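(* Let $\alpha\in(0,1)$ and let $X$ be a nonnegative random variable with distribution function $F$. Let $c,(k_n),\ell_1,A,\ell,\delta,M_R,\gamma,G_\lambda$ be as in the context, and assume that for all sufficiently large $x$ $$1-F(x)=\frac{\ell(x)}{x^{\alpha}}\,[M_R(\delta(x))+h_R(x)],$$ where $h_R$ is right-continuous and $\lim_{n\to\infty}h_R(A_{k_n}x)=0$ for every continuity point $x>0$ of $M_R$. Put $U(y)=\sum_{n=0}^\infty F^{*n}(y)$ (the renewal function, $F^{*n}$ being the $n$-fold convolution power) and $B(x)=x^\alpha\ell(x)^{-1}$. Then $$\lim_{y\to\infty}\left| y^{-\alpha}\ell(y)\,U(y)-\alpha\int_0^\infty G_{\gamma(B(y)x^{-\alpha})}(x)\,x^{-\alpha-1}\,\mathrm dx\right|=0 .$$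
   Context: Setting: $c>1$; $(k_n)_{n\ge1}$ is a strictly increasing sequence of positive integers with $k_{n+1}/k_n\to c$. $\ell_1:[1,\infty)\to(0,\infty)$ is slowly varying at infinity, $A(x)=A_x=x^{1/\alpha}\ell_1(x)$, and for large $x$ the slowly varying function $\ell$ is defined by $x^{-\alpha}\ell(x)=\sup\{t\in(0,1]: t^{-1/\alpha}\ell_1(1/t)>x\}$. (Then $A$ and $B(y)=y^\alpha/\ell(y)$ are asymptotic inverses of each other.) For all large $x$ there is a unique $k_n$ with $A_{k_n}\le x<A_{k_{n+1}}$, and $\delta(x)=x/A_{k_n}$. $M_R:(0,\infty)\to(0,\infty)$ is bounded, bounded away from $0$, right-continuous, not constant, satisfies $M_R(c^{1/\alpha}x)=M_R(x)$ for all $x>0$, and $x\mapsto M_R(x)x^{-\alpha}$ is nonincreasing. Position parameter: $\gamma(x)=\gamma_x=x/k_n$ where $k_{n-1}<x\le k_n$ (with the convention $k_0=0$). For $\lambda>0$ let $\Lambda_\lambda$ be the measure on $(0,\infty)$ with $\Lambda_\lambda((x,\infty))=x^{-\alpha}M_R(\lambda^{1/\alpha}x)$, $x>0$, and let $V_\lambda$ be the (nonnegative, semistable) random variable with characteristic function $\mathbb E e^{\mathrm itV_\lambda}=\exp\{\int_0^\infty(e^{\mathrm itx}-1)\Lambda_\lambda(\mathrm dx)\}$ (no centering is used when $\alpha<1$). $G_\lambda$ denotes the distribution function of $V_\lambda$. Note $G_{c\lambda}=G_\lambda$. *)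

theory Defs
  imports "HOL-Probability.Probability"
begin

text \<open>
  Slow variation at infinity of a positive function given on \<open>[a, \<infinity>)\<close>. Borel measurability is
  part of the notion, as in Karamata's theory.
\<close>

definition slowly_varying_from :: "real \<Rightarrow> (real \<Rightarrow> real) \<Rightarrow> bool" where
  "slowly_varying_from a f \<longleftrightarrow>
     f \<in> borel_measurable (restrict_space borel {a..}) \<and>
     (\<forall>x\<ge>a. f x > 0) \<and>
     (\<forall>t>0. ((\<lambda>x. f (t * x) / f x) \<longlongrightarrow> 1) at_top)"

definition norming :: "real \<Rightarrow> (real \<Rightarrow> real) \<Rightarrow> real \<Rightarrow> real" where
  "norming \<alpha> l1 x = x powr (1 / \<alpha>) * l1 x"

text \<open>
  The factor \<open>\<ell>\<close> with \<open>x\<^sup>-\<^sup>\<alpha> \<ell>(x) = sup {t \<in> (0,1]. t\<^sup>-\<^sup>1\<^sup>/\<^sup>\<alpha> \<ell>\<^sub>1(1/t) > x}\<close>. For slowly varying \<open>\<ell>\<^sub>1\<close> and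
  \<open>0 < \<alpha>\<close> the set is nonempty and bounded for every \<open>x\<close>, so the real supremum is meaningful.
\<close>

definition ell :: "real \<Rightarrow> (real \<Rightarrow> real) \<Rightarrow> real \<Rightarrow> real" where
  "ell \<alpha> l1 x = x powr \<alpha> * Sup {t. 0 < t \<and> t \<le> 1 \<and> t powr (- (1 / \<alpha>)) * l1 (1 / t) > x}"

definition inv_norming :: "real \<Rightarrow> (real \<Rightarrow> real) \<Rightarrow> real \<Rightarrow> real" where
  "inv_norming \<alpha> l1 y = y powr \<alpha> / ell \<alpha> l1 y"

text \<open>
  The sequence \<open>k\<close> is indexed from 1, with \<open>k 0 = 0\<close> as a convention; hence \<open>n \<ge> 1\<close> below.
  The index in \<open>delta\<close> is unique only for large \<open>x\<close>; elsewhere the value is irrelevant.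
\<close>

definition delta :: "real \<Rightarrow> (real \<Rightarrow> real) \<Rightarrow> (nat \<Rightarrow> nat) \<Rightarrow> real \<Rightarrow> real" where
  "delta \<alpha> l1 k x =
     x / norming \<alpha> l1 (real (k (THE n. n \<ge> 1 \<and>
           norming \<alpha> l1 (real (k n)) \<le> x \<and> x < norming \<alpha> l1 (real (k (Suc n))))))"

definition pos_param :: "(nat \<Rightarrow> nat) \<Rightarrow> real \<Rightarrow> real" where
  "pos_param k x =
     x / real (k (THE n. n \<ge> 1 \<and> real (k (n - 1)) < x \<and> x \<le> real (k n)))"

definition is_tail_measure :: "real \<Rightarrow> (real \<Rightarrow> real) \<Rightarrow> real \<Rightarrow> real measure \<Rightarrow> bool" where
  "is_tail_measure \<alpha> M lam \<Lambda> \<longleftrightarrow>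
     sets \<Lambda> = sets borel \<and> emeasure \<Lambda> {..0} = 0 \<and>
     (\<forall>x>0. emeasure \<Lambda> {x<..} = ennreal (x powr (- \<alpha>) * M (lam powr (1 / \<alpha>) * x)))"

text \<open>Convolution powers of a law on the real line; the zeroth power is the point mass at 0.\<close>

primrec conv_pow :: "real measure \<Rightarrow> nat \<Rightarrow> real measure" where
  "conv_pow \<mu> 0 = return borel 0"
| "conv_pow \<mu> (Suc n) = convolution \<mu> (conv_pow \<mu> n)"

definition renewal_fun :: "real measure \<Rightarrow> real \<Rightarrow> real" where
  "renewal_fun \<mu> y = (\<Sum>n. cdf (conv_pow \<mu> n) y)"

end

theory Submission
  imports Defs "HOL-Real_Asymp.Real_Asymp"
begin

text \<open>
  Let \<open>S\<^sub>n\<close> be the random walk with step law \<open>\<mu>\<close>, and \<open>B\<close> the asymptotic inverse of the norming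
  function \<open>A\<close>, so that \<open>y\<^sup>-\<^sup>\<alpha> \<ell>(y) = 1 / B(y)\<close>. Reading the renewal sum as the integral of a step
  function and rescaling \<open>n = B(y) u\<close> gives \<open>U(y) / B(y) = \<integral> P(S\<^bsub>\<lfloor>B(y) u\<rfloor>\<^esub> \<le> y) du\<close> over \<open>(0, \<infinity>)\<close>
  (lemma \<open>renewal_integral\<close>), while the substitution \<open>u = x\<^sup>-\<^sup>\<alpha>\<close> turns the semistable term into
  \<open>\<integral> G\<^bsub>\<gamma>(B(y) u)\<^esub>(u\<^bsup>-1/\<alpha>\<^esup>) du\<close> (lemma \<open>powr_substitution\<close>). It remains to see that the two
  integrands merge for each fixed \<open>u\<close> and to find an integrable majorant.

  Merging (lemma \<open>merging\<close>) is a compactness argument. Along a subsequence the position \<open>\<gamma>(B(y) u)\<close>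
  tends to some \<open>\<lambda> > 0\<close>; with \<open>k\<^sub>n\<close> the block of \<open>B(y) u\<close> the number of summands is then \<open>\<sim> \<lambda> k\<^sub>n\<close>
  and \<open>y \<sim> (\<lambda> / u)\<^bsup>1/\<alpha>\<^esup> A(k\<^sub>n)\<close>. Both integrands therefore tend to \<open>G\<^sub>\<lambda>(u\<^bsup>-1/\<alpha>\<^esup>)\<close>, provided that
  \<open>S\<^sub>N / (\<lambda>\<^bsup>1/\<alpha>\<^esup> A(k\<^sub>n))\<close> converges in law to \<open>V\<^sub>\<lambda>\<close> whenever \<open>N / k\<^sub>n \<rightarrow> \<lambda>\<close> (lemma
  \<open>conv_pow_cdf_limit\<close>) and that \<open>G\<^sub>\<lambda>(x)\<close> is jointly continuous (lemma \<open>V_cdf_joint_limit\<close>).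

  The limit theorem rests on \<open>k\<^sub>n P(X > A(k\<^sub>n) x) \<rightarrow> x\<^sup>-\<^sup>\<alpha> M(x)\<close> at continuity points of \<open>M\<close> (lemma
  \<open>tail_limit\<close>), which needs the uniform convergence theorem for slowly varying functions, the
  inversion \<open>B(A(v) x) \<sim> x\<^sup>\<alpha> v\<close> and the logarithmic periodicity of \<open>M\<close>. Convergence of tails gives
  convergence of \<open>k\<^sub>n (E exp(i t X / A(k\<^sub>n)) - 1)\<close> to the Levy exponent (lemma \<open>exponent_limit\<close>): away from \<open>0\<close> this is Levy's continuity theorem for normalised
  restrictions, and near \<open>0\<close> everything is negligible because \<open>\<alpha> < 1\<close> leaves room for a uniform tail
  bound \<open>C x\<^sup>-\<^sup>\<rho>\<close> with \<open>\<rho> < 1\<close> (lemma \<open>tail_power_bound\<close>).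

  Finally, a semistable Levy measure has so much mass near \<open>0\<close> that
  \<open>\<bar>E exp(i t V\<^sub>\<lambda>)\<bar> \<le> exp(- \<kappa> \<bar>t\<bar>\<^sup>\<alpha>)\<close> with \<open>\<kappa>\<close> independent of \<open>\<lambda>\<close> (lemma \<open>exponent_decay\<close>). By Levy
  inversion all \<open>G\<^sub>\<lambda>\<close> are Lipschitz with one constant; since \<open>V\<^sub>\<lambda>\<close> is nonnegative as a limit of
  nonnegative variables, \<open>G\<^sub>\<lambda>(x) \<le> D x\<close>. At \<open>x = u\<^bsup>-1/\<alpha>\<^esup>\<close> with \<open>1 / \<alpha> > 1\<close> this is integrable at
  infinity, and \<open>P(S\<^sub>n \<le> y) \<le> F(y)\<^sup>n\<close> decays exponentially in \<open>u\<close>.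
\<close>

section \<open>Uniform convergence for slowly varying functions\<close>

lemma integrable_indicator_Icc [simp]: "integrable lborel (indicator {a..b::real} :: real \<Rightarrow> real)"
  by (rule integrable_real_indicator) (auto simp: emeasure_lborel_Icc_eq)

text \<open>
  Karamata's uniform convergence theorem in additive form. Dominated convergence makes the averages
  of the truncated increments \<open>min 1 \<bar>L (x + s) - L x\<bar>\<close> over bounded windows of \<open>s\<close> vanish, seen from
  \<open>x n\<close> as well as from \<open>x n + u n\<close>. The two base points can be compared through a common point
  \<open>x n + u n + s\<close>, and averaging the triangle inequality over \<open>s\<close> removes it. This is where
  measurability of slowly varying functions enters.
\<close>

lemma uniform_convergence_additive:
  fixes L :: "real \<Rightarrow> real"
  assumes meas [measurable]: "L \<in> borel_measurable borel"
    and lim: "\<And>s. ((\<lambda>x. L (x + s) - L x) \<longlongrightarrow> 0) at_top"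
    and x: "filterlim x at_top sequentially"
    and u: "\<And>n. \<bar>u n\<bar> \<le> R"
  shows "(\<lambda>n. L (x n + u n) - L (x n)) \<longlonglongrightarrow> 0"
proof -
  have R: "0 \<le> R" using u[of 0] by linarith
  define f where "f z s = min 1 \<bar>L (z + s) - L z\<bar>" for z s :: real
  have f_meas [measurable]: "f z \<in> borel_measurable borel" for z
    unfolding f_def by measurable
  have f_bd: "\<bar>f z s\<bar> \<le> 1" "0 \<le> f z s" for z s by (auto simp: f_def)
  have key: "(\<lambda>n. LBINT s. indicator {a..b} s * f (z n) s) \<longlonglongrightarrow> 0"
    if z: "filterlim z at_top sequentially" for z :: "nat \<Rightarrow> real" and a b :: real
  proof -
    have "(\<lambda>n. LBINT s. indicator {a..b} s * f (z n) s) \<longlonglongrightarrow> (LBINT (s::real). 0)"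
    proof (rule integral_dominated_convergence[where w="indicator {a..b} :: real \<Rightarrow> real"])
      show "AE s in lborel. (\<lambda>n. indicator {a..b} s * f (z n) s) \<longlonglongrightarrow> 0"
      proof (rule AE_I2)
        fix s :: real
        have "(\<lambda>n. L (z n + s) - L (z n)) \<longlonglongrightarrow> 0"
          using filterlim_compose[OF lim z] by simp
        then have "(\<lambda>n. f (z n) s) \<longlonglongrightarrow> min 1 \<bar>0\<bar>"
          unfolding f_def by (intro tendsto_min tendsto_const tendsto_rabs)
        then have "(\<lambda>n. indicator {a..b} s * f (z n) s) \<longlonglongrightarrow> indicator {a..b} s * 0"
          by (intro tendsto_mult tendsto_const) simp
        then show "(\<lambda>n. indicator {a..b} s * f (z n) s) \<longlonglongrightarrow> 0" by simp
      qed
    qed (use f_bd in \<open>auto simp: abs_mult intro!: mult_left_le\<close>)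
    then show ?thesis by simp
  qed
  have int: "integrable lborel (\<lambda>s. indicator {a..b} s * f z s)" for a b z
    by (rule Bochner_Integration.integrable_bound[where f="indicator {a..b} :: real \<Rightarrow> real"])
       (use f_bd in \<open>auto simp: abs_mult intro!: mult_left_le\<close>)
  have xu: "filterlim (\<lambda>n. x n + u n) at_top sequentially"
  proof (rule filterlim_at_top_mono)
    show "filterlim (\<lambda>n. - R + x n) at_top sequentially"
      by (rule filterlim_tendsto_add_at_top[OF tendsto_const x])
    show "\<forall>\<^sub>F n in sequentially. - R + x n \<le> x n + u n"
    proof (rule always_eventually, rule allI)
      fix n show "- R + x n \<le> x n + u n" using u[of n] by linarith
    qed
  qed
  \<comment> \<open>The window \<open>[0, 1]\<close> seen from \<open>x n + u n\<close> lies in the window \<open>[- R, R + 1]\<close> seen from \<open>x n\<close>.\<close>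
  have bound: "min 1 \<bar>L (x n + u n) - L (x n)\<bar>
      \<le> (LBINT s. indicator {0..1} s * f (x n + u n) s)
         + (LBINT s. indicator {- R..R + 1} s * f (x n) s)" for n
  proof -
    let ?c = "min 1 \<bar>L (x n + u n) - L (x n)\<bar>"
    have int2: "integrable lborel (\<lambda>s. indicator {0..1} s * f (x n) (u n + s))"
      by (rule Bochner_Integration.integrable_bound[where f="indicator {0..1} :: real \<Rightarrow> real"])
         (use f_bd in \<open>auto simp: abs_mult intro!: mult_left_le\<close>)
    have "?c = (LBINT s. indicator {0..1::real} s * ?c)" by simp
    also have "\<dots> \<le> (LBINT s. indicator {0..1} s * f (x n + u n) s
        + indicator {0..1} s * f (x n) (u n + s))"
    proof (rule integral_mono)
      show "integrable lborel (\<lambda>s. indicator {0..1::real} s * ?c)" by simp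
      fix s :: real
      have "?c \<le> f (x n + u n) s + f (x n) (u n + s)"
        unfolding f_def add.assoc[symmetric] by linarith
      then show "indicator {0..1} s * ?c \<le> indicator {0..1} s * f (x n + u n) s
        + indicator {0..1} s * f (x n) (u n + s)"
        by (auto simp: indicator_def)
    qed (intro Bochner_Integration.integrable_add int int2)
    also have "\<dots> = (LBINT s. indicator {0..1} s * f (x n + u n) s)
        + (LBINT s. indicator {0..1} s * f (x n) (u n + s))"
      by (rule Bochner_Integration.integral_add[OF int int2])
    also have "(LBINT s. indicator {0..1} s * f (x n) (u n + s))
        = (LBINT s. indicator {u n..u n + 1} s * f (x n) s)"
      by (subst lborel_integral_real_affine[where c=1 and t="u n"])
         (auto intro!: Bochner_Integration.integral_cong simp: indicator_def)
    also have "\<dots> \<le> (LBINT s. indicator {- R..R + 1} s * f (x n) s)"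
      using u[of n] f_bd(2) by (intro integral_mono int) (auto simp: indicator_def)
    finally show ?thesis by simp
  qed
  have min_lim: "(\<lambda>n. min 1 \<bar>L (x n + u n) - L (x n)\<bar>) \<longlonglongrightarrow> 0"
  proof (rule tendsto_sandwich[of "\<lambda>_. 0"])
    show "(\<lambda>n. (LBINT s. indicator {0..1} s * f (x n + u n) s)
         + (LBINT s. indicator {- R..R + 1} s * f (x n) s)) \<longlonglongrightarrow> 0"
      using tendsto_add[OF key[OF xu] key[OF x]] by simp
    show "\<forall>\<^sub>F n in sequentially. min 1 \<bar>L (x n + u n) - L (x n)\<bar>
        \<le> (LBINT s. indicator {0..1} s * f (x n + u n) s)
         + (LBINT s. indicator {- R..R + 1} s * f (x n) s)"
      by (rule always_eventually, rule allI, rule bound)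
  qed (auto simp: always_eventually)
  then have "\<forall>\<^sub>F n in sequentially. min 1 \<bar>L (x n + u n) - L (x n)\<bar> < 1"
    by (rule order_tendstoD) simp
  then have "(\<lambda>n. \<bar>L (x n + u n) - L (x n)\<bar>) \<longlonglongrightarrow> 0"
    by (intro Lim_transform_eventually[OF min_lim]) (auto elim!: eventually_mono)
  then show ?thesis by (simp add: tendsto_rabs_zero_iff)
qed

text \<open>
  The multiplicative form follows for \<open>L x = ln (f (exp x))\<close>; the maximum with \<open>a\<close> only extends \<open>f\<close>
  to the whole line.
\<close>

lemma slowly_varying_uniform:
  assumes sv: "slowly_varying_from a f"
    and v: "filterlim v at_top sequentially"
    and t: "\<And>n. p \<le> t n" "\<And>n. t n \<le> q" and p: "0 < p"
  shows "(\<lambda>n. f (t n * v n) / f (v n)) \<longlonglongrightarrow> 1"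
proof -
  define L where "L x = ln (f (max a (exp x)))" for x
  have fpos: "\<And>x. a \<le> x \<Longrightarrow> 0 < f x"
    and f_lim: "\<And>t. 0 < t \<Longrightarrow> ((\<lambda>x. f (t * x) / f x) \<longlongrightarrow> 1) at_top"
    and f_meas: "f \<in> borel_measurable (restrict_space borel {a..})"
    using sv by (auto simp: slowly_varying_from_def)
  have tpos: "0 < t n" for n using t(1)[of n] p by linarith
  have "(\<lambda>x. f (max a (exp x))) \<in> borel_measurable borel"
    by (rule measurable_compose[OF _ f_meas]) (simp add: measurable_restrict_space2_iff)
  then have L_meas: "L \<in> borel_measurable borel" unfolding L_def by measurable
  have L_eq: "\<forall>\<^sub>F x in at_top. L (x + s) = ln (f (exp s * exp x))" for s
  proof -
    have "\<forall>\<^sub>F x in at_top. a \<le> exp s * exp x"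
      by (rule filterlim_at_top[THEN iffD1, rule_format], rule filterlim_tendsto_pos_mult_at_top)
         (auto intro: exp_at_top)
    then show ?thesis by eventually_elim (simp add: L_def exp_add mult.commute max_absorb2)
  qed
  have L_lim: "((\<lambda>x. L (x + s) - L x) \<longlongrightarrow> 0) at_top" for s
  proof -
    have "((\<lambda>x. ln (f (exp s * exp x) / f (exp x))) \<longlongrightarrow> ln 1) at_top"
      by (intro tendsto_ln filterlim_compose[OF f_lim exp_at_top]) auto
    moreover have "\<forall>\<^sub>F x in at_top. ln (f (exp s * exp x) / f (exp x)) = L (x + s) - L x"
    proof -
      have "\<forall>\<^sub>F x in at_top. a \<le> exp s * exp x"
        by (rule filterlim_at_top[THEN iffD1, rule_format], rule filterlim_tendsto_pos_mult_at_top)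
           (auto intro: exp_at_top)
      moreover have "\<forall>\<^sub>F x in at_top. a \<le> exp x"
        by (rule filterlim_at_top[THEN iffD1, rule_format], rule exp_at_top)
      ultimately show ?thesis using L_eq[of s] L_eq[of 0]
        by eventually_elim (simp add: ln_div fpos less_imp_neq[THEN not_sym])
    qed
    ultimately show ?thesis using Lim_transform_eventually by fastforce
  qed
  have lnv: "filterlim (\<lambda>n. ln (v n)) at_top sequentially"
    by (rule filterlim_compose[OF ln_at_top v])
  have lnt: "\<bar>ln (t n)\<bar> \<le> max \<bar>ln p\<bar> \<bar>ln q\<bar>" for n
  proof -
    have "ln p \<le> ln (t n)" "ln (t n) \<le> ln q" using t[of n] p tpos[of n] by auto
    then show ?thesis by linarith
  qed
  have "(\<lambda>n. exp (L (ln (v n) + ln (t n)) - L (ln (v n)))) \<longlonglongrightarrow> exp 0"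
    by (rule tendsto_exp[OF uniform_convergence_additive[OF L_meas L_lim lnv lnt]])
  moreover have "\<forall>\<^sub>F n in sequentially.
      exp (L (ln (v n) + ln (t n)) - L (ln (v n))) = f (t n * v n) / f (v n)"
    using v[unfolded filterlim_at_top, rule_format, of "max 1 (max a (a / p))"]
  proof eventually_elim
    case (elim n)
    have v1: "1 \<le> v n" "a \<le> v n" "a / p \<le> v n" using elim by auto
    have "a \<le> p * v n" using v1(3) p by (simp add: field_simps)
    also have "\<dots> \<le> t n * v n" using t(1)[of n] v1(1) by (intro mult_right_mono) auto
    finally have tv: "a \<le> t n * v n" .
    have "L (ln (v n) + ln (t n)) = ln (f (t n * v n))"
      using v1 tpos[of n] tv by (simp add: L_def exp_add mult.commute max_absorb2)
    moreover have "L (ln (v n)) = ln (f (v n))"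
      using v1 by (simp add: L_def max_absorb2)
    ultimately show ?case using fpos[OF tv] fpos[OF v1(2)] by (simp add: exp_diff)
  qed
  ultimately show ?thesis using Lim_transform_eventually by fastforce
qed

section \<open>The norming function and its asymptotic inverse\<close>

locale regular_norming =
  fixes \<alpha> :: real and l1 :: "real \<Rightarrow> real"
  assumes alpha_pos: "0 < \<alpha>" and slow: "slowly_varying_from 1 l1"
begin

abbreviation "A \<equiv> norming \<alpha> l1"
abbreviation "B \<equiv> inv_norming \<alpha> l1"

lemma A_pos: "1 \<le> v \<Longrightarrow> 0 < A v"
  using slow by (auto simp: norming_def slowly_varying_from_def)

text \<open>
  Here \<open>t\<close> need not converge, only stay in a compact subset of \<open>(0, \<infinity>)\<close>. This is what allows an
  unknown but bounded ratio to be determined from its norming values in lemma \<open>B_A\<close>.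
\<close>

lemma A_ratio_uniform:
  assumes v: "filterlim v at_top sequentially"
    and t: "\<And>n. p \<le> t n" "\<And>n. t n \<le> q" and p: "0 < p"
  shows "(\<lambda>n. A (t n * v n) / A (v n) / t n powr (1 / \<alpha>)) \<longlonglongrightarrow> 1"
proof (rule Lim_transform_eventually[OF slowly_varying_uniform[OF slow v t p]])
  show "\<forall>\<^sub>F n in sequentially. l1 (t n * v n) / l1 (v n) = A (t n * v n) / A (v n) / t n powr (1 / \<alpha>)"
    using v[unfolded filterlim_at_top, rule_format, of 1]
  proof eventually_elim
    case (elim n)
    have "0 < t n" using t(1)[of n] p by linarith
    then show ?case using elim by (simp add: norming_def powr_mult)
  qed
qed

lemma A_ratio:
  assumes v: "filterlim v at_top sequentially" and t: "t \<longlonglongrightarrow> s" and s: "0 < s"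
  shows "(\<lambda>n. A (t n * v n) / A (v n)) \<longlonglongrightarrow> s powr (1 / \<alpha>)"
proof -
  define t' where "t' n = max (s / 2) (min (2 * s) (t n))" for n
  have "t' \<longlonglongrightarrow> max (s / 2) (min (2 * s) s)"
    unfolding t'_def by (intro tendsto_max tendsto_min tendsto_const t)
  then have t': "t' \<longlonglongrightarrow> s" using s by simp
  have "(\<lambda>n. A (t' n * v n) / A (v n) / t' n powr (1 / \<alpha>)) \<longlonglongrightarrow> 1"
    by (rule A_ratio_uniform[OF v, where p="s / 2" and q="2 * s"]) (use s in \<open>auto simp: t'_def\<close>)
  moreover have "(\<lambda>n. t' n powr (1 / \<alpha>)) \<longlonglongrightarrow> s powr (1 / \<alpha>)"
    using s by (intro tendsto_powr t' tendsto_const) simp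
  ultimately have "(\<lambda>n. A (t' n * v n) / A (v n) / t' n powr (1 / \<alpha>) * t' n powr (1 / \<alpha>))
      \<longlonglongrightarrow> 1 * s powr (1 / \<alpha>)"
    by (rule tendsto_mult)
  then have "(\<lambda>n. A (t' n * v n) / A (v n) / t' n powr (1 / \<alpha>) * t' n powr (1 / \<alpha>)) \<longlonglongrightarrow> s powr (1 / \<alpha>)"
    by simp
  moreover have "\<forall>\<^sub>F n in sequentially. A (t' n * v n) / A (v n) / t' n powr (1 / \<alpha>) * t' n powr (1 / \<alpha>)
      = A (t n * v n) / A (v n)"
  proof -
    have "\<forall>\<^sub>F n in sequentially. s / 2 < t n" "\<forall>\<^sub>F n in sequentially. t n < 2 * s"
      using s by (auto intro: order_tendstoD[OF t] simp del: less_divide_eq_numeral1 divide_less_eq_numeral1)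
    then show ?thesis
    proof eventually_elim
      case (elim n)
      then have "t' n = t n" "t n > 0" using s by (auto simp: t'_def)
      then show ?case by simp
    qed
  qed
  ultimately show ?thesis by (rule Lim_transform_eventually)
qed

text \<open>
  A lower Potter bound: up to the factor \<open>1 / 2\<close>, the norming function grows at least geometrically
  along doublings. One doubling multiplies \<open>A\<close> by nearly \<open>2 powr (1 / \<alpha>)\<close>, and within one doubling
  \<open>A\<close> drops by at most a factor \<open>2\<close>.
\<close>

lemma A_potter:
  obtains w0 q where "1 \<le> w0" "1 < q"
    "\<And>i w v. w0 \<le> w \<Longrightarrow> 2 ^ i * w \<le> v \<Longrightarrow> q ^ i * A w / 2 \<le> A v"
proof -
  \<comment> \<open>Any number strictly between \<open>1\<close> and the limit of \<open>A (2 * w) / A w\<close> would do.\<close>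
  define q where "q = (1 + 2 powr (1 / \<alpha>)) / 2"
  have two: "1 < (2::real) powr (1 / \<alpha>)" using alpha_pos by simp
  then have q: "1 < q" "q < 2 powr (1 / \<alpha>)" by (auto simp: q_def)
  have "((\<lambda>w. A (2 * w) / A w) \<longlongrightarrow> 2 powr (1 / \<alpha>)) at_top"
    by (rule tendsto_at_topI_sequentially) (rule A_ratio[OF _ tendsto_const], simp_all)
  then have "\<forall>\<^sub>F w in at_top. q < A (2 * w) / A w" using q(2) by (rule order_tendstoD)
  then obtain w3 where w3: "\<And>w. w3 \<le> w \<Longrightarrow> q < A (2 * w) / A w"
    unfolding eventually_at_top_linorder by blast
  have "q * A w \<le> A (2 * w)" if "max 1 w3 \<le> w" for w
    using w3[of w] A_pos[of w] that by (simp add: pos_less_divide_eq)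
  then have "\<exists>w1\<ge>1. \<forall>w\<ge>w1. q * A w \<le> A (2 * w)" by (intro exI[of _ "max 1 w3"]) auto
  then obtain w1 where w1: "1 \<le> w1" "\<And>w. w1 \<le> w \<Longrightarrow> q * A w \<le> A (2 * w)" by blast
  have "\<exists>w2\<ge>1. \<forall>w\<ge>w2. \<forall>s. 1 \<le> s \<and> s \<le> 2 \<longrightarrow> A w / 2 \<le> A (s * w)"
  proof (rule ccontr)
    assume *: "\<not> ?thesis"
    have "\<exists>w s. real n + 1 \<le> w \<and> 1 \<le> s \<and> s \<le> 2 \<and> A (s * w) < A w / 2" for n :: nat
    proof (rule ccontr)
      assume "\<nexists>w s. real n + 1 \<le> w \<and> 1 \<le> s \<and> s \<le> 2 \<and> A (s * w) < A w / 2"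
      then have "\<forall>w\<ge>real n + 1. \<forall>s. 1 \<le> s \<and> s \<le> 2 \<longrightarrow> A w / 2 \<le> A (s * w)" by (auto simp: not_less)
      moreover have "1 \<le> real n + 1" by simp
      ultimately show False using * by blast
    qed
    then obtain w s where w: "\<And>n::nat. real n + 1 \<le> w n" and s: "\<And>n::nat. 1 \<le> s n" "\<And>n. s n \<le> 2"
      and lt: "\<And>n. A (s n * w n) < A (w n) / 2" by metis
    have wlim: "filterlim w at_top sequentially"
    proof (rule filterlim_at_top_mono[OF filterlim_real_sequentially always_eventually], rule allI)
      fix n show "real n \<le> w n" using w(1)[of n] by linarith
    qed
    have "(\<lambda>n. A (s n * w n) / A (w n) / s n powr (1 / \<alpha>)) \<longlonglongrightarrow> 1"
      by (rule A_ratio_uniform[OF wlim s]) simp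
    then have "\<forall>\<^sub>F n in sequentially. 1 / 2 < A (s n * w n) / A (w n) / s n powr (1 / \<alpha>)"
      by (rule order_tendstoD) simp
    then obtain n where n: "1 / 2 < A (s n * w n) / A (w n) / s n powr (1 / \<alpha>)"
      by (auto simp: eventually_sequentially)
    have Aw: "0 < A (w n)" using w(1)[of n] by (intro A_pos) linarith
    have sp: "1 \<le> s n powr (1 / \<alpha>)" using s(1)[of n] alpha_pos by (simp add: ge_one_powr_ge_zero)
    have "1 / 2 * s n powr (1 / \<alpha>) < A (s n * w n) / A (w n)"
      by (rule pos_less_divide_eq[THEN iffD1, OF _ n]) (use sp in linarith)
    then have "1 / 2 < A (s n * w n) / A (w n)" using sp by linarith
    then show False using lt[of n] Aw by (simp add: field_simps)
  qed
  then obtain w2 where w2: "1 \<le> w2" "\<And>w s. w2 \<le> w \<Longrightarrow> 1 \<le> s \<Longrightarrow> s \<le> 2 \<Longrightarrow> A w / 2 \<le> A (s * w)"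
    by blast
  define w0 where "w0 = max w1 w2"
  have base: "w0 \<le> w \<Longrightarrow> w \<le> v \<Longrightarrow> v \<le> 2 ^ j * w \<Longrightarrow> A w / 2 \<le> A v" for j w v
  proof (induction j arbitrary: v)
    case 0
    then have "v = w" by simp
    moreover have "0 < A w" using 0 w1(1) by (intro A_pos) (simp add: w0_def)
    ultimately show ?case by simp
  next
    case (Suc j)
    have w: "1 \<le> w" "w1 \<le> w" "w2 \<le> w" using Suc.prems w1(1) by (auto simp: w0_def)
    show ?case
    proof (cases "v \<le> 2 * w")
      case True
      then have "A w / 2 \<le> A (v / w * w)"
        using Suc.prems(2) w by (intro w2(2)) (auto simp: field_simps)
      then show ?thesis using w by simp
    next
      case False
      then have ih: "A w / 2 \<le> A (v / 2)" using Suc by auto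
      have "0 < A (v / 2)" using False w by (intro A_pos) auto
      then have "A (v / 2) \<le> q * A (v / 2)" using q by simp
      also have "\<dots> \<le> A (2 * (v / 2))" using False w by (intro w1(2)) auto
      finally show ?thesis using ih by simp
    qed
  qed
  have "w0 \<le> w \<Longrightarrow> 2 ^ i * w \<le> v \<Longrightarrow> q ^ i * A w / 2 \<le> A v" for i w v
  proof (induction i arbitrary: v)
    case 0
    have "0 < w" using 0 w1(1) by (simp add: w0_def)
    obtain j where "v / w < 2 ^ j" using real_arch_pow[of 2 "v / w"] by auto
    then show ?case using 0 \<open>0 < w\<close> by (intro order_trans[OF _ base[of w v j]]) (auto simp: field_simps)
  next
    case (Suc i)
    have w: "1 \<le> w" "w1 \<le> w" using Suc.prems w1(1) by (auto simp: w0_def)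
    have "w \<le> 2 ^ i * w" using w by (simp add: one_le_power)
    then have v2: "w \<le> v / 2" using Suc.prems by simp
    have "q ^ Suc i * A w / 2 \<le> q * A (v / 2)"
      using Suc q by (simp add: field_simps)
    also have "\<dots> \<le> A (2 * (v / 2))" using v2 w by (intro w1(2)) auto
    finally show ?case by simp
  qed
  moreover have "1 \<le> w0" using w1(1) by (simp add: w0_def)
  ultimately show ?thesis using that q(1) by blast
qed

lemma A_at_top: "filterlim A at_top at_top"
proof -
  obtain w0 q where w0: "1 \<le> w0" and q: "1 < q"
    and P: "\<And>i w v. w0 \<le> w \<Longrightarrow> 2 ^ i * w \<le> v \<Longrightarrow> q ^ i * A w / 2 \<le> A v"
    using A_potter by blast
  show ?thesis
    unfolding filterlim_at_top
  proof
    fix Z :: real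
    have A0: "0 < A w0" by (rule A_pos[OF w0])
    obtain i where "2 * Z / A w0 < q ^ i" using real_arch_pow[OF q] by blast
    then have "Z \<le> q ^ i * A w0 / 2" using A0 by (simp add: field_simps)
    then have "\<forall>v\<ge>2 ^ i * w0. Z \<le> A v" using P[of w0 i] by fastforce
    then show "\<forall>\<^sub>F v in at_top. Z \<le> A v" by (auto simp: eventually_at_top_linorder)
  qed
qed

text \<open>
  The supremum in the definition of \<open>ell\<close>; its reciprocal is the generalised inverse
  \<open>inf {v \<ge> 1. y < A v}\<close> of \<open>A\<close>, which is exactly \<open>inv_norming\<close>.
\<close>

definition tail_scale :: "real \<Rightarrow> real" where
  "tail_scale y = Sup {t. 0 < t \<and> t \<le> 1 \<and> y < A (1 / t)}"

lemma ell_eq: "ell \<alpha> l1 y = y powr \<alpha> * tail_scale y"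
proof -
  have "{t. 0 < t \<and> t \<le> 1 \<and> t powr (- (1 / \<alpha>)) * l1 (1 / t) > y}
      = {t. 0 < t \<and> t \<le> 1 \<and> y < A (1 / t)}"
    by (auto simp: norming_def powr_minus_divide powr_divide)
  then show ?thesis by (simp add: ell_def tail_scale_def)
qed

lemma tail_scale_set_nonempty: "\<exists>t. 0 < t \<and> t \<le> 1 \<and> y < A (1 / t)"
proof -
  have "\<forall>\<^sub>F v in at_top. y < A v" "\<forall>\<^sub>F v in at_top. (1::real) \<le> v"
    using A_at_top by (auto simp: filterlim_at_top_dense)
  then have "\<forall>\<^sub>F v in at_top. y < A v \<and> 1 \<le> v" by eventually_elim auto
  then obtain v where "y < A v" "1 \<le> v" by (auto simp: eventually_at_top_linorder)
  then show ?thesis by (intro exI[of _ "1 / v"]) auto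
qed

lemma tail_scale_upper: "0 < t \<Longrightarrow> t \<le> 1 \<Longrightarrow> y < A (1 / t) \<Longrightarrow> t \<le> tail_scale y"
  unfolding tail_scale_def by (rule cSup_upper) (auto intro!: bdd_aboveI[of _ 1])

lemma tail_scale_pos: "0 < tail_scale y"
  using tail_scale_set_nonempty[of y] tail_scale_upper[of _ y] by fastforce

lemma tail_scale_le_1: "tail_scale y \<le> 1"
  unfolding tail_scale_def using tail_scale_set_nonempty[of y] by (intro cSup_least) auto

lemma inv_norming_eq: "0 < y \<Longrightarrow> B y = 1 / tail_scale y"
  by (simp add: inv_norming_def ell_eq)

lemma ell_over_powr: "0 < y \<Longrightarrow> ell \<alpha> l1 y / y powr \<alpha> = 1 / B y"
  by (simp add: inv_norming_eq ell_eq)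

lemma B_ge_1: "0 < y \<Longrightarrow> 1 \<le> B y"
  using tail_scale_pos[of y] tail_scale_le_1[of y] by (simp add: inv_norming_eq)

lemma B_le: "0 < y \<Longrightarrow> 1 \<le> v \<Longrightarrow> y < A v \<Longrightarrow> B y \<le> v"
  using tail_scale_upper[of "1 / v" y] tail_scale_pos[of y] by (simp add: inv_norming_eq field_simps)

text \<open>
  Together with \<open>B_le\<close> this says that \<open>B y\<close> is the infimum of \<open>{v \<ge> 1. y < A v}\<close>.
\<close>

lemma B_less_ex:
  assumes y: "0 < y" and z: "B y < z"
  obtains v where "1 \<le> v" "B y \<le> v" "v < z" "y < A v"
proof -
  have zp: "0 < z" using B_ge_1[OF y] z by linarith
  have "1 / z < tail_scale y" using z zp tail_scale_pos[of y] y by (simp add: inv_norming_eq field_simps)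
  then obtain t where t: "0 < t" "t \<le> 1" "y < A (1 / t)" "1 / z < t"
    unfolding tail_scale_def using less_cSupE[of "1 / z"] tail_scale_set_nonempty[of y] by blast
  show ?thesis
  proof (rule that[of "1 / t"])
    show "B y \<le> 1 / t" using t by (intro B_le y) auto
  qed (use t zp in \<open>auto simp: field_simps\<close>)
qed

lemma B_mono:
  assumes "0 < y" "y \<le> y'"
  shows "B y \<le> B y'"
proof (rule dense_ge)
  fix z assume "B y' < z"
  then obtain v where v: "1 \<le> v" "v < z" "y' < A v" using B_less_ex[of y' z] assms by auto
  then have "B y \<le> v" using assms by (intro B_le) auto
  with v show "B y \<le> z" by linarith
qed

end

text \<open>
  A function that is slowly varying at infinity may be unbounded on bounded sets, and then \<open>B\<close> is
  bounded. Divergence of \<open>B\<close> is therefore a genuine hypothesis here; below it is derived from the decay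
  of the tail of the step law.
\<close>

locale regular_norming_inverse = regular_norming +
  assumes B_at_top: "filterlim B at_top at_top"
begin

text \<open>
  By definition of \<open>B\<close> as an infimum, \<open>A\<close> exceeds \<open>y\<close> somewhere just above \<open>B y\<close> and does not exceed
  it just below; the uniform convergence theorem identifies both values with \<open>A (B y)\<close>
  asymptotically.
\<close>

lemma A_B:
  assumes y: "filterlim y at_top sequentially"
  shows "(\<lambda>n. A (B (y n)) / y n) \<longlonglongrightarrow> 1"
proof -
  define b where "b n = B (y n)" for n
  have b: "filterlim b at_top sequentially"
    unfolding b_def by (rule filterlim_compose[OF B_at_top y])
  define e where "e n = 1 + 1 / (real n + 1)" for n
  have e: "e \<longlonglongrightarrow> 1" unfolding e_def by real_asymp
  have e1: "1 < e n" for n by (simp add: e_def)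
  have "\<exists>v. 0 < y n \<longrightarrow> 1 \<le> v \<and> b n \<le> v \<and> v < e n * b n \<and> y n < A v" for n
  proof (cases "0 < y n")
    case True
    then have "b n < e n * b n" using e1[of n] B_ge_1[of "y n"] by (simp add: b_def)
    with True show ?thesis unfolding b_def by (meson B_less_ex)
  qed auto
  then obtain v where v: "\<And>n. 0 < y n \<Longrightarrow> 1 \<le> v n \<and> b n \<le> v n \<and> v n < e n * b n \<and> y n < A (v n)"
    by metis
  have ev: "\<forall>\<^sub>F n in sequentially. 0 < y n \<and> 2 \<le> b n"
    using y[unfolded filterlim_at_top, rule_format, of 1] b[unfolded filterlim_at_top, rule_format, of 2]
    by eventually_elim auto
  have v_lim: "(\<lambda>n. v n / b n) \<longlonglongrightarrow> 1"
  proof (rule tendsto_sandwich[OF _ _ tendsto_const e])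
    show "\<forall>\<^sub>F n in sequentially. 1 \<le> v n / b n" "\<forall>\<^sub>F n in sequentially. v n / b n \<le> e n"
      using ev by (eventually_elim, use v in \<open>force simp: field_simps\<close>)+
  qed
  have "(\<lambda>n. A (v n / b n * b n) / A (b n)) \<longlonglongrightarrow> 1"
    using A_ratio[OF b v_lim] by simp
  then have up: "(\<lambda>n. A (v n) / A (b n)) \<longlonglongrightarrow> 1"
  proof (rule Lim_transform_eventually)
    show "\<forall>\<^sub>F n in sequentially. A (v n / b n * b n) / A (b n) = A (v n) / A (b n)"
      using ev by eventually_elim auto
  qed
  have inv: "(\<lambda>n. 1 / e n) \<longlonglongrightarrow> 1" using tendsto_divide[OF tendsto_const e, of 1] by simp
  have "(\<lambda>n. A (1 / e n * b n) / A (b n)) \<longlonglongrightarrow> 1 powr (1 / \<alpha>)"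
    by (rule A_ratio[OF b inv]) simp
  then have low: "(\<lambda>n. A (b n / e n) / A (b n)) \<longlonglongrightarrow> 1" by simp
  have "(\<lambda>n. y n / A (b n)) \<longlonglongrightarrow> 1"
  proof (rule tendsto_sandwich[OF _ _ low up])
    show "\<forall>\<^sub>F n in sequentially. y n / A (b n) \<le> A (v n) / A (b n)"
      using ev
    proof eventually_elim
      case (elim n)
      then have "0 < A (b n)" by (intro A_pos) auto
      then show ?case using v[of n] elim by (intro divide_right_mono) auto
    qed
    show "\<forall>\<^sub>F n in sequentially. A (b n / e n) / A (b n) \<le> y n / A (b n)"
      using ev
    proof eventually_elim
      case (elim n)
      have Ab: "0 < A (b n)" using elim by (intro A_pos) auto
      have "e n \<le> 2" by (simp add: e_def)
      then have be: "1 \<le> b n / e n" using elim e1[of n] by (simp add: field_simps)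
      have "b n / e n < b n" using elim e1[of n] by (simp add: field_simps)
      then have "A (b n / e n) \<le> y n"
        using B_le[of "y n" "b n / e n"] be elim by (force simp: b_def)
      then show ?case using Ab by (intro divide_right_mono) auto
    qed
  qed
  from tendsto_inverse[OF this] show ?thesis by (simp add: b_def)
qed

text \<open>
  Lemma \<open>A_B\<close> determines \<open>A (B y) / A v\<close> for \<open>y = A v * x\<close>. To read off \<open>B y / v\<close> from it, this ratio
  must first be confined to a compact set: it is bounded above since \<open>A\<close> exceeds \<open>y\<close> at a suitable
  multiple of \<open>v\<close>, and bounded away from \<open>0\<close> by the Potter bound.
\<close>

lemma B_A:
  assumes v: "filterlim v at_top sequentially" and x: "0 < x"
  shows "(\<lambda>n. B (A (v n) * x) / v n) \<longlonglongrightarrow> x powr \<alpha>"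
proof -
  define y where "y n = A (v n) * x" for n
  define b where "b n = B (y n)" for n
  define r where "r n = b n / v n" for n
  have y: "filterlim y at_top sequentially"
    unfolding y_def
    by (rule filterlim_at_top_mult_tendsto_pos[OF tendsto_const x filterlim_compose[OF A_at_top v]])
  have b: "filterlim b at_top sequentially"
    unfolding b_def by (rule filterlim_compose[OF B_at_top y])
  have ev: "\<forall>\<^sub>F n in sequentially. 1 \<le> v n \<and> 0 < y n"
    using v[unfolded filterlim_at_top, rule_format, of 1] y[unfolded filterlim_at_top, rule_format, of 1]
    by eventually_elim auto
  have "(\<lambda>n. A (b n) / y n * x) \<longlonglongrightarrow> 1 * x"
    unfolding b_def by (intro tendsto_mult tendsto_const A_B[OF y])
  then have Ab: "(\<lambda>n. A (b n) / A (v n)) \<longlonglongrightarrow> x"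
    using x by (simp add: y_def)
  define Q where "Q = (2 * x) powr \<alpha>"
  have Q: "0 < Q" using x by (simp add: Q_def)
  have "(\<lambda>n. A (Q * v n) / A (v n)) \<longlonglongrightarrow> Q powr (1 / \<alpha>)"
    by (rule A_ratio[OF v tendsto_const Q])
  moreover have "Q powr (1 / \<alpha>) = 2 * x" using x alpha_pos by (simp add: Q_def powr_powr)
  ultimately have "\<forall>\<^sub>F n in sequentially. x < A (Q * v n) / A (v n)"
    using x by (intro order_tendstoD) auto
  moreover have "\<forall>\<^sub>F n in sequentially. 1 / Q \<le> v n"
    using v by (simp add: filterlim_at_top)
  ultimately have r_up: "\<forall>\<^sub>F n in sequentially. r n \<le> Q"
    using ev
  proof eventually_elim
    case (elim n)
    have "0 < A (v n)" using elim by (intro A_pos) auto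
    then have "y n < A (Q * v n)" using elim by (simp add: y_def field_simps)
    moreover have "1 \<le> Q * v n" using elim Q by (simp add: field_simps)
    ultimately have "b n \<le> Q * v n" unfolding b_def using elim by (intro B_le) auto
    then show ?case using elim by (simp add: r_def field_simps)
  qed
  obtain w0 q where w0: "1 \<le> w0" and q: "1 < q"
    and P: "\<And>i w v. w0 \<le> w \<Longrightarrow> 2 ^ i * w \<le> v \<Longrightarrow> q ^ i * A w / 2 \<le> A v"
    using A_potter by blast
  obtain i where i: "4 / x < q ^ i" using real_arch_pow[OF q] by blast
  define p where "p = 1 / (2::real) ^ i"
  have p: "0 < p" by (simp add: p_def)
  have "\<forall>\<^sub>F n in sequentially. x / 2 < A (b n) / A (v n)"
    using x by (intro order_tendstoD[OF Ab]) auto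
  moreover have "\<forall>\<^sub>F n in sequentially. w0 \<le> b n" using b by (simp add: filterlim_at_top)
  ultimately have r_low: "\<forall>\<^sub>F n in sequentially. p \<le> r n"
    using ev
  proof eventually_elim
    case (elim n)
    show ?case
    proof (rule ccontr)
      assume "\<not> p \<le> r n"
      then have "2 ^ i * b n \<le> v n" using elim by (simp add: p_def r_def field_simps)
      then have "q ^ i * A (b n) / 2 \<le> A (v n)" using elim by (intro P) auto
      moreover have Apos: "0 < A (v n)" "0 < A (b n)" using elim w0 by (auto intro!: A_pos)
      moreover have "4 / x * A (b n) < q ^ i * A (b n)" using i Apos by (intro mult_strict_right_mono)
      ultimately have "4 / x * A (b n) < 2 * A (v n)" by linarith
      then have "A (b n) / A (v n) < x / 2" using x Apos by (simp add: field_simps)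
      then show False using elim by simp
    qed
  qed
  define r' where "r' n = (if p \<le> r n \<and> r n \<le> Q then r n else max p Q)" for n
  have "(\<lambda>n. A (r' n * v n) / A (v n) / r' n powr (1 / \<alpha>)) \<longlonglongrightarrow> 1"
    by (rule A_ratio_uniform[OF v, where p=p and q="max p Q"]) (use p in \<open>auto simp: r'_def\<close>)
  moreover have "\<forall>\<^sub>F n in sequentially. A (r' n * v n) / A (v n) / r' n powr (1 / \<alpha>)
      = A (b n) / A (v n) / r n powr (1 / \<alpha>)"
    using r_up r_low ev by eventually_elim (auto simp: r'_def r_def)
  ultimately have "(\<lambda>n. A (b n) / A (v n) / r n powr (1 / \<alpha>)) \<longlonglongrightarrow> 1"
    by (rule Lim_transform_eventually)
  from tendsto_divide[OF Ab this]
  have "(\<lambda>n. A (b n) / A (v n) / (A (b n) / A (v n) / r n powr (1 / \<alpha>))) \<longlonglongrightarrow> x" by simp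
  then have "(\<lambda>n. (A (b n) / A (v n) / (A (b n) / A (v n) / r n powr (1 / \<alpha>))) powr \<alpha>) \<longlonglongrightarrow> x powr \<alpha>"
    using x by (intro tendsto_powr tendsto_const) auto
  moreover have "\<forall>\<^sub>F n in sequentially. (A (b n) / A (v n) / (A (b n) / A (v n) / r n powr (1 / \<alpha>))) powr \<alpha>
      = B (A (v n) * x) / v n"
    using r_low ev b[unfolded filterlim_at_top, rule_format, of 1]
  proof eventually_elim
    case (elim n)
    have "0 < A (v n)" "0 < A (b n)" "0 < r n" using elim p by (auto intro!: A_pos)
    have "A (b n) / A (v n) / (A (b n) / A (v n) / r n powr (1 / \<alpha>)) = r n powr (1 / \<alpha>)"
      using \<open>0 < A (v n)\<close> \<open>0 < A (b n)\<close> by simp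
    moreover have "(r n powr (1 / \<alpha>)) powr \<alpha> = r n"
      using alpha_pos \<open>0 < r n\<close> by (subst powr_powr) simp
    moreover have "r n = B (A (v n) * x) / v n" by (simp add: r_def b_def y_def)
    ultimately show ?case by (simp only:)
  qed
  ultimately show ?thesis by (rule Lim_transform_eventually)
qed

end

section \<open>Convergence of Levy exponents\<close>

lemma norm_iexp_diff_le: "cmod (iexp x - iexp y) \<le> \<bar>x - y\<bar>"
proof -
  have "iexp x - iexp y = iexp y * (iexp (x - y) - 1)"
    by (simp add: algebra_simps exp_add[symmetric])
  then have "cmod (iexp x - iexp y) = cmod (iexp (x - y) - 1)"
    by (simp add: norm_mult)
  also have "\<dots> \<le> \<bar>x - y\<bar>" using iexp_approx1[of "x - y" 0] by simp
  finally show ?thesis .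
qed

lemma norm_iexp_minus_one_le: "cmod (iexp x - 1) \<le> \<bar>x\<bar>"
  using norm_iexp_diff_le[of x 0] by simp

lemma norm_iexp_minus_one_le_2: "cmod (iexp x - 1) \<le> 2"
  by (rule order_trans[OF norm_triangle_ineq4]) simp

text \<open>
  For a Levy measure on \<open>(0, \<infinity>)\<close> that integrates \<open>min 1 x\<close> this makes the uncompensated exponent
  well defined.
\<close>

lemma norm_iexp_minus_one_le_min: "0 \<le> x \<Longrightarrow> cmod (iexp (t * x) - 1) \<le> (\<bar>t\<bar> + 2) * min 1 x"
proof (cases "x \<le> 1")
  case True
  assume "0 \<le> x"
  then have "cmod (iexp (t * x) - 1) \<le> \<bar>t\<bar> * x"
    using norm_iexp_minus_one_le[of "t * x"] by (simp add: abs_mult)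
  also have "\<dots> \<le> (\<bar>t\<bar> + 2) * min 1 x" using True \<open>0 \<le> x\<close> by (intro mult_mono) auto
  finally show ?thesis .
next
  case False
  then show ?thesis using norm_iexp_minus_one_le_2[of "t * x"] by (simp add: min_def)
qed

text \<open>
  The contribution of the jumps with size in \<open>S\<close> to the Levy exponent.
\<close>

abbreviation jumps :: "real measure \<Rightarrow> real set \<Rightarrow> real \<Rightarrow> complex" where
  "jumps \<nu> S t \<equiv> CLINT x:S|\<nu>. iexp (t * x) - 1"

lemma antimono_continuity_point:
  fixes f :: "real \<Rightarrow> real"
  assumes f: "antimono_on {0<..} f" and uv: "0 \<le> u" "u < v"
  obtains x where "u < x" "x < v" "isCont f x"
proof -
  have "mono_on {0<..} (\<lambda>x. - f x)" using f by (auto simp: monotone_on_def)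
  then have "countable {z \<in> {0<..}. \<not> continuous (at z within {0<..}) (\<lambda>x. - f x)}"
    by (rule mono_on_ctble_discont)
  moreover have "uncountable {u<..<v}" using uv by (simp add: uncountable_open_interval)
  ultimately have "\<not> {u<..<v} \<subseteq> {z \<in> {0<..}. \<not> continuous (at z within {0<..}) (\<lambda>x. - f x)}"
    using countable_subset by blast
  then obtain x where x: "u < x" "x < v" "continuous (at x within {0<..}) (\<lambda>x. - f x)" using uv by auto
  have "at x within {0<..} = at x" by (rule at_within_open) (use x uv in auto)
  then have "isCont (\<lambda>x. - f x) x" using x(3) by simp
  from continuous_minus[OF this] have "isCont f x" unfolding minus_minus .
  then show ?thesis using that x(1,2) by blast
qed

text \<open>
  The sum of the geometric series that appears when \<open>(0, \<epsilon>]\<close> is cut into dyadic pieces.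
\<close>

definition dyadic_moment_const :: "real \<Rightarrow> real" where
  "dyadic_moment_const \<rho> = 2 powr \<rho> / (1 - 2 powr (\<rho> - 1))"

text \<open>
  On the dyadic piece \<open>(\<epsilon> / 2\<^bsup>i+1\<^esup>, \<epsilon> / 2\<^sup>i]\<close> the integrand is at most \<open>\<epsilon> / 2\<^sup>i\<close> and the mass at most
  \<open>C (\<epsilon> / 2\<^bsup>i+1\<^esup>)\<^sup>-\<^sup>\<rho>\<close>; the resulting series converges because \<open>\<rho> < 1\<close>.
\<close>

lemma truncated_first_moment:
  fixes \<nu> :: "real measure"
  assumes [measurable_cong]: "sets \<nu> = sets borel" and \<rho>: "\<rho> < 1" and C: "0 \<le> C"
    and tail: "\<And>x. 0 < x \<Longrightarrow> x \<le> 1 \<Longrightarrow> emeasure \<nu> {x<..} \<le> ennreal (C * x powr (- \<rho>))"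
    and \<epsilon>: "0 < \<epsilon>" "\<epsilon> \<le> 1"
  shows "(\<integral>\<^sup>+x. ennreal x * indicator {0<..\<epsilon>} x \<partial>\<nu>)
    \<le> ennreal (C * dyadic_moment_const \<rho> * \<epsilon> powr (1 - \<rho>))"
proof -
  define e where "e i = \<epsilon> * (1 / 2) ^ i" for i :: nat
  have e_pos: "0 < e i" for i using \<epsilon> by (simp add: e_def)
  have e_le: "e i \<le> 1" for i using \<epsilon> by (auto simp: e_def intro!: mult_le_one power_le_one)
  define q where "q = (2::real) powr (\<rho> - 1)"
  have q: "0 < q" "q < 1" using \<rho> by (auto simp: q_def powr_less_one)
  have pointwise: "ennreal x * indicator {0<..\<epsilon>} x \<le> (\<Sum>i. ennreal (e i) * indicator {e (Suc i)<..} x)" for x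
  proof (cases "0 < x \<and> x \<le> \<epsilon>")
    case True
    obtain n where "(1 / 2) ^ n < x / \<epsilon>" using real_arch_pow_inv[of "x / \<epsilon>" "1 / 2"] True by auto
    then have n: "e n < x" using \<epsilon> by (simp add: e_def field_simps)
    define i where "i = (LEAST i. e (Suc i) < x)"
    have "e (Suc n) \<le> e n" using \<epsilon> by (simp add: e_def)
    then have "e (Suc n) < x" using n by linarith
    then have i: "e (Suc i) < x" unfolding i_def by (rule LeastI)
    have xi: "x \<le> e i"
    proof (cases i)
      case 0 then show ?thesis using True by (simp add: e_def)
    next
      case (Suc j)
      then have "\<not> e (Suc j) < x" unfolding i_def by (intro not_less_Least) simp
      then show ?thesis using Suc by simp
    qed
    have "ennreal x * indicator {0<..\<epsilon>} x \<le> ennreal (e i) * indicator {e (Suc i)<..} x"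
      using True i xi by (auto intro: ennreal_leI)
    also have "\<dots> \<le> (\<Sum>i. ennreal (e i) * indicator {e (Suc i)<..} x)"
      using sum_le_suminf[of "\<lambda>i. ennreal (e i) * indicator {e (Suc i)<..} x" "{i}"]
      by (simp del: sum_mult_indicator)
    finally show ?thesis .
  qed auto
  have "(\<integral>\<^sup>+x. ennreal x * indicator {0<..\<epsilon>} x \<partial>\<nu>)
      \<le> (\<integral>\<^sup>+x. (\<Sum>i. ennreal (e i) * indicator {e (Suc i)<..} x) \<partial>\<nu>)"
    by (intro nn_integral_mono pointwise)
  also have "\<dots> = (\<Sum>i. \<integral>\<^sup>+x. ennreal (e i) * indicator {e (Suc i)<..} x \<partial>\<nu>)"
    by (rule nn_integral_suminf) measurable
  also have "\<dots> = (\<Sum>i. ennreal (e i) * emeasure \<nu> {e (Suc i)<..})"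
    by (subst nn_integral_cmult_indicator) auto
  also have "\<dots> \<le> (\<Sum>i. ennreal (e i * (C * e (Suc i) powr (- \<rho>))))"
  proof (intro suminf_le)
    fix i
    have "ennreal (e i) * emeasure \<nu> {e (Suc i)<..} \<le> ennreal (e i) * ennreal (C * e (Suc i) powr (- \<rho>))"
      by (intro mult_left_mono tail e_pos e_le) simp
    also have "\<dots> = ennreal (e i * (C * e (Suc i) powr (- \<rho>)))"
      using e_pos[of i] C by (intro ennreal_mult[symmetric]) auto
    finally show "ennreal (e i) * emeasure \<nu> {e (Suc i)<..} \<le> ennreal (e i * (C * e (Suc i) powr (- \<rho>)))" .
  qed auto
  also have "\<dots> = (\<Sum>i. ennreal (C * \<epsilon> powr (1 - \<rho>) * 2 powr \<rho> * q ^ i))"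
  proof (intro suminf_cong arg_cong[where f=ennreal])
    fix i
    have "e (Suc i) = \<epsilon> * 2 powr (- real i - 1)"
      by (simp add: e_def powr_diff powr_minus powr_realpow field_simps)
    then have "e (Suc i) powr (- \<rho>) = \<epsilon> powr (- \<rho>) * 2 powr (\<rho> * (real i + 1))"
      using \<epsilon> by (simp add: powr_mult powr_powr algebra_simps)
    moreover have "e i = \<epsilon> powr 1 * 2 powr (- real i)"
      using \<epsilon> by (simp add: e_def powr_minus powr_realpow field_simps)
    moreover have "q ^ i = 2 powr ((\<rho> - 1) * real i)"
      by (simp add: q_def powr_realpow[symmetric] powr_powr)
    moreover have "\<epsilon> powr (1 - \<rho>) = \<epsilon> powr 1 * \<epsilon> powr (- \<rho>)"
      by (simp only: powr_add[symmetric]) simp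
    moreover have "2 powr (- real i) * 2 powr (\<rho> * (real i + 1)) = 2 powr \<rho> * (2::real) powr ((\<rho> - 1) * real i)"
      by (simp add: powr_add[symmetric] algebra_simps)
    ultimately show "e i * (C * e (Suc i) powr (- \<rho>)) = C * \<epsilon> powr (1 - \<rho>) * 2 powr \<rho> * q ^ i"
      by (simp add: mult_ac)
  qed
  also have "\<dots> = ennreal (C * \<epsilon> powr (1 - \<rho>) * 2 powr \<rho> * (1 / (1 - q)))"
    using q C by (intro suminf_ennreal_eq sums_mult geometric_sums) auto
  finally show ?thesis by (simp add: dyadic_moment_const_def q_def mult_ac)
qed

lemma dyadic_moment_const_nonneg: "\<rho> < 1 \<Longrightarrow> 0 \<le> dyadic_moment_const \<rho>"
  by (simp add: dyadic_moment_const_def powr_less_one less_imp_le)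

text \<open>
  Jumps of size at most \<open>\<epsilon>\<close> contribute \<open>O(\<epsilon>\<^bsup>1-\<rho>\<^esup>)\<close> to the exponent, with a constant depending on the
  measure only through the tail bound. The same estimate thus serves a Levy measure and the rescaled
  step laws that approximate it.
\<close>

lemma small_jumps_exponent:
  fixes \<nu> :: "real measure"
  assumes sets [measurable_cong]: "sets \<nu> = sets borel" and \<rho>: "\<rho> < 1" and C: "0 \<le> C"
    and tail: "\<And>x. 0 < x \<Longrightarrow> x \<le> 1 \<Longrightarrow> emeasure \<nu> {x<..} \<le> ennreal (C * x powr (- \<rho>))"
    and \<epsilon>: "0 < \<epsilon>" "\<epsilon> \<le> 1"
  shows "set_integrable \<nu> {0<..\<epsilon>} (\<lambda>x. x)"
    and "cmod (jumps \<nu> {0<..\<epsilon>} t) \<le> \<bar>t\<bar> * (C * dyadic_moment_const \<rho> * \<epsilon> powr (1 - \<rho>))"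
proof -
  let ?D = "C * dyadic_moment_const \<rho> * \<epsilon> powr (1 - \<rho>)"
  have D: "0 \<le> ?D" using C dyadic_moment_const_nonneg[OF \<rho>] by simp
  note moment = truncated_first_moment[OF assms]
  have eq: "(\<integral>\<^sup>+x. ennreal (norm (indicat_real {0<..\<epsilon>} x * x)) \<partial>\<nu>) = (\<integral>\<^sup>+x. ennreal x * indicator {0<..\<epsilon>} x \<partial>\<nu>)"
    by (intro nn_integral_cong) (auto simp: indicator_def)
  show int: "set_integrable \<nu> {0<..\<epsilon>} (\<lambda>x. x)"
    unfolding set_integrable_def real_scaleR_def
    by (rule integrableI_bounded) (use moment eq in \<open>auto intro: le_less_trans\<close>)
  have "(LINT x:{0<..\<epsilon>}|\<nu>. x) \<le> ?D"
  proof -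
    have "ennreal (LINT x:{0<..\<epsilon>}|\<nu>. x) = (\<integral>\<^sup>+x. ennreal (indicat_real {0<..\<epsilon>} x * x) \<partial>\<nu>)"
      unfolding set_lebesgue_integral_def real_scaleR_def
      by (rule nn_integral_eq_integral[symmetric])
         (use int in \<open>auto simp: set_integrable_def indicator_def\<close>)
    also have "\<dots> = (\<integral>\<^sup>+x. ennreal x * indicator {0<..\<epsilon>} x \<partial>\<nu>)"
      by (intro nn_integral_cong) (auto simp: indicator_def)
    finally have "ennreal (LINT x:{0<..\<epsilon>}|\<nu>. x) \<le> ennreal ?D" using moment by simp
    then show ?thesis using D by simp
  qed
  then have bound: "\<bar>t\<bar> * (LINT x:{0<..\<epsilon>}|\<nu>. x) \<le> \<bar>t\<bar> * ?D"
    by (intro mult_left_mono) auto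
  have "cmod (jumps \<nu> {0<..\<epsilon>} t) \<le> (LINT x:{0<..\<epsilon>}|\<nu>. \<bar>t\<bar> * x)"
    unfolding set_lebesgue_integral_def
  proof (rule Bochner_Integration.integral_norm_bound_integral)
    have bd: "cmod (indicat_real {0<..\<epsilon>} x *\<^sub>R (iexp (t * x) - 1)) \<le> indicat_real {0<..\<epsilon>} x *\<^sub>R (\<bar>t\<bar> * x)" for x
      using norm_iexp_minus_one_le[of "t * x"] by (cases "x \<in> {0<..\<epsilon>}") (auto simp: abs_mult)
    then show "\<And>x. x \<in> space \<nu> \<Longrightarrow> cmod (indicat_real {0<..\<epsilon>} x *\<^sub>R (iexp (t * x) - 1)) \<le> indicat_real {0<..\<epsilon>} x *\<^sub>R (\<bar>t\<bar> * x)" .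
    show int_t: "integrable \<nu> (\<lambda>x. indicat_real {0<..\<epsilon>} x *\<^sub>R (\<bar>t\<bar> * x))"
      using set_integrable_mult_right[of "\<bar>t\<bar>", OF int] by (simp add: set_integrable_def)
    show "complex_integrable \<nu> (\<lambda>x. indicat_real {0<..\<epsilon>} x *\<^sub>R (iexp (t * x) - 1))"
      by (rule Bochner_Integration.integrable_bound[OF int_t])
         (use order_trans[OF bd abs_ge_self] in \<open>auto intro!: AE_I2\<close>)
  qed
  also have "\<dots> = \<bar>t\<bar> * (LINT x:{0<..\<epsilon>}|\<nu>. x)" by simp
  finally show "cmod (jumps \<nu> {0<..\<epsilon>} t) \<le> \<bar>t\<bar> * ?D" using bound by linarith
qed

text \<open>
  A possibly infinite measure on \<open>(0, \<infinity>)\<close> whose tail near \<open>0\<close> is controlled by a power with exponent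
  less than one: a Levy measure of bounded variation type, for which no compensation is needed.
\<close>

locale levy_tail =
  fixes \<Lambda> :: "real measure" and C \<rho> :: real
  assumes sets_levy [measurable_cong]: "sets \<Lambda> = sets borel" and rho: "\<rho> < 1" and C_nonneg: "0 \<le> C"
    and levy_tail: "\<And>x. 0 < x \<Longrightarrow> x \<le> 1 \<Longrightarrow> emeasure \<Lambda> {x<..} \<le> ennreal (C * x powr (- \<rho>))"
begin

definition exponent :: "real \<Rightarrow> complex" where
  "exponent t = jumps \<Lambda> {0<..} t"

lemma space_levy [simp]: "space \<Lambda> = UNIV" using sets_eq_imp_space_eq[OF sets_levy] by simp

lemma finite_levy_tail: "0 < x \<Longrightarrow> emeasure \<Lambda> {x<..} < \<infinity>"
proof -
  assume x: "0 < x"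
  have "emeasure \<Lambda> {x<..} \<le> emeasure \<Lambda> {min x 1<..}" by (rule emeasure_mono) (auto simp: sets_levy)
  also have "\<dots> \<le> ennreal (C * min x 1 powr (- \<rho>))" using x by (intro levy_tail) auto
  finally show ?thesis by (auto intro: le_less_trans)
qed

lemma integrable_min_levy: "set_integrable \<Lambda> {0<..} (\<lambda>x. min 1 x)"
proof -
  have "set_integrable \<Lambda> {0<..1} (\<lambda>x. x)"
    by (rule small_jumps_exponent(1)[OF sets_levy rho C_nonneg levy_tail]) auto
  moreover have "integrable \<Lambda> (indicat_real {1<..})"
    by (rule integrable_real_indicator) (use finite_levy_tail[of 1] in \<open>auto simp: sets_levy\<close>)
  ultimately have "integrable \<Lambda> (\<lambda>x. indicat_real {0<..1} x *\<^sub>R x + indicat_real {1<..} x)"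
    unfolding set_integrable_def by (intro Bochner_Integration.integrable_add)
  moreover have "(\<lambda>x. indicat_real {0<..1} x *\<^sub>R x + indicat_real {1<..} x) = (\<lambda>x. indicat_real {0<..} x *\<^sub>R min 1 x)"
    by (auto simp: indicator_def fun_eq_iff)
  ultimately show ?thesis by (simp add: set_integrable_def)
qed

lemma integrable_iexp_levy: "set_integrable \<Lambda> {0<..} (\<lambda>x. iexp (t * x) - 1)"
  unfolding set_integrable_def
proof (rule Bochner_Integration.integrable_bound)
  show "integrable \<Lambda> (\<lambda>x. (\<bar>t\<bar> + 2) * (indicat_real {0<..} x *\<^sub>R min 1 x))"
    using integrable_min_levy unfolding set_integrable_def by (intro integrable_mult_right)
  have "cmod (indicat_real {0<..} x *\<^sub>R (iexp (t * x) - 1)) \<le> norm ((\<bar>t\<bar> + 2) * (indicat_real {0<..} x *\<^sub>R min 1 x))" for x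
    using norm_iexp_minus_one_le_min[of x t] by (auto simp: indicator_def)
  then show "AE x in \<Lambda>. cmod (indicat_real {0<..} x *\<^sub>R (iexp (t * x) - 1)) \<le> norm ((\<bar>t\<bar> + 2) * (indicat_real {0<..} x *\<^sub>R min 1 x))"
    by (intro AE_I2)
qed measurable

lemma exponent_continuous:
  assumes s: "s \<longlonglongrightarrow> t" shows "(\<lambda>n. exponent (s n)) \<longlonglongrightarrow> exponent t"
proof -
  obtain R where R: "\<And>n. \<bar>s n\<bar> \<le> R" using convergent_imp_Bseq[OF convergentI[OF s]] by (auto simp: Bseq_def)
  show ?thesis unfolding exponent_def set_lebesgue_integral_def
  proof (rule integral_dominated_convergence[where w="\<lambda>x. (R + 2) * (indicat_real {0<..} x *\<^sub>R min 1 x)"])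
    show "integrable \<Lambda> (\<lambda>x. (R + 2) * (indicat_real {0<..} x *\<^sub>R min 1 x))"
      using integrable_min_levy unfolding set_integrable_def by (intro integrable_mult_right)
    have "cmod (indicat_real {0<..} x *\<^sub>R (iexp (s n * x) - 1)) \<le> (R + 2) * (indicat_real {0<..} x *\<^sub>R min 1 x)" for n x
    proof (cases "0 < x")
      case True
      have "cmod (iexp (s n * x) - 1) \<le> (\<bar>s n\<bar> + 2) * min 1 x" using True by (intro norm_iexp_minus_one_le_min) simp
      also have "\<dots> \<le> (R + 2) * min 1 x" using True R[of n] by (intro mult_right_mono) auto
      finally show ?thesis using True by simp
    qed auto
    then show "AE x in \<Lambda>. cmod (indicat_real {0<..} x *\<^sub>R (iexp (s n * x) - 1)) \<le> (R + 2) * (indicat_real {0<..} x *\<^sub>R min 1 x)" for n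
      by (intro AE_I2)
    show "AE x in \<Lambda>. (\<lambda>n. indicat_real {0<..} x *\<^sub>R (iexp (s n * x) - 1)) \<longlonglongrightarrow> indicat_real {0<..} x *\<^sub>R (iexp (t * x) - 1)"
      by (intro AE_I2 tendsto_intros s)
  qed measurable
qed

lemma exponent_split:
  assumes "0 < \<epsilon>"
  shows "exponent t = jumps \<Lambda> {0<..\<epsilon>} t + jumps \<Lambda> {\<epsilon><..} t"
proof -
  let ?e = "\<lambda>x. iexp (t * x) - 1"
  have U: "{0<..} = {0<..\<epsilon>} \<union> {\<epsilon><..}" using assms by auto
  have "set_integrable \<Lambda> {0<..\<epsilon>} ?e"
    by (rule set_integrable_subset[OF integrable_iexp_levy]) (auto simp: sets_levy)
  moreover have "set_integrable \<Lambda> {\<epsilon><..} ?e"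
    by (rule set_integrable_subset[OF integrable_iexp_levy]) (use assms in \<open>auto simp: sets_levy\<close>)
  ultimately show ?thesis unfolding exponent_def U by (intro set_integral_Un) auto
qed

lemma Re_exponent: "Re (exponent t) = - (LINT x:{0<..}|\<Lambda>. 1 - cos (t * x))"
proof -
  have "Re (exponent t) = (LINT x|\<Lambda>. Re (indicat_real {0<..} x *\<^sub>R (iexp (t * x) - 1)))"
    unfolding exponent_def set_lebesgue_integral_def
    by (rule integral_Re[symmetric]) (use integrable_iexp_levy[of t] in \<open>simp add: set_integrable_def\<close>)
  also have "\<dots> = (LINT x|\<Lambda>. - (indicat_real {0<..} x *\<^sub>R (1 - cos (t * x))))"
    by (intro Bochner_Integration.integral_cong) (auto simp: Re_exp indicator_def)
  finally show ?thesis by (simp add: set_lebesgue_integral_def)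
qed

lemma integrable_one_minus_cos: "set_integrable \<Lambda> {0<..} (\<lambda>x. 1 - cos (t * x))"
proof -
  have "integrable \<Lambda> (\<lambda>x. - Re (indicat_real {0<..} x *\<^sub>R (iexp (t * x) - 1)))"
    using integrable_iexp_levy[of t] by (intro Bochner_Integration.integrable_minus integrable_Re) (simp add: set_integrable_def)
  moreover have "(\<lambda>x. - Re (indicat_real {0<..} x *\<^sub>R (iexp (t * x) - 1))) = (\<lambda>x. indicat_real {0<..} x *\<^sub>R (1 - cos (t * x)))"
    by (auto simp: Re_exp indicator_def fun_eq_iff)
  ultimately show ?thesis by (simp only: set_integrable_def)
qed

end

text \<open>
  Restricting to a set of finite mass and normalising reduces exponents to characteristic functions.
\<close>

lemma char_uniform_measure:
  fixes \<nu> :: "real measure"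
  assumes sets: "sets \<nu> = sets borel" and S: "S \<in> sets borel" "emeasure \<nu> S \<noteq> 0" "emeasure \<nu> S < \<infinity>"
  shows "(jumps \<nu> S t) = measure \<nu> S * (char (uniform_measure \<nu> S) t - 1)"
proof -
  note [measurable_cong] = sets
  note [measurable] = S(1)
  have em: "emeasure \<nu> S = ennreal (measure \<nu> S)" using S by (simp add: emeasure_eq_ennreal_measure)
  have pos: "0 < measure \<nu> S" using S em by (simp add: zero_less_measure_iff)
  have dens: "uniform_measure \<nu> S = density \<nu> (\<lambda>x. ennreal (indicator S x / measure \<nu> S))"
    unfolding uniform_measure_def em using pos
    by (intro density_cong) (auto simp: divide_ennreal[of 1, simplified] indicator_def)
  have "char (uniform_measure \<nu> S) t = (CLINT x|\<nu>. (indicat_real S x / measure \<nu> S) *\<^sub>R iexp (t * x))"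
    unfolding char_def dens by (rule integral_density) auto
  also have "\<dots> = (CLINT x|\<nu>. (1 / measure \<nu> S) *\<^sub>R (indicat_real S x *\<^sub>R iexp (t * x)))"
    by simp
  also have "\<dots> = (1 / measure \<nu> S) *\<^sub>R (CLINT x:S|\<nu>. iexp (t * x))"
    unfolding set_lebesgue_integral_def by (rule integral_scaleR_right)
  finally have ch: "(CLINT x:S|\<nu>. iexp (t * x)) = measure \<nu> S *\<^sub>R char (uniform_measure \<nu> S) t"
    using pos by simp
  have "integrable \<nu> (indicat_real S)" using S sets by (intro integrable_real_indicator) auto
  then have int: "set_integrable \<nu> S (\<lambda>x. iexp (t * x))" "set_integrable \<nu> S (\<lambda>x. 1::complex)"
    unfolding set_integrable_def
    by (auto intro!: Bochner_Integration.integrable_bound[where f="indicat_real S"] AE_I2)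
  have "(CLINT x:S|\<nu>. 1) = measure \<nu> S"
    using S sets by (simp add: set_lebesgue_integral_def scaleR_conv_of_real)
  moreover have "(jumps \<nu> S t) = (CLINT x:S|\<nu>. iexp (t * x)) - (CLINT x:S|\<nu>. 1)"
    by (rule set_integral_diff(2)[OF int])
  ultimately show ?thesis by (simp only: ch) (simp add: scaleR_conv_of_real algebra_simps)
qed

lemma cdf_uniform_measure_Ioi:
  fixes \<nu> :: "real measure"
  assumes sets: "sets \<nu> = sets borel" and S: "emeasure \<nu> {\<epsilon><..} \<noteq> 0" "emeasure \<nu> {\<epsilon><..} < \<infinity>"
  shows "cdf (uniform_measure \<nu> {\<epsilon><..}) x
    = (if x \<le> \<epsilon> then 0 else 1 - measure \<nu> {x<..} / measure \<nu> {\<epsilon><..})"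
proof -
  have em: "emeasure \<nu> {\<epsilon><..} = ennreal (measure \<nu> {\<epsilon><..})" using S by (simp add: emeasure_eq_ennreal_measure)
  have pos: "0 < measure \<nu> {\<epsilon><..}" using S em by (simp add: zero_less_measure_iff)
  have "cdf (uniform_measure \<nu> {\<epsilon><..}) x = measure \<nu> ({\<epsilon><..} \<inter> {..x}) / measure \<nu> {\<epsilon><..}"
    unfolding cdf_def using S by (intro measure_uniform_measure) (auto simp: sets)
  moreover have "measure \<nu> ({\<epsilon><..} \<inter> {..x}) = measure \<nu> {\<epsilon><..} - measure \<nu> {x<..}" if "\<epsilon> < x"
  proof -
    have "{\<epsilon><..} \<inter> {..x} = {\<epsilon><..} - {x<..}" by auto
    then show ?thesis using that S by (simp only:) (rule measure_Diff, auto simp: sets)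
  qed
  moreover have "{\<epsilon><..} \<inter> {..x} = {}" if "x \<le> \<epsilon>" using that by auto
  ultimately show ?thesis using pos by (auto simp: field_simps)
qed

lemma real_distribution_uniform_measure:
  fixes \<nu> :: "real measure"
  assumes "sets \<nu> = sets borel" "emeasure \<nu> S \<noteq> 0" "emeasure \<nu> S < \<infinity>"
  shows "real_distribution (uniform_measure \<nu> S)"
proof -
  interpret prob_space "uniform_measure \<nu> S" using assms by (intro prob_space_uniform_measure) auto
  show ?thesis by standard (simp add: assms)
qed

text \<open>
  Laws \<open>\<mu> n\<close> on \<open>[0, \<infinity>)\<close> with weights \<open>w n\<close> whose weighted tails converge to the tail of \<open>\<Lambda>\<close> at its
  continuity points, under a common power bound near \<open>0\<close>.
\<close>

locale levy_limit = levy_tail +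
  fixes \<mu> :: "nat \<Rightarrow> real measure" and w :: "nat \<Rightarrow> real"
  assumes tail_pos: "\<And>x. 0 < x \<Longrightarrow> 0 < measure \<Lambda> {x<..}"
    and laws: "\<And>n. real_distribution (\<mu> n)" and nonneg: "\<And>n. AE x in \<mu> n. 0 \<le> x"
    and weight: "\<And>n. 0 < w n"
    and law_tail: "\<And>n x. 0 < x \<Longrightarrow> x \<le> 1 \<Longrightarrow> w n * measure (\<mu> n) {x<..} \<le> C * x powr (- \<rho>)"
    and tail_lim: "\<And>x. 0 < x \<Longrightarrow> isCont (\<lambda>x. measure \<Lambda> {x<..}) x \<Longrightarrow>
        (\<lambda>n. w n * measure (\<mu> n) {x<..}) \<longlonglongrightarrow> measure \<Lambda> {x<..}"
begin

text \<open>
  The normalised restrictions to \<open>(\<epsilon>, \<infinity>)\<close> are probability measures whose distribution functions are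
  ratios of tails. They converge weakly, and Levy's continuity theorem passes this on to their
  characteristic functions.
\<close>

lemma large_jumps_limit:
  assumes \<epsilon>: "0 < \<epsilon>" and cont: "isCont (\<lambda>x. measure \<Lambda> {x<..}) \<epsilon>"
  shows "(\<lambda>n. w n * (jumps (\<mu> n) {\<epsilon><..} t)) \<longlonglongrightarrow> jumps \<Lambda> {\<epsilon><..} t"
proof -
  interpret L: real_distribution "\<mu> n" for n by (rule laws)
  define T where "T x = measure \<Lambda> {x<..}" for x
  define S where "S n x = measure (\<mu> n) {x<..}" for n x
  have T_pos: "0 < T \<epsilon>" unfolding T_def by (rule tail_pos[OF \<epsilon>])
  have lim: "(\<lambda>n. w n * S n x) \<longlonglongrightarrow> T x" if "0 < x" "isCont T x" for x
    unfolding S_def T_def by (rule tail_lim) (use that in \<open>auto simp: T_def[abs_def]\<close>)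
  have lim_\<epsilon>: "(\<lambda>n. w n * S n \<epsilon>) \<longlonglongrightarrow> T \<epsilon>" by (rule lim) (use \<epsilon> cont in \<open>auto simp: T_def[abs_def]\<close>)
  have L_em: "emeasure \<Lambda> {\<epsilon><..} \<noteq> 0" "emeasure \<Lambda> {\<epsilon><..} < \<infinity>"
    using T_pos finite_levy_tail[OF \<epsilon>] by (auto simp: T_def measure_def)
  \<comment> \<open>The restriction can be normalised only if it has positive mass, which holds for large \<open>n\<close>.\<close>
  define Q where "Q n = (if 0 < S n \<epsilon> then uniform_measure (\<mu> n) {\<epsilon><..} else \<mu> n)" for n
  define Q' where "Q' = uniform_measure \<Lambda> {\<epsilon><..}"
  have em: "emeasure (\<mu> n) {\<epsilon><..} \<noteq> 0" if "0 < S n \<epsilon>" for n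
    using that by (simp add: S_def L.emeasure_eq_measure)
  have Q_dist: "real_distribution (Q n)" for n
    unfolding Q_def using em[of n] laws[of n]
    by (auto intro!: real_distribution_uniform_measure simp: L.emeasure_eq_measure)
  have Q'_dist: "real_distribution Q'"
    unfolding Q'_def by (rule real_distribution_uniform_measure[OF sets_levy L_em])
  have Q'_cdf: "cdf Q' x = (if x \<le> \<epsilon> then 0 else 1 - T x / T \<epsilon>)" for x
    unfolding Q'_def T_def by (rule cdf_uniform_measure_Ioi[OF sets_levy L_em])
  have ev: "\<forall>\<^sub>F n in sequentially. 0 < S n \<epsilon>"
    using order_tendstoD(1)[OF lim_\<epsilon> T_pos]
  proof eventually_elim
    case (elim n) then show ?case using weight[of n] by (simp add: zero_less_mult_iff)
  qed
  have Q_cdf: "\<forall>\<^sub>F n in sequentially. (if x \<le> \<epsilon> then 0 else 1 - (w n * S n x) / (w n * S n \<epsilon>)) = cdf (Q n) x" for x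
    using ev
  proof eventually_elim
    case (elim n)
    have "cdf (Q n) x = (if x \<le> \<epsilon> then 0 else 1 - S n x / S n \<epsilon>)"
      unfolding Q_def S_def using elim em[of n]
      by (simp add: S_def cdf_uniform_measure_Ioi L.emeasure_eq_measure)
    then show ?case using weight[of n] by simp
  qed
  have "weak_conv_m Q Q'"
    unfolding weak_conv_m_def weak_conv_def
  proof (intro allI impI)
    fix x assume cx: "isCont (cdf Q') x"
    have "(\<lambda>n. if x \<le> \<epsilon> then 0 else 1 - (w n * S n x) / (w n * S n \<epsilon>)) \<longlonglongrightarrow> cdf Q' x"
    proof (cases "x \<le> \<epsilon>")
      case True then show ?thesis by (simp add: Q'_cdf)
    next
      case False
      have "\<forall>\<^sub>F y in nhds x. T y = T \<epsilon> * (1 - cdf Q' y)"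
        using eventually_nhds_in_open[of "{\<epsilon><..}" x] False T_pos
        by (auto elim!: eventually_mono simp: Q'_cdf)
      then have "isCont T x \<longleftrightarrow> isCont (\<lambda>y. T \<epsilon> * (1 - cdf Q' y)) x" by (rule isCont_cong)
      moreover have "isCont (\<lambda>y. T \<epsilon> * (1 - cdf Q' y)) x" by (intro continuous_intros cx)
      ultimately have "(\<lambda>n. w n * S n x) \<longlonglongrightarrow> T x" using False \<epsilon> by (intro lim) auto
      then have "(\<lambda>n. 1 - (w n * S n x) / (w n * S n \<epsilon>)) \<longlonglongrightarrow> 1 - T x / T \<epsilon>"
        using T_pos by (intro tendsto_diff tendsto_divide tendsto_const lim_\<epsilon>) auto
      then show ?thesis using False by (simp add: Q'_cdf)
    qed
    then show "(\<lambda>n. cdf (Q n) x) \<longlonglongrightarrow> cdf Q' x" by (rule Lim_transform_eventually[OF _ Q_cdf])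
  qed
  then have "(\<lambda>n. char (Q n) t) \<longlonglongrightarrow> char Q' t" by (rule levy_continuity1[OF Q_dist Q'_dist])
  then have "(\<lambda>n. complex_of_real (w n * S n \<epsilon>) * (char (Q n) t - 1)) \<longlonglongrightarrow> complex_of_real (T \<epsilon>) * (char Q' t - 1)"
    by (intro tendsto_intros lim_\<epsilon>)
  moreover have "complex_of_real (T \<epsilon>) * (char Q' t - 1) = jumps \<Lambda> {\<epsilon><..} t"
    unfolding T_def Q'_def by (rule char_uniform_measure[symmetric]) (use sets_levy L_em in auto)
  moreover have "\<forall>\<^sub>F n in sequentially. complex_of_real (w n * S n \<epsilon>) * (char (Q n) t - 1)
      = w n * (jumps (\<mu> n) {\<epsilon><..} t)"
    using ev
  proof eventually_elim
    case (elim n)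
    then have "(jumps (\<mu> n) {\<epsilon><..} t) = S n \<epsilon> * (char (Q n) t - 1)"
      using em[of n] unfolding Q_def S_def
      by (subst char_uniform_measure) (auto simp: L.emeasure_eq_measure)
    then show ?case by (simp only: of_real_mult mult.assoc)
  qed
  ultimately show ?thesis using Lim_transform_eventually by fastforce
qed

lemma char_split:
  assumes \<epsilon>: "0 < \<epsilon>"
  shows "char (\<mu> n) t - 1 = jumps (\<mu> n) {0<..\<epsilon>} t + jumps (\<mu> n) {\<epsilon><..} t"
proof -
  interpret L: real_distribution "\<mu> n" by (rule laws)
  have bint: "complex_integrable (\<mu> n) (\<lambda>x. indicat_real S x *\<^sub>R (iexp (t * x) - 1))" if [measurable]: "S \<in> sets borel" for S
    by (rule L.integrable_const_bound[where B=2])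
       (use norm_iexp_minus_one_le_2[of "t * x" for x] in \<open>auto intro!: AE_I2 simp: indicator_def\<close>)
  have "char (\<mu> n) t - 1 = (CLINT x|\<mu> n. iexp (t * x) - 1)"
    unfolding char_def by (subst Bochner_Integration.integral_diff) (use L.prob_space in \<open>auto simp: L.integrable_iexp\<close>)
  also have "\<dots> = (CLINT x|\<mu> n. indicat_real {0<..\<epsilon>} x *\<^sub>R (iexp (t * x) - 1) + indicat_real {\<epsilon><..} x *\<^sub>R (iexp (t * x) - 1))"
  proof (rule integral_cong_AE)
    show "AE x in \<mu> n. iexp (t * x) - 1 = indicat_real {0<..\<epsilon>} x *\<^sub>R (iexp (t * x) - 1) + indicat_real {\<epsilon><..} x *\<^sub>R (iexp (t * x) - 1)"
      using nonneg[of n]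
    proof eventually_elim
      case (elim x)
      then show ?case using \<epsilon> by (cases "x = 0") (auto simp: indicator_def)
    qed
  qed auto
  also have "\<dots> = jumps (\<mu> n) {0<..\<epsilon>} t + jumps (\<mu> n) {\<epsilon><..} t"
    unfolding set_lebesgue_integral_def by (intro Bochner_Integration.integral_add bint) auto
  finally show ?thesis .
qed

text \<open>
  Large jumps converge for every continuity point \<open>\<epsilon>\<close>, and small ones are \<open>O(\<epsilon>\<^bsup>1-\<rho>\<^esup>)\<close> uniformly in
  \<open>n\<close>; continuity points exist arbitrarily close to \<open>0\<close> because the tail is monotone.
\<close>

theorem exponent_limit: "(\<lambda>n. w n * (char (\<mu> n) t - 1)) \<longlonglongrightarrow> exponent t"
proof (rule LIMSEQ_I)
  fix r :: real assume r: "0 < r"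
  interpret L: real_distribution "\<mu> n" for n by (rule laws)
  define K where "K = \<bar>t\<bar> * (C * dyadic_moment_const \<rho>)"
  have K: "0 \<le> K" using C_nonneg dyadic_moment_const_nonneg[OF rho] by (simp add: K_def)
  have "((\<lambda>\<epsilon>. K * \<epsilon> powr (1 - \<rho>)) \<longlongrightarrow> K * 0 powr (1 - \<rho>)) (at_right 0)"
    using rho by (intro tendsto_intros) (auto simp: eventually_at_right_less eventually_at_filter)
  then have "\<forall>\<^sub>F \<epsilon> in at_right 0. K * \<epsilon> powr (1 - \<rho>) < r / 3"
    using r by (intro order_tendstoD) auto
  then obtain d where d: "0 < d" "\<And>\<epsilon>. 0 < \<epsilon> \<Longrightarrow> \<epsilon> < d \<Longrightarrow> K * \<epsilon> powr (1 - \<rho>) < r / 3"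
    by (auto simp: eventually_at_right_field)
  obtain \<epsilon> where \<epsilon>: "0 < \<epsilon>" "\<epsilon> < min d 1" and cont: "isCont (\<lambda>x. measure \<Lambda> {x<..}) \<epsilon>"
  proof (rule antimono_continuity_point[of "\<lambda>x. measure \<Lambda> {x<..}" 0 "min d 1"])
    show "antimono_on {0<..} (\<lambda>x. measure \<Lambda> {x<..})"
    proof (rule monotone_onI)
      fix r s :: real assume "r \<in> {0<..}" "s \<in> {0<..}" "r \<le> s"
      then show "measure \<Lambda> {s<..} \<le> measure \<Lambda> {r<..}"
        using finite_levy_tail[of r] by (auto intro!: measure_mono_fmeasurable simp: fmeasurable_def sets_levy)
    qed
  qed (use d(1) in auto)
  have small: "K * \<epsilon> powr (1 - \<rho>) < r / 3" using \<epsilon> by (intro d) auto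
  have "cmod (jumps \<Lambda> {0<..\<epsilon>} t) \<le> K * \<epsilon> powr (1 - \<rho>)"
    using small_jumps_exponent(2)[OF sets_levy rho C_nonneg levy_tail \<epsilon>(1), of t] \<epsilon> by (simp add: K_def mult_ac)
  then have sL: "cmod (jumps \<Lambda> {0<..\<epsilon>} t) < r / 3" using small by linarith
  have s\<mu>: "cmod (w n * (jumps (\<mu> n) {0<..\<epsilon>} t)) < r / 3" for n
  proof -
    have "cmod (jumps (\<mu> n) {0<..\<epsilon>} t) \<le> \<bar>t\<bar> * (C / w n * dyadic_moment_const \<rho> * \<epsilon> powr (1 - \<rho>))"
    proof (rule small_jumps_exponent(2))
      fix x :: real assume "0 < x" "x \<le> 1"
      then have "w n * measure (\<mu> n) {x<..} \<le> C * x powr (- \<rho>)" by (rule law_tail)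
      then show "emeasure (\<mu> n) {x<..} \<le> ennreal (C / w n * x powr (- \<rho>))"
        using weight[of n] by (auto simp: L.emeasure_eq_measure field_simps intro!: ennreal_leI)
    qed (use rho C_nonneg weight[of n] \<epsilon> in auto)
    then have "w n * cmod (jumps (\<mu> n) {0<..\<epsilon>} t) \<le> K * \<epsilon> powr (1 - \<rho>)"
      using weight[of n] by (simp add: K_def field_simps)
    then show ?thesis using small weight[of n] by (simp add: norm_mult)
  qed
  obtain N where N: "\<And>n. N \<le> n \<Longrightarrow> cmod (w n * (jumps (\<mu> n) {\<epsilon><..} t) - jumps \<Lambda> {\<epsilon><..} t) < r / 3"
    using LIMSEQ_D[OF large_jumps_limit[OF \<epsilon>(1) cont, of t], of "r / 3"] r by auto
  show "\<exists>no. \<forall>n\<ge>no. norm (w n * (char (\<mu> n) t - 1) - exponent t) < r"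
  proof (intro exI[of _ N] allI impI)
    fix n assume n: "N \<le> n"
    let ?a = "w n * (jumps (\<mu> n) {0<..\<epsilon>} t)"
    let ?b = "jumps \<Lambda> {0<..\<epsilon>} t"
    let ?c = "w n * (jumps (\<mu> n) {\<epsilon><..} t) - jumps \<Lambda> {\<epsilon><..} t"
    have "cmod (w n * (char (\<mu> n) t - 1) - exponent t) = cmod ((?a - ?b) + ?c)"
      by (simp add: char_split[OF \<epsilon>(1)] exponent_split[OF \<epsilon>(1)] algebra_simps)
    also have "\<dots> \<le> cmod ?a + cmod ?b + cmod ?c"
      using norm_triangle_ineq[of "?a - ?b" ?c] norm_triangle_ineq4[of ?a ?b] by linarith
    finally show "norm (w n * (char (\<mu> n) t - 1) - exponent t) < r"
      using s\<mu>[of n] sL N[OF n] by linarith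
  qed
qed

end

section \<open>Distribution functions and characteristic functions\<close>

text \<open>
  In Levy's inversion formula the kernel is bounded by \<open>b - a\<close>, so an integrable majorant of the
  characteristic function bounds the mass of intervals linearly in their length. The formula requires
  endpoints without mass; these are dense, which first shows that there are no atoms at all.
\<close>

lemma (in real_distribution) measure_Ioc_le_of_char_bound:
  assumes g: "integrable lborel g" and bound: "\<And>t. cmod (char M t) \<le> g t" and ab: "a \<le> b"
  shows "measure M {a<..b} \<le> (b - a) * (LBINT t. g t)"
proof -
  define K where "K = (LBINT t. g t)"
  have g_nonneg: "0 \<le> g t" for t using bound[of t] norm_ge_zero order_trans by blast
  then have K: "0 \<le> K" unfolding K_def by (intro integral_nonneg_AE AE_I2)
  have no_atoms: "measure M {a<..b} \<le> (b - a) * K"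
    if ab: "a \<le> b" and atoms: "measure M {a} = 0" "measure M {b} = 0" for a b
  proof -
    let ?F = "\<lambda>t::real. (iexp (-(t * a)) - iexp (-(t * b))) / (\<i> * t)"
    have F_le: "cmod (?F t) \<le> b - a" if "t \<noteq> 0" for t
      using Levy_Inversion_aux2[of "- b" "- a" t] ab that by simp
    have term_le: "cmod (1 / (2 * pi) * (CLBINT t=ereal (- real n)..ereal (real n). ?F t * char M t)) \<le> (b - a) * K" for n :: nat
    proof -
      have "cmod (CLBINT t=ereal (- real n)..ereal (real n). ?F t * char M t)
          \<le> (LBINT t. cmod (indicat_real {- real n<..<real n} t *\<^sub>R (?F t * char M t)))"
        unfolding interval_lebesgue_integral_def set_lebesgue_integral_def
        by (simp add: integral_norm_bound del: norm_scaleR)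
      also have "\<dots> \<le> (LBINT t. (b - a) * g t)"
      proof (rule integral_mono_AE')
        show "integrable lborel (\<lambda>t. (b - a) * g t)" using g by simp
        show "AE t in lborel. cmod (indicat_real {- real n<..<real n} t *\<^sub>R (?F t * char M t)) \<le> (b - a) * g t"
          using AE_lborel_singleton[of 0]
        proof eventually_elim
          case (elim t)
          have "cmod (?F t * char M t) \<le> (b - a) * g t"
            unfolding norm_mult using F_le[OF elim] bound[of t] ab by (intro mult_mono) auto
          moreover have "0 \<le> (b - a) * g t" using ab g_nonneg[of t] by simp
          ultimately show ?case by (cases "t \<in> {- real n<..<real n}") (simp_all del: times_divide_eq_left)
        qed
        show "AE t in lborel. 0 \<le> (b - a) * g t" using ab g_nonneg by auto
      qed
      also have "\<dots> = (b - a) * K" by (simp add: K_def)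
      finally have le: "cmod (CLBINT t=ereal (- real n)..ereal (real n). ?F t * char M t) \<le> (b - a) * K" .
      have "cmod (1 / (2 * pi) * (CLBINT t=ereal (- real n)..ereal (real n). ?F t * char M t))
          = 1 / (2 * pi) * cmod (CLBINT t=ereal (- real n)..ereal (real n). ?F t * char M t)"
        by (simp add: norm_mult norm_divide)
      also have "\<dots> \<le> 1 * cmod (CLBINT t=ereal (- real n)..ereal (real n). ?F t * char M t)"
        using pi_gt3 by (intro mult_right_mono) (auto simp: field_simps)
      finally show ?thesis using le by linarith
    qed
    have "cmod (complex_of_real (measure M {a<..b})) \<le> (b - a) * K"
      by (rule tendsto_upperbound[OF tendsto_norm[OF Levy_Inversion[OF ab atoms]]])
         (use term_le in \<open>auto intro!: always_eventually\<close>)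
    then show ?thesis by simp
  qed
  \<comment> \<open>The atoms of a law are countable, so every interval contains a point that is not an atom.\<close>
  have near: "\<exists>z. u < z \<and> z < v \<and> measure M {z} = 0" if "u < v" for u v
  proof -
    have "\<not> {u<..<v} \<subseteq> {x. 0 < measure M {x}}"
      using countable_subset[OF _ countable_atoms] uncountable_open_interval[of u v] that by auto
    then obtain z where "z \<in> {u<..<v}" "\<not> 0 < measure M {z}" by blast
    then show ?thesis by (intro exI[of _ z]) (auto simp: zero_less_measure_iff)
  qed
  have atom: "measure M {x} = 0" for x
  proof -
    have "measure M {x} \<le> 0 + e" if e: "0 < e" for e
    proof -
      define d where "d = e / (2 * (K + 1))"
      have d: "0 < d" using e K by (simp add: d_def)
      obtain u where u: "x - d < u" "u < x" "measure M {u} = 0" using near[of "x - d" x] d by auto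
      obtain v where v: "x < v" "v < x + d" "measure M {v} = 0" using near[of x "x + d"] d by auto
      have "measure M {x} \<le> measure M {u<..v}" using u v by (intro finite_measure_mono) auto
      also have "\<dots> \<le> (v - u) * K" using u v by (intro no_atoms) auto
      also have "\<dots> \<le> (2 * d) * (K + 1)" using u v K d by (intro mult_mono) auto
      also have "\<dots> = e" using K by (simp add: d_def field_simps)
      finally show ?thesis by simp
    qed
    then have "measure M {x} \<le> 0" by (rule field_le_epsilon)
    then show ?thesis by (simp add: measure_le_0_iff)
  qed
  show ?thesis using no_atoms[OF ab atom atom] by (simp add: K_def)
qed

text \<open>
  Monotonicity of distribution functions makes weak convergence to a continuous limit insensitive to a
  convergent perturbation of the argument.
\<close>

lemma weak_conv_cdf_tendsto:
  assumes "\<And>n. real_distribution (Mn n)" "real_distribution M" and conv: "weak_conv_m Mn M"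
    and cont: "\<And>x. isCont (cdf M) x" and z: "z \<longlonglongrightarrow> x"
  shows "(\<lambda>n. cdf (Mn n) (z n)) \<longlonglongrightarrow> cdf M x"
proof -
  interpret Mn: real_distribution "Mn n" for n by fact
  interpret M: real_distribution M by fact
  have lim: "(\<lambda>n. cdf (Mn n) y) \<longlonglongrightarrow> cdf M y" for y
    using conv cont by (auto simp: weak_conv_m_def weak_conv_def)
  show ?thesis
  proof (rule order_tendstoI)
    fix a assume a: "a < cdf M x"
    have "\<forall>\<^sub>F y in at_left x. a < cdf M y"
      using cont[of x] a by (intro order_tendstoD(1)) (auto simp: isCont_def intro: tendsto_within_subset)
    then obtain y where y: "y < x" "a < cdf M y"
      by (metis (mono_tags, lifting) eventually_at_left_field dense)
    show "\<forall>\<^sub>F n in sequentially. a < cdf (Mn n) (z n)"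
      using order_tendstoD(1)[OF lim y(2)] order_tendstoD(1)[OF z y(1)]
    proof eventually_elim
      case (elim n)
      then show ?case using Mn.cdf_nondecreasing[of y "z n" n] by simp
    qed
  next
    fix a assume a: "cdf M x < a"
    have "\<forall>\<^sub>F y in at_right x. cdf M y < a"
      using cont[of x] a by (intro order_tendstoD(2)) (auto simp: isCont_def intro: tendsto_within_subset)
    then obtain y where y: "x < y" "cdf M y < a"
      by (metis (mono_tags, lifting) eventually_at_right_field dense)
    show "\<forall>\<^sub>F n in sequentially. cdf (Mn n) (z n) < a"
      using order_tendstoD(2)[OF lim y(2)] order_tendstoD(2)[OF z y(1)]
    proof eventually_elim
      case (elim n)
      then show ?case using Mn.cdf_nondecreasing[of "z n" y n] by simp
    qed
  qed
qed

text \<open>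
  The compound Poisson approximation: since \<open>Re (z - 1) \<le> 0\<close>, both \<open>z\<close> and \<open>exp (z - 1)\<close> lie in the unit
  disc, where the \<open>N\<close>-th powers differ by at most \<open>N\<close> times the difference of the bases, which is
  \<open>o(z - 1)\<close>.
\<close>

lemma power_tendsto_exp:
  fixes z :: "nat \<Rightarrow> complex" and N :: "nat \<Rightarrow> nat"
  assumes le_1: "\<And>j. cmod (z j) \<le> 1" and z: "z \<longlonglongrightarrow> 1"
    and lim: "(\<lambda>j. of_nat (N j) * (z j - 1)) \<longlonglongrightarrow> \<psi>"
  shows "(\<lambda>j. z j ^ N j) \<longlonglongrightarrow> exp \<psi>"
proof -
  define \<zeta> where "\<zeta> j = z j - 1" for j
  have \<zeta>: "\<zeta> \<longlonglongrightarrow> 0" unfolding \<zeta>_def using tendsto_diff[OF z tendsto_const[of 1]] by simp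
  \<comment> \<open>The relative error of the first-order expansion of the exponential, continuously extended by \<open>0\<close>.\<close>
  define r where "r w = (if w = 0 then 0 else (exp w - 1) / w - 1)" for w :: complex
  have "((\<lambda>w. (exp w - 1) / w - 1) \<longlongrightarrow> 1 - (1::complex)) (at 0)"
    by (intro tendsto_intros lim_exp_minus_1)
  then have "((\<lambda>w. (exp w - 1) / w - 1) \<longlongrightarrow> (0::complex)) (at 0)" by simp
  then have "(r \<longlongrightarrow> 0) (at 0)"
    by (rule Lim_transform_eventually) (auto simp: r_def eventually_at_filter)
  then have "isCont r 0" by (simp add: isCont_def r_def)
  then have r: "(\<lambda>j. r (\<zeta> j)) \<longlonglongrightarrow> 0"
    using isCont_tendsto_compose[OF _ \<zeta>, of r] by (simp add: r_def)
  have r_eq: "exp w - 1 - w = w * r w" for w by (simp add: r_def field_simps)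
  have "(\<lambda>j. cmod (of_nat (N j) * \<zeta> j) * cmod (r (\<zeta> j))) \<longlonglongrightarrow> cmod \<psi> * cmod 0"
    using lim r by (intro tendsto_mult tendsto_norm) (auto simp: \<zeta>_def)
  then have small: "(\<lambda>j. cmod (of_nat (N j) * \<zeta> j) * cmod (r (\<zeta> j))) \<longlonglongrightarrow> 0" by simp
  have "cmod (z j ^ N j - exp (\<zeta> j) ^ N j) \<le> cmod (of_nat (N j) * \<zeta> j) * cmod (r (\<zeta> j))" for j
  proof -
    have "Re (\<zeta> j) \<le> 0" using le_1[of j] complex_Re_le_cmod[of "z j"] by (simp add: \<zeta>_def)
    then have "cmod (exp (\<zeta> j)) \<le> 1" by simp
    then have "cmod (z j ^ N j - exp (\<zeta> j) ^ N j) \<le> N j * cmod (z j - exp (\<zeta> j))"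
      by (intro norm_power_diff le_1)
    also have "z j - exp (\<zeta> j) = - (\<zeta> j * r (\<zeta> j))"
      using r_eq[of "\<zeta> j"] by (simp add: \<zeta>_def algebra_simps)
    finally show ?thesis by (simp add: norm_mult mult.assoc)
  qed
  then have "(\<lambda>j. z j ^ N j - exp (\<zeta> j) ^ N j) \<longlonglongrightarrow> 0"
    by (intro Lim_null_comparison[OF _ small]) auto
  moreover have "(\<lambda>j. exp (\<zeta> j) ^ N j) \<longlonglongrightarrow> exp \<psi>"
    using tendsto_exp[OF lim] by (simp add: exp_of_nat_mult \<zeta>_def)
  ultimately have "(\<lambda>j. (z j ^ N j - exp (\<zeta> j) ^ N j) + exp (\<zeta> j) ^ N j) \<longlonglongrightarrow> 0 + exp \<psi>"
    by (rule tendsto_add)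
  then show ?thesis by simp
qed

text \<open>
  Comparison with the Cauchy density, as the stretched exponential beats every polynomial.
\<close>

lemma integrable_exp_minus_powr:
  assumes "0 < (\<kappa>::real)" "0 < (\<alpha>::real)"
  shows "integrable lborel (\<lambda>t. exp (- \<kappa> * \<bar>t\<bar> powr \<alpha>))"
proof -
  have "((\<lambda>t. (1 + t ^ 2) * exp (- \<kappa> * t powr \<alpha>)) \<longlongrightarrow> 0) at_top"
    using assms by real_asymp
  then have "\<forall>\<^sub>F t in at_top. (1 + t ^ 2) * exp (- \<kappa> * t powr \<alpha>) < 1" by (rule order_tendstoD) simp
  then obtain T0 where T0: "\<And>t. T0 \<le> t \<Longrightarrow> (1 + t ^ 2) * exp (- \<kappa> * t powr \<alpha>) < 1"
    unfolding eventually_at_top_linorder by blast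
  define T where "T = max T0 0"
  have bound: "(1 + t ^ 2) * exp (- \<kappa> * t powr \<alpha>) \<le> 1 + T ^ 2" if "0 \<le> t" for t
  proof (cases "T \<le> t")
    case True
    then have "(1 + t ^ 2) * exp (- \<kappa> * t powr \<alpha>) < 1" by (intro T0) (simp add: T_def)
    then show ?thesis using zero_le_power2[of T] by linarith
  next
    case False
    have "exp (- \<kappa> * t powr \<alpha>) \<le> 1" using assms by simp
    then have "(1 + t ^ 2) * exp (- \<kappa> * t powr \<alpha>) \<le> (1 + t ^ 2) * 1"
      by (intro mult_left_mono) auto
    also have "\<dots> \<le> 1 + T ^ 2" using False that by (simp add: power_mono)
    finally show ?thesis .
  qed
  have "integrable lborel (\<lambda>t. inverse (1 + t ^ 2) :: real)"
    using integrable_inverse_1_plus_square by (simp add: set_integrable_def)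
  then have "integrable lborel (\<lambda>t. (1 + T ^ 2) * inverse (1 + t ^ 2) :: real)"
    by (rule integrable_mult_right)
  then show ?thesis
  proof (rule Bochner_Integration.integrable_bound)
    show "AE t in lborel. norm (exp (- \<kappa> * \<bar>t\<bar> powr \<alpha>)) \<le> norm ((1 + T ^ 2) * inverse (1 + t ^ 2) :: real)"
    proof (rule AE_I2)
      fix t :: real
      have p: "0 < 1 + t ^ 2" by (simp add: add_pos_nonneg)
      have "(1 + t ^ 2) * exp (- \<kappa> * \<bar>t\<bar> powr \<alpha>) \<le> 1 + T ^ 2" using bound[of "\<bar>t\<bar>"] by simp
      then have "exp (- \<kappa> * \<bar>t\<bar> powr \<alpha>) \<le> (1 + T ^ 2) * inverse (1 + t ^ 2)"
        using p by (simp add: pos_le_divide_eq mult.commute divide_inverse[symmetric])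
      then show "norm (exp (- \<kappa> * \<bar>t\<bar> powr \<alpha>)) \<le> norm ((1 + T ^ 2) * inverse (1 + t ^ 2) :: real)"
        by simp
    qed
  qed measurable
qed

section \<open>Convolution powers of a nonnegative law\<close>

lemma char_convolution:
  assumes "real_distribution M" "real_distribution N"
  shows "char (convolution M N) t = char M t * char N t"
proof -
  interpret M: real_distribution M by fact
  interpret N: real_distribution N by fact
  interpret P: pair_prob_space M N ..
  have "char (convolution M N) t = (CLINT p|M \<Otimes>\<^sub>M N. iexp (t * (fst p + snd p)))"
    unfolding char_def convolution_def by (subst integral_distr) (auto simp: split_beta')
  also have "\<dots> = (CLINT x|M. CLINT y|N. iexp (t * (x + y)))"
    by (subst P.integral_fst'[symmetric]) (auto intro!: P.P.integrable_const_bound[where B=1])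
  also have "\<dots> = (CLINT x|M. iexp (t * x) * char N t)"
    unfolding char_def by (simp add: distrib_left exp_add)
  also have "\<dots> = char M t * char N t" by (simp add: char_def)
  finally show ?thesis .
qed

lemma real_distribution_convolution:
  assumes "real_distribution M" "real_distribution N"
  shows "real_distribution (convolution M N)"
proof -
  interpret M: real_distribution M by fact
  interpret N: real_distribution N by fact
  interpret P: pair_prob_space M N ..
  have "prob_space (convolution M N)"
    unfolding convolution_def by (rule P.prob_space_distr) simp
  then show ?thesis by (simp add: real_distribution_def real_distribution_axioms_def)
qed

lemma real_distribution_conv_pow: "real_distribution \<mu> \<Longrightarrow> real_distribution (conv_pow \<mu> n)"
proof (induction n)
  case 0
  have "prob_space (return borel (0::real))" by (rule prob_space_return) simp
  then show ?case by (simp add: real_distribution_def real_distribution_axioms_def)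
qed (simp add: real_distribution_convolution)

lemma char_conv_pow: "real_distribution \<mu> \<Longrightarrow> char (conv_pow \<mu> n) t = char \<mu> t ^ n"
proof (induction n)
  case 0
  then show ?case by (simp add: char_def integral_return)
qed (simp add: char_convolution real_distribution_conv_pow)

text \<open>
  If a sum of two nonnegative variables is at most \<open>y\<close>, so is each of them.
\<close>

lemma cdf_convolution_le:
  assumes "real_distribution M" "real_distribution N" and M: "AE x in M. 0 \<le> x" and N: "measure N {..<0} = 0"
  shows "cdf (convolution M N) y \<le> cdf M y * cdf N y" "measure (convolution M N) {..<0} = 0"
proof -
  interpret M: real_distribution M by fact
  interpret N: real_distribution N by fact
  interpret MN: real_distribution "convolution M N" by (rule real_distribution_convolution) fact+
  have em: "emeasure (convolution M N) A = (\<integral>\<^sup>+x. emeasure N {a. a + x \<in> A} \<partial>M)" if "A \<in> sets borel" for A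
    using that by (intro convolution_emeasure) (auto simp: M.finite_measure_axioms N.finite_measure_axioms)
  have neg: "emeasure N S = 0" if "S \<subseteq> {..<0}" for S
    using emeasure_mono[of S "{..<0}" N] that N by (simp add: N.emeasure_eq_measure)
  have "emeasure (convolution M N) {..y} \<le> (\<integral>\<^sup>+x. emeasure N {..y} * indicator {..y} x \<partial>M)"
    unfolding em[OF atMost_borel]
  proof (rule nn_integral_mono_AE, use M in eventually_elim)
    case (elim x)
    show ?case
    proof (cases "x \<le> y")
      case True
      then show ?thesis using elim by (auto intro!: emeasure_mono)
    next
      case False
      then have "emeasure N {a. a + x \<in> {..y}} = 0" by (intro neg) auto
      then show ?thesis by simp
    qed
  qed
  also have "\<dots> = emeasure N {..y} * emeasure M {..y}" by (rule nn_integral_cmult_indicator) simp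
  finally have "ennreal (cdf (convolution M N) y) \<le> ennreal (cdf M y * cdf N y)"
    by (simp add: cdf_def M.emeasure_eq_measure N.emeasure_eq_measure MN.emeasure_eq_measure ennreal_mult'[symmetric] mult.commute)
  then show "cdf (convolution M N) y \<le> cdf M y * cdf N y"
    by (simp add: cdf_def)
  have "emeasure (convolution M N) {..<0} = (\<integral>\<^sup>+x. 0 \<partial>M)"
    unfolding em[OF lessThan_borel]
    by (rule nn_integral_cong_AE, use M in eventually_elim) (auto intro!: neg)
  then show "measure (convolution M N) {..<0} = 0" by (simp add: MN.emeasure_eq_measure)
qed

lemma cdf_conv_pow:
  assumes "real_distribution \<mu>" "AE x in \<mu>. 0 \<le> x"
  shows measure_conv_pow_neg: "measure (conv_pow \<mu> n) {..<0} = 0"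
    and cdf_conv_pow_le: "cdf (conv_pow \<mu> n) y \<le> cdf \<mu> y ^ n"
proof (induction n)
  case 0
  { case 1 show ?case by (simp add: measure_return) }
  { case 2 show ?case by (simp add: cdf_def measure_return) }
next
  case (Suc n)
  note le = cdf_convolution_le[OF assms(1) real_distribution_conv_pow[OF assms(1)] assms(2) Suc(1)]
  { case 1 show ?case using le(2) by simp }
  { case 2
    have "cdf \<mu> y * cdf (conv_pow \<mu> n) y \<le> cdf \<mu> y * cdf \<mu> y ^ n"
      using Suc(2) assms(1) by (intro mult_left_mono) (auto simp: cdf_def)
    then show ?case using le(1)[of y] by simp }
qed

section \<open>Step functions, substitution and subsequences\<close>

text \<open>
  Each term of the series is spread over an interval of length \<open>1 / b\<close>.
\<close>

lemma integral_step_function: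
  fixes f :: "nat \<Rightarrow> real"
  assumes b: "0 < b" and f: "\<And>n. 0 \<le> f n" "summable f"
  shows "set_integrable lborel {0<..} (\<lambda>u. f (nat \<lfloor>b * u\<rfloor>))"
    and "(LBINT u:{0<..}. f (nat \<lfloor>b * u\<rfloor>)) = (\<Sum>n. f n) / b"
proof -
  define g where "g n u = f n * indicator {real n / b..<(real n + 1) / b} u" for n u
  have g_int: "integrable lborel (g n)" for n
    unfolding g_def using b
    by (intro integrable_mult_right integrable_real_indicator) (auto simp: emeasure_lborel_Ico divide_right_mono)
  have g_val: "(LBINT u. g n u) = f n / b" for n
    using b unfolding g_def by (simp add: field_simps)
  have g_abs: "\<bar>g n u\<bar> = g n u" for n u using f by (simp add: g_def)
  have g_sums: "(\<lambda>n. g n u) sums (indicat_real {0<..} u *\<^sub>R f (nat \<lfloor>b * u\<rfloor>))" if "u \<noteq> 0" for u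
  proof (cases "0 < u")
    case True
    have z: "0 \<le> \<lfloor>b * u\<rfloor>" using True b by simp
    have mem: "u \<in> {real n / b..<(real n + 1) / b} \<longleftrightarrow> n = nat \<lfloor>b * u\<rfloor>" for n
    proof -
      have "u \<in> {real n / b..<(real n + 1) / b} \<longleftrightarrow> real n \<le> b * u \<and> b * u < real n + 1"
        by (simp add: pos_divide_le_eq[OF b] pos_less_divide_eq[OF b] mult.commute)
      also have "\<dots> \<longleftrightarrow> \<lfloor>b * u\<rfloor> = int n" by (simp add: floor_eq_iff)
      also have "\<dots> \<longleftrightarrow> n = nat \<lfloor>b * u\<rfloor>"
        using z by (metis int_nat_eq nat_int)
      finally show ?thesis .
    qed
    have "(\<lambda>n. g n u) = (\<lambda>n. if n = nat \<lfloor>b * u\<rfloor> then f n else 0)"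
    proof
      fix n show "g n u = (if n = nat \<lfloor>b * u\<rfloor> then f n else 0)"
        using mem[of n] unfolding g_def
        by (cases "n = nat \<lfloor>b * u\<rfloor>") (simp_all only: indicator_simps mult_1_right mult_zero_right if_True if_False simp_thms)
    qed
    then have "(\<lambda>n. g n u) sums f (nat \<lfloor>b * u\<rfloor>)"
      by (simp only: sums_single)
    moreover have "indicat_real {0<..} u = 1" using True by simp
    ultimately show ?thesis by (simp only: scaleR_one)
  next
    case False
    have "g n u = 0" for n
    proof -
      have "u < 0" using False that by linarith
      also have "0 \<le> real n / b" using b by simp
      finally have "u \<notin> {real n / b..<(real n + 1) / b}" by (simp only: atLeastLessThan_iff not_le[symmetric] simp_thms)
      then have "indicat_real {real n / b..<(real n + 1) / b} u = 0" by (rule indicator_simps(2))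
      then show ?thesis unfolding g_def by (simp only: mult_zero_right)
    qed
    moreover have "indicat_real {0<..} u = 0" using False by simp
    ultimately show ?thesis by (simp only: scaleR_zero_left sums_zero)
  qed
  have sm: "AE u in lborel. summable (\<lambda>n. norm (g n u))"
    using AE_lborel_singleton[of 0]
    by eventually_elim (unfold real_norm_def g_abs, rule sums_summable[OF g_sums])
  have sm2: "summable (\<lambda>n. LBINT u. norm (g n u))"
    using f(2) by (simp add: g_abs g_val summable_divide)
  have "AE u in lborel. (\<Sum>n. g n u) = indicat_real {0<..} u *\<^sub>R f (nat \<lfloor>b * u\<rfloor>)"
    using AE_lborel_singleton[of 0] by eventually_elim (use g_sums in \<open>auto simp: sums_iff\<close>)
  note ae = this
  have m1: "(\<lambda>u. \<Sum>n. g n u) \<in> borel_measurable lborel" unfolding g_def by measurable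
  have m2: "(\<lambda>u. indicat_real {0<..} u *\<^sub>R f (nat \<lfloor>b * u\<rfloor>)) \<in> borel_measurable lborel" by measurable
  show "set_integrable lborel {0<..} (\<lambda>u. f (nat \<lfloor>b * u\<rfloor>))"
    unfolding set_integrable_def integrable_cong_AE[OF m1 m2 ae, symmetric]
    by (rule integrable_suminf[OF g_int sm sm2])
  have "(LBINT u:{0<..}. f (nat \<lfloor>b * u\<rfloor>)) = (LBINT u. \<Sum>n. g n u)"
    unfolding set_lebesgue_integral_def by (rule integral_cong_AE[OF m1 m2 ae, symmetric])
  also have "\<dots> = (\<Sum>n. f n / b)"
    unfolding integral_suminf[OF g_int sm sm2] g_val ..
  finally show "(LBINT u:{0<..}. f (nat \<lfloor>b * u\<rfloor>)) = (\<Sum>n. f n) / b"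
    using suminf_divide[OF f(2)] by simp
qed

lemma powr_substitution:
  fixes f :: "real \<Rightarrow> real"
  assumes \<alpha>: "0 < \<alpha>" and [measurable]: "f \<in> borel_measurable borel" and f: "set_integrable lborel {0<..} f"
  shows "\<alpha> * (LBINT x:{0<..}. f (x powr (- \<alpha>)) * x powr (- \<alpha> - 1)) = (LBINT u:{0<..}. f u)"
proof -
  let ?g = "\<lambda>x::real. x powr (- \<alpha>)" and ?g' = "\<lambda>x::real. - \<alpha> * x powr (- \<alpha> - 1)"
  have deriv: "(?g has_field_derivative ?g' x) (at x within {0<..})" if "x \<in> {0<..}" for x
    using that by (auto intro!: derivative_eq_intros)
  have inj: "inj_on ?g {0<..}"
    using \<alpha> by (intro inj_on_inverseI[where g="\<lambda>u. u powr (- (1 / \<alpha>))"]) (auto simp: powr_powr)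
  have img: "?g ` {0<..} = {0<..}"
  proof (intro equalityI subsetI)
    fix u :: real assume "u \<in> {0<..}"
    then show "u \<in> ?g ` {0<..}" using \<alpha> by (intro image_eqI[of _ _ "u powr (- (1 / \<alpha>))"]) (auto simp: powr_powr)
  qed auto
  have abs_f: "f absolutely_integrable_on {0<..}"
    using f integrable_completion[of "\<lambda>x. indicat_real {0<..} x *\<^sub>R f x" lborel] by (simp add: set_integrable_def)
  have "(LBINT u:{0<..}. f u) = integral {0<..} f" by (rule set_borel_integral_eq_integral(2)[OF f])
  then have rhs: "f absolutely_integrable_on ?g ` {0<..} \<and> integral (?g ` {0<..}) f = (LBINT u:{0<..}. f u)"
    unfolding img using abs_f by simp
  have S: "{0::real<..} \<in> sets lebesgue" by simp
  have iff: "((\<lambda>x. \<bar>?g' x\<bar> * f (?g x)) absolutely_integrable_on {0<..}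
      \<and> integral {0<..} (\<lambda>x. \<bar>?g' x\<bar> * f (?g x)) = (LBINT u:{0<..}. f u))
    \<longleftrightarrow> (f absolutely_integrable_on ?g ` {0<..} \<and> integral (?g ` {0<..}) f = (LBINT u:{0<..}. f u))"
    by (rule has_absolute_integral_change_of_variables_1'[OF S _ inj]) (erule deriv)
  note ai = conjunct1[OF iffD2[OF iff rhs]] and eq = conjunct2[OF iffD2[OF iff rhs]]
  define G where "G = (\<lambda>x::real. \<bar>?g' x\<bar> * f (?g x))"
  have G: "G \<in> borel_measurable borel" unfolding G_def by measurable
  have G_meas: "(\<lambda>x. indicat_real {0<..} x *\<^sub>R G x) \<in> borel_measurable lborel"
    using G by simp
  have "set_lebesgue_integral lborel {0<..} G = set_lebesgue_integral lebesgue {0<..} G"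
    unfolding set_lebesgue_integral_def by (simp only: integral_completion[OF G_meas])
  also have "\<dots> = (LBINT u:{0<..}. f u)"
    using set_lebesgue_integral_eq_integral(2)[OF ai] eq unfolding G_def by simp
  finally have "set_lebesgue_integral lborel {0<..} G = (LBINT u:{0<..}. f u)" .
  moreover have "set_lebesgue_integral lborel {0<..} G
      = set_lebesgue_integral lborel {0<..} (\<lambda>x. \<alpha> * (f (x powr (- \<alpha>)) * x powr (- \<alpha> - 1)))"
    unfolding G_def using \<alpha> by (intro set_lebesgue_integral_cong) (auto simp: abs_mult)
  ultimately show ?thesis by simp
qed

lemma subsequence_tendsto_at_top:
  fixes f :: "real \<Rightarrow> real"
  assumes "\<And>y::nat \<Rightarrow> real. filterlim y at_top sequentially \<Longrightarrow>
      \<exists>r::nat \<Rightarrow> nat. strict_mono r \<and> (\<lambda>j. f (y (r j))) \<longlonglongrightarrow> 0"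
  shows "(f \<longlongrightarrow> 0) at_top"
proof (rule ccontr)
  assume "\<not> ?thesis"
  then obtain e where e: "0 < e" "\<not> (\<forall>\<^sub>F y in at_top. dist (f y) 0 < e)" by (auto simp: tendsto_iff)
  then have "\<exists>y\<ge>real n. e \<le> \<bar>f y\<bar>" for n :: nat
    unfolding eventually_at_top_linorder by (auto simp: not_less)
  then obtain y where y: "\<And>n::nat. real n \<le> y n" "\<And>n. e \<le> \<bar>f (y n)\<bar>" by metis
  have "filterlim y at_top sequentially"
    by (rule filterlim_at_top_mono[OF filterlim_real_sequentially always_eventually]) (use y in auto)
  then obtain r where "(\<lambda>j. f (y (r j))) \<longlonglongrightarrow> 0" using assms by blast
  then have "\<forall>\<^sub>F j in sequentially. dist (f (y (r j))) 0 < e" using e(1) by (rule tendstoD)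
  then obtain j where "\<bar>f (y (r j))\<bar> < e" by (auto simp: eventually_sequentially)
  then show False using y(2)[of "r j"] by simp
qed

lemma floor_ratio_tendsto:
  fixes x \<kappa> :: "nat \<Rightarrow> real"
  assumes \<kappa>: "filterlim \<kappa> at_top sequentially" and x: "\<forall>\<^sub>F j in sequentially. 0 \<le> x j"
    and lim: "(\<lambda>j. x j / \<kappa> j) \<longlonglongrightarrow> l"
  shows "(\<lambda>j. real (nat \<lfloor>x j\<rfloor>) / \<kappa> j) \<longlonglongrightarrow> l"
proof (rule tendsto_sandwich[OF _ _ _ lim])
  have "(\<lambda>j. x j / \<kappa> j - 1 / \<kappa> j) \<longlonglongrightarrow> l - 0"
    by (intro tendsto_diff lim tendsto_divide_0[OF tendsto_const] filterlim_at_top_imp_at_infinity \<kappa>)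
  then show "(\<lambda>j. x j / \<kappa> j - 1 / \<kappa> j) \<longlonglongrightarrow> l" by simp
  have pos: "\<forall>\<^sub>F j in sequentially. 0 < \<kappa> j" using \<kappa> by (simp add: filterlim_at_top_dense)
  show "\<forall>\<^sub>F j in sequentially. x j / \<kappa> j - 1 / \<kappa> j \<le> real (nat \<lfloor>x j\<rfloor>) / \<kappa> j"
    using pos
  proof eventually_elim
    case (elim j)
    have "x j - 1 \<le> real (nat \<lfloor>x j\<rfloor>)" by linarith
    then show ?case unfolding diff_divide_distrib[symmetric] using elim by (intro divide_right_mono) auto
  qed
  show "\<forall>\<^sub>F j in sequentially. real (nat \<lfloor>x j\<rfloor>) / \<kappa> j \<le> x j / \<kappa> j"
    using pos x
  proof eventually_elim
    case (elim j)
    then have "real (nat \<lfloor>x j\<rfloor>) \<le> x j" by linarith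
    then show ?case using elim by (intro divide_right_mono) auto
  qed
qed

section \<open>The tail along the norming sequence\<close>

lemma index_quotient_tendsto:
  fixes b :: "nat \<Rightarrow> real"
  assumes ratio: "(\<lambda>n. b (Suc n) / b n) \<longlonglongrightarrow> q" and nz: "\<forall>\<^sub>F n in sequentially. b n \<noteq> 0"
  shows "(\<lambda>n. b (n + i) / b n) \<longlonglongrightarrow> q ^ i"
proof (induction i)
  case 0
  have "\<forall>\<^sub>F n in sequentially. 1 = b (n + 0) / b n" using nz by eventually_elim auto
  then show ?case by (rule Lim_transform_eventually[rotated]) simp
next
  case (Suc i)
  have "(\<lambda>n. b (Suc (n + i)) / b (n + i) * (b (n + i) / b n)) \<longlonglongrightarrow> q * q ^ i"
    by (intro tendsto_mult Suc LIMSEQ_ignore_initial_segment[OF ratio])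
  moreover have "\<forall>\<^sub>F n in sequentially. b (Suc (n + i)) / b (n + i) * (b (n + i) / b n) = b (n + Suc i) / b n"
    using eventually_all_ge_at_top[OF nz]
  proof eventually_elim
    case (elim n)
    then have "b (n + i) \<noteq> 0" by simp
    then show ?case by simp
  qed
  ultimately show ?case using Lim_transform_eventually by fastforce
qed

text \<open>
  The hypotheses on the step law \<open>\<mu>\<close>: it lives on \<open>[0, \<infinity>)\<close> and belongs to the domain of geometric
  partial attraction described by \<open>\<alpha>\<close>, \<open>l1\<close>, the sequence \<open>k\<close> and the logarithmically periodic
  modulation \<open>M\<close>.
\<close>

locale semistable_tail = regular_norming \<alpha> l1 for \<alpha> :: real and l1 :: "real \<Rightarrow> real" +
  fixes c :: real and k :: "nat \<Rightarrow> nat" and M h :: "real \<Rightarrow> real" and \<mu> :: "real measure"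
  assumes alpha_less_1: "\<alpha> < 1" and c_gt_1: "1 < c" and k_0: "k 0 = 0" and k_mono: "strict_mono k"
    and k_ratio: "(\<lambda>n. real (k (Suc n)) / real (k n)) \<longlonglongrightarrow> c"
    and M_bounds: "\<exists>m>0. \<exists>K. \<forall>x>0. m \<le> M x \<and> M x \<le> K"
    and M_periodic: "\<forall>x>0. M (c powr (1 / \<alpha>) * x) = M x"
    and M_mono: "antimono_on {0<..} (\<lambda>x. M x * x powr (- \<alpha>))"
    and law: "real_distribution \<mu>" and law_nonneg: "AE x in \<mu>. 0 \<le> x"
    and tail: "\<forall>\<^sub>F x in at_top. 1 - cdf \<mu> x = ell \<alpha> l1 x / x powr \<alpha> * (M (delta \<alpha> l1 k x) + h x)"
    and h_lim: "\<And>x. 0 < x \<Longrightarrow> isCont M x \<Longrightarrow> (\<lambda>n. h (norming \<alpha> l1 (real (k n)) * x)) \<longlonglongrightarrow> 0"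
begin

definition a :: "nat \<Rightarrow> real" where "a n = A (real (k n))"
text \<open>
  The limit of the ratios \<open>a (Suc n) / a n\<close>, and at the same time the period of \<open>M\<close>.
\<close>

definition d :: real where "d = c powr (1 / \<alpha>)"
definition Fbar :: "real \<Rightarrow> real" where "Fbar x = 1 - cdf \<mu> x"

sublocale law: real_distribution \<mu> by (rule law)

lemma d_gt_1: "1 < d" using c_gt_1 alpha_pos by (simp add: d_def)

lemma k_ge: "n \<le> k n" using strict_mono_imp_increasing[OF k_mono] .

lemma k_pos: "1 \<le> n \<Longrightarrow> 1 \<le> k n" using k_ge[of n] by simp

lemma k_at_top: "filterlim (\<lambda>n. real (k n)) at_top sequentially"
  by (rule filterlim_at_top_mono[OF filterlim_real_sequentially always_eventually]) (use k_ge in auto)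

lemma a_pos: "1 \<le> n \<Longrightarrow> 0 < a n"
  unfolding a_def using k_pos[of n] by (intro A_pos) simp

lemma a_at_top: "filterlim a at_top sequentially"
  unfolding a_def by (rule filterlim_compose[OF A_at_top k_at_top])

lemma a_ratio: "(\<lambda>n. a (Suc n) / a n) \<longlonglongrightarrow> d"
proof -
  have "(\<lambda>n. A (real (k (Suc n)) / real (k n) * real (k n)) / A (real (k n))) \<longlonglongrightarrow> c powr (1 / \<alpha>)"
    using c_gt_1 by (intro A_ratio k_at_top k_ratio) auto
  moreover have "\<forall>\<^sub>F n in sequentially. A (real (k (Suc n)) / real (k n) * real (k n)) / A (real (k n)) = a (Suc n) / a n"
    using eventually_ge_at_top[of 1]
  proof eventually_elim
    case (elim n)
    then show ?case using k_pos[of n] by (simp add: a_def)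
  qed
  ultimately show ?thesis unfolding d_def by (rule Lim_transform_eventually)
qed

lemma a_ratio_shift: "(\<lambda>n. a (n + i) / a n) \<longlonglongrightarrow> d ^ i"
  by (rule index_quotient_tendsto[OF a_ratio])
     (use a_pos in \<open>auto intro!: eventually_mono[OF eventually_ge_at_top[of 1]] simp: less_imp_neq[THEN not_sym]\<close>)

abbreviation in_block :: "nat \<Rightarrow> real \<Rightarrow> bool" where
  "in_block j y \<equiv> a j \<le> y \<and> y < a (Suc j) \<and> delta \<alpha> l1 k y = y / a j"

text \<open>
  Since the ratios \<open>a (Suc n) / a n\<close> tend to \<open>d > 1\<close>, the norming constants eventually increase
  strictly to infinity. Hence every large \<open>y\<close> lies in exactly one of the intervals
  \<open>[a j, a (Suc j))\<close>, and the definite description in \<open>delta\<close> picks its index.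
\<close>

lemma delta_eq:
  obtains n0 where "1 \<le> n0" "\<And>n. n0 \<le> n \<Longrightarrow> a n < a (Suc n)"
    "\<And>n. n0 \<le> n \<Longrightarrow> \<forall>\<^sub>F y in at_top. \<exists>j\<ge>n. in_block j y"
proof -
  have "\<forall>\<^sub>F n in sequentially. 1 < a (Suc n) / a n" by (rule order_tendstoD(1)[OF a_ratio d_gt_1])
  moreover have "\<forall>\<^sub>F n in sequentially. 0 < a n"
    using a_pos by (auto intro!: eventually_mono[OF eventually_ge_at_top[of 1]])
  ultimately have "\<forall>\<^sub>F n in sequentially. a n < a (Suc n) \<and> 1 \<le> n"
    using eventually_ge_at_top[of 1] by eventually_elim (auto simp: field_simps)
  then obtain n0 where n0: "1 \<le> n0" "\<And>n. n0 \<le> n \<Longrightarrow> a n < a (Suc n)"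
    unfolding eventually_sequentially by blast
  have incr: "a i \<le> a j" if "n0 \<le> i" "i \<le> j" for i j
    using that(2)
  proof (induction rule: dec_induct)
    case (step j)
    then show ?case using n0(2)[of j] that(1) by simp
  qed simp
  have "\<forall>\<^sub>F y in at_top. \<exists>j\<ge>n1. in_block j y" if n1: "n0 \<le> n1" for n1
  proof -
    have "\<forall>\<^sub>F y in at_top. \<forall>i\<in>{..n1}. a i < y"
      by (intro eventually_ball_finite) (auto intro: eventually_gt_at_top)
    then show ?thesis
    proof eventually_elim
      case (elim y)
      have ex: "\<exists>i. n1 \<le> i \<and> y < a (Suc i)"
      proof -
        have "\<forall>\<^sub>F n in sequentially. y < a n" using a_at_top by (simp add: filterlim_at_top_dense)
        then obtain i where i: "\<And>n. i \<le> n \<Longrightarrow> y < a n" by (auto simp: eventually_sequentially)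
        show ?thesis using i[of "Suc (max n1 i)"] by (intro exI[of _ "max n1 i"]) auto
      qed
      define j where "j = (LEAST i. n1 \<le> i \<and> y < a (Suc i))"
      have j: "n1 \<le> j" "y < a (Suc j)" using LeastI_ex[OF ex] by (auto simp: j_def)
      have aj: "a j \<le> y"
      proof (cases "j = n1")
        case True then show ?thesis using elim by force
      next
        case False
        then obtain j' where j': "j = Suc j'" "n1 \<le> j'" using j(1) by (cases j) auto
        have "j' < (LEAST i. n1 \<le> i \<and> y < a (Suc i))" using j'(1) by (simp add: j_def)
        from not_less_Least[OF this] have "\<not> (n1 \<le> j' \<and> y < a (Suc j'))" .
        then show ?thesis using j' by simp
      qed
      have uniq: "i = j" if "1 \<le> i \<and> a i \<le> y \<and> y < a (Suc i)" for i
      proof (rule ccontr)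
        assume "i \<noteq> j"
        have "\<not> Suc i \<le> n1" using elim that by force
        then have i: "n1 \<le> i" by simp
        from \<open>i \<noteq> j\<close> consider "Suc i \<le> j" | "Suc j \<le> i" by linarith
        then show False
        proof cases
          case 1 then show False using incr[of "Suc i" j] i n1 aj that by simp
        next
          case 2 then show False using incr[of "Suc j" i] j n1 that by simp
        qed
      qed
      have "(THE n. n \<ge> 1 \<and> a n \<le> y \<and> y < a (Suc n)) = j"
        by (rule the_equality) (use j aj n1 n0(1) uniq in auto)
      then have "delta \<alpha> l1 k y = y / a j" unfolding delta_def a_def by simp
      then show ?case using j aj by blast
    qed
  qed
  with n0 show ?thesis using that by blast
qed

lemma M_period_power: "0 < x \<Longrightarrow> M (d ^ i * x) = M x"
proof (induction i)
  case (Suc i)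
  have "0 < d ^ i * x" using Suc d_gt_1 by simp
  then have "M (d * (d ^ i * x)) = M (d ^ i * x)" using M_periodic by (simp add: d_def)
  then show ?case using Suc by (simp add: mult.assoc)
qed simp

text \<open>
  The block of \<open>a n * x\<close> has index \<open>n + i\<close> with \<open>i\<close> in a bounded range, and for each such \<open>i\<close> the
  constants \<open>a (n + i)\<close> and \<open>d\<^sup>i * a n\<close> are asymptotically equal. By the periodicity of \<open>M\<close> the factor
  \<open>d\<^sup>i\<close> is harmless, whichever \<open>i\<close> occurs; this covers the points \<open>x = d\<^sup>i\<close> at which the index may
  oscillate.
\<close>

lemma M_delta_limit:
  assumes x: "0 < x" and cont: "isCont M x"
  shows "(\<lambda>n. M (delta \<alpha> l1 k (a n * x))) \<longlonglongrightarrow> M x"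
proof -
  obtain n0 where n0: "1 \<le> n0" "\<And>n. n0 \<le> n \<Longrightarrow> a n < a (Suc n)"
    and ex: "\<And>n. n0 \<le> n \<Longrightarrow> \<forall>\<^sub>F y in at_top. \<exists>j\<ge>n. in_block j y"
    using delta_eq by blast
  have incr: "a i \<le> a j" if "n0 \<le> i" "i \<le> j" for i j
    using that(2)
  proof (induction rule: dec_induct)
    case (step j)
    then show ?case using n0(2)[of j] that(1) by simp
  qed simp
  obtain I1 where I1: "x < d ^ I1" using real_arch_pow[OF d_gt_1] by blast
  obtain I2 where I2: "1 / x < d ^ I2" using real_arch_pow[OF d_gt_1] by blast
  define I where "I = max I1 I2"
  have "d ^ I1 \<le> d ^ I" "d ^ I2 \<le> d ^ I" using d_gt_1 by (auto simp: I_def intro!: power_increasing)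
  then have I: "x < d ^ I" "1 / x < d ^ I" using I1 I2 by auto
  \<comment> \<open>To keep exponents natural, indices are counted from \<open>b = n - I\<close>, so that \<open>n\<close> is \<open>b + I\<close> and the
    block index is \<open>b + i\<close> with \<open>i \<le> 2 * I\<close>.\<close>
  define z where "z i b = d ^ i * a (b + I) * x / a (b + i)" for i b
  have nz: "\<forall>\<^sub>F b in sequentially. 0 < a b" using a_pos by (auto intro!: eventually_mono[OF eventually_ge_at_top[of 1]])
  have z_lim: "z i \<longlonglongrightarrow> d ^ I * x" for i
  proof -
    have "(\<lambda>b. d ^ i * (a (b + I) / a b) * x / (a (b + i) / a b)) \<longlonglongrightarrow> d ^ i * d ^ I * x / d ^ i"
      using d_gt_1 by (intro tendsto_intros a_ratio_shift) auto
    moreover have "\<forall>\<^sub>F b in sequentially. d ^ i * (a (b + I) / a b) * x / (a (b + i) / a b) = z i b"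
      using nz by eventually_elim (simp add: z_def)
    ultimately show ?thesis using d_gt_1 Lim_transform_eventually by fastforce
  qed
  have "\<forall>\<^sub>F y in nhds (d ^ I * x). M y = M (y / d ^ I)"
  proof (rule eventually_mono[OF eventually_nhds_in_open[of "{0<..}"]])
    show "d ^ I * x \<in> {0<..}" using x d_gt_1 by simp
    fix y :: real assume "y \<in> {0<..}"
    then show "M y = M (y / d ^ I)" using M_period_power[of "y / d ^ I" I] d_gt_1 by simp
  qed simp
  then have "isCont M (d ^ I * x) \<longleftrightarrow> isCont (\<lambda>y. M (y / d ^ I)) (d ^ I * x)" by (rule isCont_cong)
  moreover have "isCont (\<lambda>y. M (y / d ^ I)) (d ^ I * x)"
    using cont d_gt_1 by (intro isCont_o2[where g=M and f="\<lambda>y. y / d ^ I"]) auto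
  ultimately have cont': "isCont M (d ^ I * x)" by blast
  have Mz: "(\<lambda>b. M (z i b)) \<longlonglongrightarrow> M x" for i
    using isCont_tendsto_compose[OF cont' z_lim] M_period_power[OF x] by simp
  have "(\<lambda>b. \<Sum>i\<le>2 * I. \<bar>M (z i b) - M x\<bar>) \<longlonglongrightarrow> (\<Sum>i\<le>2 * I. \<bar>M x - M x\<bar>)"
    by (intro tendsto_intros Mz)
  then have sum_lim: "(\<lambda>b. \<Sum>i\<le>2 * I. \<bar>M (z i b) - M x\<bar>) \<longlonglongrightarrow> 0" by simp
  have y_lim: "filterlim (\<lambda>b. a (b + I) * x) at_top sequentially"
    by (rule filterlim_at_top_mult_tendsto_pos[OF tendsto_const x])
       (rule filterlim_compose[OF a_at_top filterlim_add_const_nat_at_top])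
  have bound: "\<forall>\<^sub>F b in sequentially.
      norm (M (delta \<alpha> l1 k (a (b + I) * x)) - M x) \<le> (\<Sum>i\<le>2 * I. \<bar>M (z i b) - M x\<bar>)"
    using order_tendstoD(1)[OF a_ratio_shift I(2)]
      order_tendstoD(1)[OF LIMSEQ_ignore_initial_segment[OF a_ratio_shift, of I I] I(1)]
      eventually_ge_at_top[of n0] filterlim_iff[THEN iffD1, OF y_lim, rule_format, OF ex[OF order_refl]] nz
  proof eventually_elim
    case (elim b)
    let ?y = "a (b + I) * x"
    obtain j where j: "n0 \<le> j" "a j \<le> ?y" "?y < a (Suc j)" "delta \<alpha> l1 k ?y = ?y / a j"
      using elim by blast
    have lo: "a b < ?y" using elim x by (simp add: field_simps)
    have "0 < a (b + I)" using elim n0(1) by (intro a_pos) auto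
    then have hi: "?y < a (b + I + I)" using elim by (simp add: field_simps)
    have "\<not> Suc j \<le> b" using incr[of "Suc j" b] j lo by fastforce
    moreover have "\<not> b + I + I \<le> j" using incr[of "b + I + I" j] j hi elim by fastforce
    ultimately obtain i where i: "j = b + i" "i \<le> 2 * I" by (intro that[of "j - b"]) auto
    have "0 < ?y / a j" using j n0 x a_pos[of j] a_pos[of "b + I"] elim by simp
    then have "M (delta \<alpha> l1 k ?y) = M (d ^ i * (?y / a j))"
      using M_period_power[of "?y / a j" i] j by simp
    also have "d ^ i * (?y / a j) = z i b" by (simp add: z_def i(1) mult.assoc)
    finally have "norm (M (delta \<alpha> l1 k ?y) - M x) = \<bar>M (z i b) - M x\<bar>" by simp
    also have "\<dots> \<le> (\<Sum>i\<le>2 * I. \<bar>M (z i b) - M x\<bar>)"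
      using i by (intro member_le_sum) auto
    finally show ?case .
  qed
  have "(\<lambda>b. M (delta \<alpha> l1 k (a (b + I) * x)) - M x) \<longlonglongrightarrow> 0"
    by (rule Lim_null_comparison[OF bound sum_lim])
  then have "(\<lambda>b. M (delta \<alpha> l1 k (a (b + I) * x))) \<longlonglongrightarrow> M x" by (simp add: LIM_zero_iff)
  then show ?thesis by (rule LIMSEQ_offset)
qed

lemma M_pos: "0 < x \<Longrightarrow> 0 < M x" using M_bounds by (meson less_le_trans)

text \<open>
  The monotone function \<open>M x * x powr (- \<alpha>)\<close> and \<open>M\<close> have the same continuity points.
\<close>

lemma M_continuity_point:
  assumes "0 < u" "u < v"
  obtains x where "u < x" "x < v" "isCont M x"
proof -
  let ?T = "\<lambda>x. M x * x powr (- \<alpha>)"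
  obtain x where x: "u < x" "x < v" "isCont ?T x"
    using antimono_continuity_point[OF M_mono, of u v] assms by auto
  have "\<forall>\<^sub>F y in nhds x. M y = ?T y * y powr \<alpha>"
    by (rule eventually_mono[OF eventually_nhds_in_open[of "{0<..}"]])
       (use x assms in \<open>auto simp: powr_minus\<close>)
  then have "isCont M x \<longleftrightarrow> isCont (\<lambda>y. ?T y * y powr \<alpha>) x" by (rule isCont_cong)
  moreover have "isCont (\<lambda>y. ?T y * y powr \<alpha>) x"
  proof (rule continuous_mult[OF x(3)])
    show "isCont (\<lambda>y. y powr \<alpha>) x" using x assms by (intro continuous_intros) auto
  qed
  ultimately show ?thesis using that x by blast
qed

lemma Fbar_mono: "x \<le> y \<Longrightarrow> Fbar y \<le> Fbar x"
  unfolding Fbar_def using law.cdf_nondecreasing[of x y] by simp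

lemma Fbar_nonneg: "0 \<le> Fbar x" unfolding Fbar_def using law.cdf_bounded_prob[of x] by simp
lemma Fbar_le_1: "Fbar x \<le> 1" unfolding Fbar_def using law.cdf_nonneg[of x] by simp

lemma Fbar_eq_measure: "Fbar x = measure \<mu> {x<..}"
proof -
  have "measure \<mu> {x<..} = 1 - measure \<mu> {..x}"
    using law.prob_compl[of "{..x}"] by (simp add: Compl_eq_Diff_UNIV[symmetric])
  then show ?thesis by (simp add: Fbar_def cdf_def)
qed

lemma Fbar_at_top: "(Fbar \<longlongrightarrow> 0) at_top"
  using tendsto_diff[OF tendsto_const[of 1] law.cdf_lim_at_top_prob] by (simp add: Fbar_def[abs_def])

lemma tail_along_norming:
  assumes x: "0 < x"
  shows "\<forall>\<^sub>F n in sequentially. Fbar (a n * x) = (M (delta \<alpha> l1 k (a n * x)) + h (a n * x)) / B (a n * x)"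
proof -
  have y: "filterlim (\<lambda>n. a n * x) at_top sequentially"
    by (rule filterlim_at_top_mult_tendsto_pos[OF tendsto_const x a_at_top])
  have "\<forall>\<^sub>F y in at_top. Fbar y = (M (delta \<alpha> l1 k y) + h y) / B y"
    using tail eventually_gt_at_top[of 0]
    by eventually_elim (simp add: Fbar_def ell_over_powr)
  then show ?thesis by (rule filterlim_iff[THEN iffD1, OF y, rule_format])
qed

lemma modulation_limit:
  assumes x: "0 < x" and cont: "isCont M x"
  shows "(\<lambda>n. M (delta \<alpha> l1 k (a n * x)) + h (a n * x)) \<longlonglongrightarrow> M x"
  using tendsto_add[OF M_delta_limit[OF assms] h_lim[OF assms]] by (simp add: a_def)

text \<open>
  The tail of \<open>\<mu>\<close> vanishes at infinity while along \<open>a n * x\<close> it equals \<open>1 / B\<close> times a quantity with the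
  positive limit \<open>M x\<close>. Hence \<open>B\<close> diverges along this sequence, and everywhere by monotonicity.
\<close>

sublocale regular_norming_inverse
proof
  obtain x where x: "1 < x" "x < 2" "isCont M x" using M_continuity_point[of 1 2] by auto
  have y: "filterlim (\<lambda>n. a n * x) at_top sequentially"
    by (rule filterlim_at_top_mult_tendsto_pos[OF tendsto_const _ a_at_top]) (use x in simp)
  let ?L = "\<lambda>n. M (delta \<alpha> l1 k (a n * x)) + h (a n * x)"
  have L: "?L \<longlonglongrightarrow> M x" using x by (intro modulation_limit) auto
  have Mx: "0 < M x" using x by (intro M_pos) simp
  have "(\<lambda>n. Fbar (a n * x) / ?L n) \<longlonglongrightarrow> 0 / M x"
    using Mx by (intro tendsto_divide L filterlim_compose[OF Fbar_at_top y]) auto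
  then have lim: "(\<lambda>n. Fbar (a n * x) / ?L n) \<longlonglongrightarrow> 0" by simp
  show "filterlim B at_top at_top"
    unfolding filterlim_at_top
  proof
    fix Z :: real
    define Z' where "Z' = max Z 1"
    have xp: "0 < x" using x by simp
    have "\<forall>\<^sub>F n in sequentially. Fbar (a n * x) / ?L n < 1 / Z'"
      by (rule order_tendstoD(2)[OF lim]) (simp add: Z'_def)
    then have "\<forall>\<^sub>F n in sequentially. Z' < B (a n * x) \<and> 0 < a n * x"
      using order_tendstoD(1)[OF L Mx] tail_along_norming[OF xp] eventually_ge_at_top[of "1::nat"]
    proof eventually_elim
      case (elim n)
      have p: "0 < a n * x" using elim xp a_pos[of n] by simp
      have "Fbar (a n * x) / ?L n = 1 / B (a n * x)" using elim by (simp del: of_nat_Suc)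
      then have "1 / B (a n * x) < 1 / Z'" using elim by simp
      moreover have "0 < Z'" "0 < B (a n * x)" using B_ge_1[OF p] by (auto simp: Z'_def)
      ultimately show ?case using p by (simp add: field_simps)
    qed
    then obtain n where n: "Z' < B (a n * x)" "0 < a n * x" by (auto simp: eventually_sequentially)
    have "\<forall>\<^sub>F y in at_top. a n * x \<le> y" by (rule eventually_ge_at_top)
    then show "\<forall>\<^sub>F y in at_top. Z \<le> B y"
    proof eventually_elim
      case (elim y)
      then have "B (a n * x) \<le> B y" using n by (intro B_mono)
      then show ?case using n by (simp add: Z'_def)
    qed
  qed
qed

lemma B_along: "0 < x \<Longrightarrow> (\<lambda>n. B (a n * x) / k n) \<longlonglongrightarrow> x powr \<alpha>"
  unfolding a_def by (rule B_A[OF k_at_top])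

text \<open>
  The basic attraction statement: along the norming sequence the rescaled tails converge to the tail of
  the Levy measure with parameter \<open>1\<close>.
\<close>

lemma tail_limit:
  assumes x: "0 < x" and cont: "isCont M x"
  shows "(\<lambda>n. k n * Fbar (a n * x)) \<longlonglongrightarrow> x powr (- \<alpha>) * M x"
proof -
  have "(\<lambda>n. (M (delta \<alpha> l1 k (a n * x)) + h (a n * x)) / (B (a n * x) / k n)) \<longlonglongrightarrow> M x / x powr \<alpha>"
    using x by (intro tendsto_divide modulation_limit B_along cont) auto
  moreover have "\<forall>\<^sub>F n in sequentially.
      (M (delta \<alpha> l1 k (a n * x)) + h (a n * x)) / (B (a n * x) / k n) = k n * Fbar (a n * x)"
    using tail_along_norming[OF x] by eventually_elim simp
  ultimately have "(\<lambda>n. k n * Fbar (a n * x)) \<longlonglongrightarrow> M x / x powr \<alpha>" by (rule Lim_transform_eventually)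
  then show ?thesis by (simp add: powr_minus field_simps)
qed

text \<open>
  Any exponent strictly between \<open>\<alpha>\<close> and \<open>1\<close> would do.
\<close>

definition \<rho> :: real where "\<rho> = (\<alpha> + 1) / 2"

lemma rho_bounds: "\<alpha> < \<rho>" "\<rho> < 1" "0 < \<rho>" using alpha_pos alpha_less_1 by (auto simp: \<rho>_def)

text \<open>
  Equivalently \<open>y powr \<rho> * Fbar y\<close> is at most a constant times \<open>b n = a n powr \<rho> / k n\<close> for \<open>y \<le> a n\<close>.
  Since \<open>\<rho> > \<alpha>\<close>, the sequence \<open>b\<close> eventually increases, so the bound survives the passage from \<open>n\<close> to
  \<open>Suc n\<close>; on the new range \<open>(a n, a (Suc n)]\<close> it follows from \<open>k n * Fbar (a n)\<close> being bounded.
\<close>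

lemma tail_power_bound:
  obtains C N where "0 \<le> C" "1 \<le> N"
    "\<And>n y. N \<le> n \<Longrightarrow> 0 < y \<Longrightarrow> y \<le> 1 \<Longrightarrow> k n * Fbar (a n * y) \<le> C * y powr (- \<rho>)"
proof -
  obtain x0 where x0: "1 / 2 < x0" "x0 < 1" "isCont M x0" using M_continuity_point[of "1/2" 1] by auto
  have "Bseq (\<lambda>n. k n * Fbar (a n * x0))"
    using tail_limit[of x0] x0 by (intro convergent_imp_Bseq) (auto simp: convergent_def)
  then obtain C1 where C1: "\<And>n. k n * Fbar (a n * x0) \<le> C1"
    unfolding Bseq_def by (metis abs_le_D1 real_norm_def)
  have C1_nonneg: "0 \<le> C1" using C1[of 0] by (simp add: k_0)
  have at_a: "k n * Fbar (a n) \<le> C1" if "1 \<le> n" for n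
  proof -
    have "Fbar (a n) \<le> Fbar (a n * x0)" using x0 a_pos[OF that] by (intro Fbar_mono) simp
    then have "k n * Fbar (a n) \<le> k n * Fbar (a n * x0)" by (intro mult_left_mono) auto
    then show ?thesis using C1[of n] by linarith
  qed
  define b where "b n = a n powr \<rho> / k n" for n
  have b_pos: "0 < b n" if "1 \<le> n" for n using a_pos[OF that] k_pos[OF that] by (simp add: b_def)
  have dc: "1 < d powr \<rho> / c"
  proof -
    have "1 < \<rho> / \<alpha>" using rho_bounds alpha_pos by simp
    then have "c powr 1 < c powr (\<rho> / \<alpha>)" using c_gt_1 by (intro powr_less_mono)
    then show ?thesis using c_gt_1 by (simp add: d_def powr_powr)
  qed
  have "(\<lambda>n. (a (Suc n) / a n) powr \<rho> / (k (Suc n) / k n)) \<longlonglongrightarrow> d powr \<rho> / c"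
    using d_gt_1 c_gt_1 by (intro tendsto_intros a_ratio k_ratio) auto
  then have "\<forall>\<^sub>F n in sequentially. 1 < (a (Suc n) / a n) powr \<rho> / (k (Suc n) / k n)"
    using dc by (rule order_tendstoD)
  moreover have "\<forall>\<^sub>F n in sequentially. real (k (Suc n)) / real (k n) < 2 * c"
    using c_gt_1 by (intro order_tendstoD(2)[OF k_ratio]) simp
  ultimately have "\<forall>\<^sub>F n in sequentially. 1 \<le> n \<and> b n \<le> b (Suc n) \<and> real (k (Suc n)) \<le> 2 * c * k n"
    using eventually_ge_at_top[of 1]
  proof eventually_elim
    case (elim n)
    have kp: "0 < real (k n)" "0 < real (k (Suc n))" using k_pos[of n] k_pos[of "Suc n"] elim by auto
    have ap: "0 < a n powr \<rho>" using a_pos[of n] elim by simp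
    have "(a (Suc n) / a n) powr \<rho> = a (Suc n) powr \<rho> / a n powr \<rho>"
      using a_pos[of n] a_pos[of "Suc n"] elim by (simp add: powr_divide)
    then have "1 < b (Suc n) / b n" using elim by (simp add: b_def mult.commute)
    then have "b n \<le> b (Suc n)" using b_pos[of n] elim by (simp add: field_simps)
    then show ?case using elim kp by (simp add: field_simps)
  qed
  then obtain N where N: "\<And>n. N \<le> n \<Longrightarrow> 1 \<le> n \<and> b n \<le> b (Suc n) \<and> real (k (Suc n)) \<le> 2 * c * k n"
    unfolding eventually_sequentially by blast
  have N1: "1 \<le> N" using N[of N] by simp
  define C where "C = max (real (k N)) (2 * c * C1)"
  have C: "0 \<le> C" by (simp add: C_def)
  have main: "\<forall>y. 0 < y \<and> y \<le> a n \<longrightarrow> y powr \<rho> * Fbar y \<le> C * b n" if "N \<le> n" for n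
    using that
  proof (induction rule: dec_induct)
    case base
    show ?case
    proof (intro allI impI)
      fix y assume y: "0 < y \<and> y \<le> a N"
      have "y powr \<rho> * Fbar y \<le> a N powr \<rho> * 1"
        using y rho_bounds Fbar_le_1[of y] Fbar_nonneg[of y] by (intro mult_mono powr_mono2) auto
      also have "\<dots> = k N * b N" using k_pos[OF N1] by (simp add: b_def)
      also have "\<dots> \<le> C * b N" using b_pos[OF N1] by (intro mult_right_mono) (auto simp: C_def)
      finally show "y powr \<rho> * Fbar y \<le> C * b N" .
    qed
  next
    case (step n)
    note Nn = N[OF step(1)]
    show ?case
    proof (intro allI impI)
      fix y assume y: "0 < y \<and> y \<le> a (Suc n)"
      show "y powr \<rho> * Fbar y \<le> C * b (Suc n)"
      proof (cases "y \<le> a n")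
        case True
        then have "y powr \<rho> * Fbar y \<le> C * b n" using step y by blast
        also have "\<dots> \<le> C * b (Suc n)" using Nn C by (intro mult_left_mono) auto
        finally show ?thesis .
      next
        case False
        have kp: "0 < real (k n)" using k_pos[of n] Nn by simp
        have "y powr \<rho> * Fbar y \<le> a (Suc n) powr \<rho> * Fbar (a n)"
          using y False rho_bounds Fbar_nonneg[of y] by (intro mult_mono powr_mono2 Fbar_mono) auto
        also have "\<dots> \<le> a (Suc n) powr \<rho> * (C1 / k n)"
          using at_a[of n] Nn kp by (intro mult_left_mono) (auto simp: field_simps)
        also have "\<dots> = b (Suc n) * (k (Suc n) / k n * C1)"
          using k_pos[of "Suc n"] by (simp add: b_def)
        also have "\<dots> \<le> b (Suc n) * (2 * c * C1)"
          using b_pos[of "Suc n"] Nn kp C1_nonneg by (intro mult_left_mono mult_right_mono) (auto simp: field_simps)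
        also have "\<dots> \<le> b (Suc n) * C" using b_pos[of "Suc n"] by (intro mult_left_mono) (auto simp: C_def)
        finally show ?thesis by (simp add: mult.commute)
      qed
    qed
  qed
  show ?thesis
  proof (rule that[OF C N1])
    fix n y assume n: "N \<le> n" and y: "0 < y" "y \<le> (1::real)"
    have ap: "0 < a n" and kp: "0 < real (k n)" using a_pos[of n] k_pos[of n] n N1 by auto
    have "(a n * y) powr \<rho> * Fbar (a n * y) \<le> C * b n" using main[OF n] ap y by simp
    then have "a n powr \<rho> * y powr \<rho> * Fbar (a n * y) \<le> C * a n powr \<rho> / k n"
      using ap y by (simp add: powr_mult b_def)
    then show "k n * Fbar (a n * y) \<le> C * y powr (- \<rho>)"
      using ap kp y by (simp add: powr_minus field_simps)
  qed
qed

text \<open>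
  At the end \<open>a (Suc j)\<close> of the block containing \<open>y\<close> the tail is at least a constant over \<open>k (Suc j)\<close>, and
  \<open>k (Suc j)\<close> is comparable to \<open>B y\<close>.
\<close>

lemma tail_lower_bound:
  obtains \<kappa> where "0 < \<kappa>" "\<forall>\<^sub>F y in at_top. \<kappa> / B y \<le> Fbar y"
proof -
  obtain x where x: "1 < x" "x < 2" "isCont M x" using M_continuity_point[of 1 2] by auto
  define q where "q = x powr (- \<alpha>) * M x / 2"
  have Mx: "0 < M x" using x by (intro M_pos) auto
  have q: "0 < q" using x Mx by (simp add: q_def)
  have lim: "(\<lambda>n. k n * Fbar (a n * x)) \<longlonglongrightarrow> x powr (- \<alpha>) * M x" using x by (intro tail_limit) auto
  have "\<forall>\<^sub>F n in sequentially. q < k n * Fbar (a n * x)"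
    by (rule order_tendstoD(1)[OF lim]) (use x Mx in \<open>simp add: q_def\<close>)
  then have ev1: "\<forall>\<^sub>F n in sequentially. q < k (Suc n) * Fbar (a (Suc n) * x)"
    by (subst eventually_sequentially_Suc)
  have "(\<lambda>n. B (a n * 1) / k n) \<longlonglongrightarrow> 1 powr \<alpha>" by (rule B_along) simp
  then have ev2: "\<forall>\<^sub>F n in sequentially. 1 / 2 < B (a n) / k n"
    by (intro order_tendstoD(1)[where y="1 powr \<alpha>"]) auto
  have ev3: "\<forall>\<^sub>F n in sequentially. real (k (Suc n)) / real (k n) < 2 * c"
    using c_gt_1 by (intro order_tendstoD(2)[OF k_ratio]) simp
  obtain n0 where n0: "1 \<le> n0" "\<And>n. n0 \<le> n \<Longrightarrow> a n < a (Suc n)"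
    and ex: "\<And>n. n0 \<le> n \<Longrightarrow> \<forall>\<^sub>F y in at_top. \<exists>j\<ge>n. in_block j y"
    using delta_eq by blast
  from ev1 ev2 ev3 have "\<forall>\<^sub>F n in sequentially. q < k (Suc n) * Fbar (a (Suc n) * x) \<and> 1 / 2 < B (a n) / k n
      \<and> real (k (Suc n)) / real (k n) < 2 * c"
    by eventually_elim auto
  then obtain n1 where n1: "\<And>n. n1 \<le> n \<Longrightarrow> q < k (Suc n) * Fbar (a (Suc n) * x) \<and> 1 / 2 < B (a n) / k n
      \<and> real (k (Suc n)) / real (k n) < 2 * c"
    unfolding eventually_sequentially by blast
  show ?thesis
  proof (rule that[of "q / (4 * c)"])
    show "0 < q / (4 * c)" using q c_gt_1 by simp
    show "\<forall>\<^sub>F y in at_top. q / (4 * c) / B y \<le> Fbar y"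
      using ex[OF max.cobounded1[of n0 n1]] eventually_gt_at_top[of 0]
    proof eventually_elim
      case (elim y)
      then obtain j where j: "n0 \<le> j" "n1 \<le> j" "a j \<le> y" "y < a (Suc j)" by auto
      have jp: "1 \<le> j" using j n0(1) by simp
      have kp: "0 < real (k j)" "0 < real (k (Suc j))" using k_pos[of j] k_pos[of "Suc j"] jp by auto
      note nj = n1[OF j(2)]
      have "y \<le> a (Suc j) * x" using j x a_pos[of "Suc j"] mult_left_mono[of 1 x "a (Suc j)"] by linarith
      then have F: "Fbar (a (Suc j) * x) \<le> Fbar y" by (rule Fbar_mono)
      have "q \<le> Fbar (a (Suc j) * x) * k (Suc j)" using nj by (simp only: mult.commute less_imp_le)
      then have "q / k (Suc j) \<le> Fbar (a (Suc j) * x)" by (simp only: pos_divide_le_eq[OF kp(2)])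
      then have 1: "q / k (Suc j) \<le> Fbar y" using F by linarith
      have "1 / 2 * k j < B (a j)" using nj by (simp only: pos_less_divide_eq[OF kp(1)])
      moreover have "B (a j) \<le> B y" using a_pos[OF jp] j by (intro B_mono)
      ultimately have By: "k j \<le> 2 * B y" by linarith
      have "k (Suc j) < 2 * c * k j" using nj by (simp only: pos_divide_less_eq[OF kp(1)])
      also have "2 * c * k j \<le> 2 * c * (2 * B y)" using By c_gt_1 by (intro mult_left_mono) auto
      finally have le: "k (Suc j) \<le> 4 * c * B y" by linarith
      have "q / (4 * c * B y) \<le> q / k (Suc j)"
        using q by (intro divide_left_mono[OF le] mult_pos_pos less_le_trans[OF kp(2) le] kp(2)) linarith
      then show ?case using 1 by (simp only: divide_divide_eq_left)
    qed
  qed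
qed

end

section \<open>The semistable limit laws\<close>

locale semistable_renewal = semistable_tail +
  fixes \<Lambda> V :: "real \<Rightarrow> real measure"
  assumes tail_measure: "\<And>lam. 0 < lam \<Longrightarrow> is_tail_measure \<alpha> M lam (\<Lambda> lam)"
    and V_law: "\<And>lam. 0 < lam \<Longrightarrow> real_distribution (V lam)"
    and V_char: "\<And>lam t. 0 < lam \<Longrightarrow> char (V lam) t = exp (CLINT x:{0<..}|\<Lambda> lam. (iexp (t * x) - 1))"
begin

text \<open>
  The Levy exponent of \<open>V lam\<close>, and the factor by which lengths scale when mass scales by \<open>lam\<close>.
\<close>

definition \<psi> :: "real \<Rightarrow> real \<Rightarrow> complex" where
  "\<psi> lam t = (CLINT x:{0<..}|\<Lambda> lam. (iexp (t * x) - 1))"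

definition scale :: "real \<Rightarrow> real" where "scale lam = lam powr (1 / \<alpha>)"

lemma scale_pos: "0 < lam \<Longrightarrow> 0 < scale lam" by (simp add: scale_def)

lemma scale_powr: "0 < lam \<Longrightarrow> scale lam powr \<alpha> = lam"
  using alpha_pos by (simp add: scale_def powr_powr)

lemma M_upper: obtains K where "0 < K" "\<And>x. 0 < x \<Longrightarrow> M x \<le> K"
  using M_bounds M_pos by (meson less_le_trans zero_less_one)

lemma emeasure_levy: "0 < lam \<Longrightarrow> 0 < x \<Longrightarrow> emeasure (\<Lambda> lam) {x<..} = ennreal (x powr (- \<alpha>) * M (scale lam * x))"
  using tail_measure[of lam] by (simp add: is_tail_measure_def scale_def)

lemma sets_Lambda: "0 < lam \<Longrightarrow> sets (\<Lambda> lam) = sets borel"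
  using tail_measure[of lam] by (simp add: is_tail_measure_def)

lemma measure_levy: "0 < lam \<Longrightarrow> 0 < x \<Longrightarrow> measure (\<Lambda> lam) {x<..} = x powr (- \<alpha>) * M (scale lam * x)"
  using M_pos[of "scale lam * x"] scale_pos[of lam] by (simp add: measure_def emeasure_levy)

lemma levy_tail_bound:
  assumes K: "\<And>x. 0 < x \<Longrightarrow> M x \<le> K" "0 < K" and lam: "0 < lam" and x: "0 < x" "x \<le> 1"
  shows "emeasure (\<Lambda> lam) {x<..} \<le> ennreal (K * x powr (- \<rho>))"
proof -
  have "x powr (- \<alpha>) * M (scale lam * x) \<le> x powr (- \<rho>) * K"
    using x K(2) M_pos[of "scale lam * x"] scale_pos[OF lam] rho_bounds
    by (intro mult_mono K powr_mono') auto
  then show ?thesis by (simp add: emeasure_levy lam x mult.commute ennreal_leI)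
qed

lemma levy_tail_family:
  obtains K where "\<And>lam. 0 < lam \<Longrightarrow> levy_tail (\<Lambda> lam) K \<rho>"
proof -
  obtain K where K: "0 < K" "\<And>x. 0 < x \<Longrightarrow> M x \<le> K" using M_upper by blast
  have "levy_tail (\<Lambda> lam) K \<rho>" if "0 < lam" for lam
    by unfold_locales (use K rho_bounds levy_tail_bound[of K lam] sets_Lambda that in auto)
  then show ?thesis by (rule that)
qed

lemma isCont_levy_tail:
  assumes lam: "0 < (lam::real)" and x: "0 < x" and cont: "isCont (\<lambda>x. measure (\<Lambda> lam) {x<..}) x"
  shows "isCont M (scale lam * x)"
proof -
  let ?s = "scale lam" and ?T = "\<lambda>x. measure (\<Lambda> lam) {x<..}"
  have s: "0 < ?s" by (rule scale_pos[OF lam])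
  have "\<forall>\<^sub>F y in nhds (?s * x). M y = ?T (y / ?s) * (y / ?s) powr \<alpha>"
  proof (rule eventually_mono[OF eventually_nhds_in_open[of "{0<..}"]])
    show "?s * x \<in> {0<..}" using s x by simp
    fix y :: real assume "y \<in> {0<..}"
    then show "M y = ?T (y / ?s) * (y / ?s) powr \<alpha>"
      using s by (simp add: measure_levy[OF lam] powr_minus)
  qed simp
  then have "isCont M (?s * x) \<longleftrightarrow> isCont (\<lambda>y. ?T (y / ?s) * (y / ?s) powr \<alpha>) (?s * x)" by (rule isCont_cong)
  moreover have "isCont (\<lambda>y. ?T (y / ?s) * (y / ?s) powr \<alpha>) (?s * x)"
  proof (rule continuous_mult)
    show "isCont (\<lambda>y. ?T (y / ?s)) (?s * x)"
      by (rule isCont_o2[where g="?T" and f="\<lambda>y. y / ?s"]) (use s cont in auto)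
    show "isCont (\<lambda>y. (y / ?s) powr \<alpha>) (?s * x)"
      using s x by (intro continuous_intros) auto
  qed
  ultimately show ?thesis by blast
qed

lemma char_scaled: "char (distr \<mu> borel (\<lambda>x. x / s)) t = char \<mu> (t / s)"
  unfolding char_def by (subst integral_distr) auto

text \<open>
  The law of \<open>X / (scale lam * a n)\<close> with weight \<open>lam * k n\<close> has the rescaled tails whose limit is the
  tail of \<open>\<Lambda> lam\<close>. Indices start at \<open>N\<close>, from which on the power bound holds.
\<close>

theorem exponent_from_tail:
  fixes lam :: real
  assumes lam: "0 < (lam::real)"
  shows "(\<lambda>n. lam * k n * (char \<mu> (t / (scale lam * a n)) - 1)) \<longlonglongrightarrow> \<psi> lam t"
proof -
  let ?s = "scale lam"
  have s: "0 < ?s" by (rule scale_pos[OF lam])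
  obtain C N where C: "0 \<le> C" "1 \<le> N"
    and bound: "\<And>n y. N \<le> n \<Longrightarrow> 0 < y \<Longrightarrow> y \<le> 1 \<Longrightarrow> k n * Fbar (a n * y) \<le> C * y powr (- \<rho>)"
    using tail_power_bound by blast
  obtain K where K: "0 < K" "\<And>x. 0 < x \<Longrightarrow> M x \<le> K" using M_upper by blast
  \<comment> \<open>The constant serves both \<open>\<Lambda> lam\<close>, through the bound \<open>K\<close> of \<open>M\<close>, and the rescaled step laws, where
    \<open>scale lam * x\<close> may exceed \<open>1\<close> although \<open>x\<close> does not.\<close>
  define C' where "C' = max K (lam * (C * max (?s powr (- \<rho>)) 1))"
  have C': "0 < C'" using K by (simp add: C'_def)
  define \<mu>' where "\<mu>' n = distr \<mu> borel (\<lambda>x. x / (?s * a (n + N)))" for n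
  define w where "w n = lam * k (n + N)" for n
  have ap: "0 < a (n + N)" for n using C(2) by (intro a_pos) simp
  have tail_\<mu>': "measure (\<mu>' n) {x<..} = Fbar (a (n + N) * (?s * x))" for n x
  proof -
    have "(\<lambda>x. x / (?s * a (n + N))) -` {x<..} \<inter> space \<mu> = {a (n + N) * (?s * x)<..}"
      using s ap[of n] by (auto simp: pos_less_divide_eq mult_ac)
    then show ?thesis unfolding \<mu>'_def Fbar_eq_measure by (subst measure_distr) auto
  qed
  interpret levy_limit "\<Lambda> lam" C' \<rho> \<mu>' w
  proof (intro levy_limit.intro levy_tail.intro levy_limit_axioms.intro)
    show "sets (\<Lambda> lam) = sets borel" by (rule sets_Lambda[OF lam])
    show "\<rho> < 1" by (rule rho_bounds)
    show "0 \<le> C'" using C' by simp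
    show "emeasure (\<Lambda> lam) {x<..} \<le> ennreal (C' * x powr (- \<rho>))" if "0 < x" "x \<le> 1" for x
      by (rule levy_tail_bound[OF _ C' lam that]) (use K(2) in \<open>force simp: C'_def\<close>)
    show "0 < measure (\<Lambda> lam) {x<..}" if "0 < x" for x
      using that s lam M_pos[of "?s * x"] by (simp add: measure_levy)
    show "real_distribution (\<mu>' n)" for n unfolding \<mu>'_def by (rule law.real_distribution_distr) simp
    show "AE x in \<mu>' n. 0 \<le> x" for n
      unfolding \<mu>'_def using law_nonneg s ap[of n] by (subst AE_distr_iff) auto
    show "0 < w n" for n using lam k_pos[of "n + N"] C(2) by (simp add: w_def)
    show "w n * measure (\<mu>' n) {x<..} \<le> C' * x powr (- \<rho>)" if x: "0 < x" "x \<le> 1" for n x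
    proof -
      have "k (n + N) * Fbar (a (n + N) * (?s * x)) \<le> C * (max (?s powr (- \<rho>)) 1 * x powr (- \<rho>))"
      proof (cases "?s * x \<le> 1")
        case True
        then have "k (n + N) * Fbar (a (n + N) * (?s * x)) \<le> C * (?s * x) powr (- \<rho>)"
          using s x by (intro bound) auto
        also have "\<dots> = C * (?s powr (- \<rho>) * x powr (- \<rho>))" using s x by (simp add: powr_mult)
        also have "\<dots> \<le> C * (max (?s powr (- \<rho>)) 1 * x powr (- \<rho>))"
          using C by (intro mult_left_mono mult_right_mono) auto
        finally show ?thesis .
      next
        case False
        have "a (n + N) * 1 \<le> a (n + N) * (?s * x)" using False ap[of n] by (intro mult_left_mono) auto
        from mult_left_mono[OF Fbar_mono[OF this] of_nat_0_le_iff]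
        have "k (n + N) * Fbar (a (n + N) * (?s * x)) \<le> k (n + N) * Fbar (a (n + N) * 1)" .
        also have "\<dots> \<le> C * 1 powr (- \<rho>)" by (intro bound) auto
        also have "\<dots> \<le> C * (max (?s powr (- \<rho>)) 1 * x powr (- \<rho>))"
        proof (intro mult_left_mono C)
          have "1 \<le> x powr (- \<rho>)" using x rho_bounds by (simp add: powr_minus powr_le1 one_le_inverse_iff)
          then have "1 * 1 \<le> max (?s powr (- \<rho>)) 1 * x powr (- \<rho>)" by (intro mult_mono) auto
          then show "1 powr (- \<rho>) \<le> max (?s powr (- \<rho>)) 1 * x powr (- \<rho>)" by simp
        qed
        finally show ?thesis .
      qed
      then have "w n * measure (\<mu>' n) {x<..} \<le> lam * (C * (max (?s powr (- \<rho>)) 1 * x powr (- \<rho>)))"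
        unfolding w_def tail_\<mu>' mult.assoc using lam by (intro mult_left_mono) auto
      also have "\<dots> = lam * (C * max (?s powr (- \<rho>)) 1) * x powr (- \<rho>)" by (simp only: mult.assoc)
      also have "\<dots> \<le> C' * x powr (- \<rho>)" by (intro mult_right_mono) (auto simp: C'_def)
      finally show ?thesis .
    qed
    show "(\<lambda>n. w n * measure (\<mu>' n) {x<..}) \<longlonglongrightarrow> measure (\<Lambda> lam) {x<..}"
      if x: "0 < x" and cont: "isCont (\<lambda>x. measure (\<Lambda> lam) {x<..}) x" for x
    proof -
      have "(\<lambda>n. k n * Fbar (a n * (?s * x))) \<longlonglongrightarrow> (?s * x) powr (- \<alpha>) * M (?s * x)"
        using s x by (intro tail_limit isCont_levy_tail[OF lam x cont]) auto
      then have "(\<lambda>n. k (n + N) * Fbar (a (n + N) * (?s * x))) \<longlonglongrightarrow> (?s * x) powr (- \<alpha>) * M (?s * x)"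
        by (rule LIMSEQ_ignore_initial_segment)
      from tendsto_mult[OF tendsto_const this]
      have "(\<lambda>n. lam * (k (n + N) * Fbar (a (n + N) * (?s * x)))) \<longlonglongrightarrow> lam * ((?s * x) powr (- \<alpha>) * M (?s * x))" .
      moreover have "lam * ((?s * x) powr (- \<alpha>) * M (?s * x)) = measure (\<Lambda> lam) {x<..}"
        using s x lam by (simp add: measure_levy powr_mult powr_minus scale_powr)
      ultimately show ?thesis by (simp add: w_def tail_\<mu>' mult.assoc)
    qed
  qed
  have "(\<lambda>n. w n * (char (\<mu>' n) t - 1)) \<longlonglongrightarrow> \<psi> lam t"
    using exponent_limit[of t] by (simp add: exponent_def \<psi>_def)
  then have "(\<lambda>n. lam * k (n + N) * (char \<mu> (t / (?s * a (n + N))) - 1)) \<longlonglongrightarrow> \<psi> lam t"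
    by (simp add: w_def \<mu>'_def char_scaled)
  then show ?thesis by (rule LIMSEQ_offset)
qed

text \<open>
  Both sides are limits of one and the same expression in the characteristic function of \<open>\<mu>\<close>, which
  saves transporting the measures \<open>\<Lambda> lam\<close> themselves.
\<close>

lemma exponent_scaling:
  fixes lam :: real
  assumes lam: "0 < (lam::real)"
  shows "\<psi> lam t = lam * \<psi> 1 (t / scale lam)"
proof (rule LIMSEQ_unique[OF exponent_from_tail[OF lam]])
  have "(\<lambda>n. complex_of_real lam * (complex_of_real (1 * real (k n)) * (char \<mu> (t / scale lam / (scale 1 * a n)) - 1)))
      \<longlonglongrightarrow> lam * \<psi> 1 (t / scale lam)"
    by (rule tendsto_mult[OF tendsto_const exponent_from_tail[OF zero_less_one]])
  then show "(\<lambda>n. complex_of_real (lam * k n) * (char \<mu> (t / (scale lam * a n)) - 1)) \<longlonglongrightarrow> lam * \<psi> 1 (t / scale lam)"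
    by (simp add: scale_def mult.assoc)
qed

lemma V_char_exponent: "0 < lam \<Longrightarrow> char (V lam) t = exp (\<psi> lam t)"
  by (simp add: V_char \<psi>_def)

text \<open>
  On the interval \<open>(r / \<bar>t\<bar>, 1 / \<bar>t\<bar>]\<close> the function \<open>1 - cos (t * x)\<close> is at least \<open>1 - cos r\<close>, and for
  small \<open>r\<close> its mass is at least \<open>\<bar>t\<bar> powr \<alpha>\<close>, because \<open>M\<close> lies between two positive constants.
\<close>

lemma exponent_decay:
  obtains \<kappa> where "0 < \<kappa>" "\<And>lam t. 0 < lam \<Longrightarrow> Re (\<psi> lam t) \<le> - \<kappa> * \<bar>t\<bar> powr \<alpha>"
proof -
  obtain m K where m: "0 < m" "\<And>x. 0 < x \<Longrightarrow> m \<le> M x" "\<And>x. 0 < x \<Longrightarrow> M x \<le> K"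
    using M_bounds by blast
  have mK: "m \<le> K" using m(2)[of 1] m(3)[of 1] by simp
  obtain K' where lt: "\<And>lam. 0 < lam \<Longrightarrow> levy_tail (\<Lambda> lam) K' \<rho>" using levy_tail_family by blast
  \<comment> \<open>Chosen so that \<open>r powr (- \<alpha>) * m - K = 1\<close>.\<close>
  define r where "r = ((K + 1) / m) powr (- (1 / \<alpha>))"
  have q: "1 < (K + 1) / m" using m(1) mK by simp
  have "1 < ((K + 1) / m) powr (1 / \<alpha>)" using q alpha_pos by simp
  moreover have "r = 1 / ((K + 1) / m) powr (1 / \<alpha>)" unfolding r_def by (rule powr_minus_divide)
  ultimately have r: "0 < r" "r < 1" by (simp_all only: divide_less_eq_1_pos zero_less_divide_1_iff less_trans[OF zero_less_one])
  have r_powr: "r powr (- \<alpha>) * m = K + 1" using q m(1) mK alpha_pos by (simp add: r_def powr_powr)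
  define \<kappa> where "\<kappa> = 1 - cos r"
  have "cos r < cos 0" using r pi_gt3 by (intro cos_monotone_0_pi) auto
  then have \<kappa>: "0 < \<kappa>" by (simp add: \<kappa>_def)
  have "Re (\<psi> lam t) \<le> - \<kappa> * \<bar>t\<bar> powr \<alpha>" if lam: "0 < lam" for lam t
  proof (cases "t = 0")
    case True
    then show ?thesis by (simp add: \<psi>_def)
  next
    case False
    then have t: "0 < \<bar>t\<bar>" by simp
    interpret levy_tail "\<Lambda> lam" K' \<rho> by (rule lt[OF lam])
    define I where "I = {r / \<bar>t\<bar><..1 / \<bar>t\<bar>}"
    have I_diff: "I = {r / \<bar>t\<bar><..} - {1 / \<bar>t\<bar><..}" by (auto simp: I_def)
    have "measure (\<Lambda> lam) I = measure (\<Lambda> lam) {r / \<bar>t\<bar><..} - measure (\<Lambda> lam) {1 / \<bar>t\<bar><..}"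
      unfolding I_diff using r t finite_levy_tail[of "r / \<bar>t\<bar>"]
      by (intro measure_Diff) (auto simp: sets_Lambda[OF lam] divide_right_mono intro: less_le_trans le_less_trans)
    also have "\<dots> \<ge> (r / \<bar>t\<bar>) powr (- \<alpha>) * m - (1 / \<bar>t\<bar>) powr (- \<alpha>) * K"
      using r t lam scale_pos[OF lam]
      by (simp only: measure_levy divide_pos_pos zero_less_one)
         (intro diff_mono mult_left_mono m, auto)
    also have "(r / \<bar>t\<bar>) powr (- \<alpha>) * m - (1 / \<bar>t\<bar>) powr (- \<alpha>) * K = \<bar>t\<bar> powr \<alpha> * (r powr (- \<alpha>) * m - K)"
      using r t by (simp add: powr_divide powr_minus field_simps)
    also have "\<dots> = \<bar>t\<bar> powr \<alpha>" by (simp add: r_powr)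
    finally have I_ge: "\<bar>t\<bar> powr \<alpha> \<le> measure (\<Lambda> lam) I" .
    have I_em: "emeasure (\<Lambda> lam) I < \<infinity>"
    proof (rule le_less_trans[OF emeasure_mono])
      show "I \<subseteq> {r / \<bar>t\<bar><..}" by (auto simp: I_def)
      show "emeasure (\<Lambda> lam) {r / \<bar>t\<bar><..} < \<infinity>" using r t by (intro finite_levy_tail) simp
    qed (simp add: sets_Lambda[OF lam])
    have I_sets: "I \<in> sets (\<Lambda> lam)" by (simp add: I_def sets_Lambda[OF lam])
    have "\<kappa> * measure (\<Lambda> lam) I = (LINT x|\<Lambda> lam. \<kappa> * indicat_real I x)"
      using I_sets by (simp add: Int_absorb2 sets.sets_into_space)
    also have "\<dots> \<le> (LINT x:{0<..}|\<Lambda> lam. 1 - cos (t * x))"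
      unfolding set_lebesgue_integral_def
    proof (rule integral_mono)
      show "integrable (\<Lambda> lam) (\<lambda>x. \<kappa> * indicat_real I x)"
        using I_sets I_em by (intro integrable_mult_right integrable_real_indicator)
      show "integrable (\<Lambda> lam) (\<lambda>x. indicat_real {0<..} x *\<^sub>R (1 - cos (t * x)))"
        using integrable_one_minus_cos[of t] by (simp add: set_integrable_def)
      fix x
      show "\<kappa> * indicat_real I x \<le> indicat_real {0<..} x *\<^sub>R (1 - cos (t * x))"
      proof (cases "x \<in> I")
        case True
        then have x: "0 < x" "r \<le> \<bar>t\<bar> * x" "\<bar>t\<bar> * x \<le> 1"
          using r t by (auto simp: I_def pos_divide_less_eq pos_le_divide_eq mult.commute intro: less_trans[of 0 "r / \<bar>t\<bar>"])
        have "cos (t * x) = cos (\<bar>t\<bar> * x)" by (metis abs_mult abs_of_pos cos_abs_real x(1))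
        also have "\<dots> \<le> cos r" using x r pi_gt3 by (intro cos_monotone_0_pi_le) auto
        finally show ?thesis using True x by (simp add: \<kappa>_def)
      qed (simp add: indicator_def)
    qed
    finally have "\<kappa> * measure (\<Lambda> lam) I \<le> - Re (\<psi> lam t)"
      using Re_exponent[of t] by (simp add: exponent_def \<psi>_def)
    moreover have "\<kappa> * \<bar>t\<bar> powr \<alpha> \<le> \<kappa> * measure (\<Lambda> lam) I" using I_ge \<kappa> by (intro mult_left_mono) auto
    ultimately show ?thesis by simp
  qed
  then show ?thesis using that \<kappa> by blast
qed

lemma V_cdf_lipschitz:
  obtains D where "0 < D" "\<And>lam x y. 0 < lam \<Longrightarrow> x \<le> y \<Longrightarrow> cdf (V lam) y \<le> cdf (V lam) x + D * (y - x)"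
proof -
  obtain \<kappa> where \<kappa>: "0 < \<kappa>" "\<And>lam t. 0 < lam \<Longrightarrow> Re (\<psi> lam t) \<le> - \<kappa> * \<bar>t\<bar> powr \<alpha>"
    using exponent_decay by blast
  define g where "g t = exp (- \<kappa> * \<bar>t\<bar> powr \<alpha>)" for t
  have g: "integrable lborel g" unfolding g_def by (rule integrable_exp_minus_powr[OF \<kappa>(1) alpha_pos])
  define D where "D = (LBINT t. g t) + 1"
  have "0 \<le> (LBINT t. g t)" by (rule integral_nonneg_AE) (simp add: g_def)
  then have D: "0 < D" by (simp add: D_def)
  have "cdf (V lam) y \<le> cdf (V lam) x + D * (y - x)" if lam: "0 < lam" and xy: "x \<le> y" for lam x y
  proof (cases "x = y")
    case False
    interpret V: real_distribution "V lam" by (rule V_law[OF lam])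
    have "cmod (char (V lam) t) \<le> g t" for t
      using \<kappa>(2)[OF lam, of t] by (simp add: V_char_exponent[OF lam] g_def)
    then have "measure (V lam) {x<..y} \<le> (y - x) * (LBINT t. g t)"
      by (rule V.measure_Ioc_le_of_char_bound[OF g _ xy])
    also have "\<dots> \<le> D * (y - x)" using xy by (simp add: D_def algebra_simps)
    finally show ?thesis using V.cdf_diff_eq[of x y] xy False by simp
  qed simp
  with D show ?thesis using that by blast
qed

lemma V_cdf_continuous: "0 < lam \<Longrightarrow> isCont (cdf (V lam)) x"
proof -
  assume lam: "0 < lam"
  interpret V: real_distribution "V lam" by (rule V_law[OF lam])
  obtain D where D: "0 < D" "\<And>lam x y. 0 < lam \<Longrightarrow> x \<le> y \<Longrightarrow> cdf (V lam) y \<le> cdf (V lam) x + D * (y - x)"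
    using V_cdf_lipschitz by blast
  have bd: "norm (cdf (V lam) y - cdf (V lam) x) \<le> D * \<bar>y - x\<bar>" for y
    using D(2)[OF lam, of x y] D(2)[OF lam, of y x] V.cdf_nondecreasing[of x y] V.cdf_nondecreasing[of y x]
    by (cases "x \<le> y") auto
  have "((\<lambda>y. D * \<bar>y - x\<bar>) \<longlongrightarrow> D * \<bar>x - x\<bar>) (at x)" by (intro tendsto_intros)
  then have "((\<lambda>y. cdf (V lam) y - cdf (V lam) x) \<longlongrightarrow> 0) (at x)"
    by (intro Lim_null_comparison[OF always_eventually[rule_format, OF bd]]) simp
  then show ?thesis by (simp add: isCont_def LIM_zero_iff)
qed

text \<open>
  The limit theorem for sums: the characteristic function of the rescaled sum is an \<open>N\<close>-th power whose
  base tends to \<open>1\<close> at the speed given by \<open>exponent_from_tail\<close>.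
\<close>

theorem conv_pow_cdf_limit:
  assumes lam: "0 < (lam::real)" and n: "filterlim n at_top sequentially"
    and N: "(\<lambda>j. real (N j) / real (k (n j))) \<longlonglongrightarrow> lam" and z: "(\<lambda>j. y j / a (n j)) \<longlonglongrightarrow> z"
  shows "(\<lambda>j. cdf (conv_pow \<mu> (N j)) (y j)) \<longlonglongrightarrow> cdf (V lam) (z / scale lam)"
proof -
  let ?s = "scale lam"
  have s: "0 < ?s" by (rule scale_pos[OF lam])
  interpret CP: real_distribution "conv_pow \<mu> i" for i by (rule real_distribution_conv_pow[OF law])
  define law_j where "law_j j = distr (conv_pow \<mu> (N j)) borel (\<lambda>x. x / (?s * a (n j)))" for j
  have dist: "real_distribution (law_j j)" for j
    unfolding law_j_def by (rule CP.real_distribution_distr) simp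
  have big: "\<forall>\<^sub>F j in sequentially. 1 \<le> n j" using n by (simp add: filterlim_at_top)
  have char_eq: "char (law_j j) t = char \<mu> (t / (?s * a (n j))) ^ N j" for j t
  proof -
    have "char (law_j j) t = char (conv_pow \<mu> (N j)) (t / (?s * a (n j)))"
      unfolding law_j_def char_def by (subst integral_distr) auto
    then show ?thesis by (simp add: char_conv_pow[OF law])
  qed
  have "(\<lambda>j. char (law_j j) t) \<longlonglongrightarrow> char (V lam) t" for t
    unfolding char_eq V_char_exponent[OF lam]
  proof (rule power_tendsto_exp)
    show "cmod (char \<mu> (t / (?s * a (n j)))) \<le> 1" for j by (rule law.cmod_char_le_1)
    have "filterlim (\<lambda>j. ?s * a (n j)) at_top sequentially"
      by (rule filterlim_tendsto_pos_mult_at_top[OF tendsto_const s filterlim_compose[OF a_at_top n]])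
    then have "(\<lambda>j. t / (?s * a (n j))) \<longlonglongrightarrow> 0"
      by (intro tendsto_divide_0[OF tendsto_const] filterlim_at_top_imp_at_infinity)
    from isCont_tendsto_compose[OF law.isCont_char this]
    show "(\<lambda>j. char \<mu> (t / (?s * a (n j)))) \<longlonglongrightarrow> 1" by (simp add: law.char_zero)
    have "(\<lambda>j. complex_of_real (real (N j) / real (k (n j)) / lam) * (lam * k (n j) * (char \<mu> (t / (?s * a (n j))) - 1)))
        \<longlonglongrightarrow> complex_of_real (lam / lam) * \<psi> lam t"
      using lam by (intro tendsto_mult tendsto_of_real tendsto_divide N tendsto_const
          filterlim_compose[OF exponent_from_tail[OF lam] n]) auto
    moreover have "\<forall>\<^sub>F j in sequentially.
        complex_of_real (real (N j) / real (k (n j)) / lam) * (lam * k (n j) * (char \<mu> (t / (?s * a (n j))) - 1))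
        = of_nat (N j) * (char \<mu> (t / (?s * a (n j))) - 1)"
      using big
    proof eventually_elim
      case (elim j)
      then have "real (k (n j)) \<noteq> 0" using k_pos[of "n j"] by simp
      then show ?case using lam by simp
    qed
    ultimately show "(\<lambda>j. of_nat (N j) * (char \<mu> (t / (?s * a (n j))) - 1)) \<longlonglongrightarrow> \<psi> lam t"
      using lam Lim_transform_eventually by fastforce
  qed
  then have wc: "weak_conv_m law_j (V lam)" by (rule levy_continuity[OF dist V_law[OF lam]])
  have "(\<lambda>j. y j / a (n j) / ?s) \<longlonglongrightarrow> z / ?s" using s by (intro tendsto_intros z) auto
  then have "(\<lambda>j. cdf (law_j j) (y j / a (n j) / ?s)) \<longlonglongrightarrow> cdf (V lam) (z / ?s)"
    by (rule weak_conv_cdf_tendsto[OF dist V_law[OF lam] wc V_cdf_continuous[OF lam]])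
  moreover have "\<forall>\<^sub>F j in sequentially. cdf (law_j j) (y j / a (n j) / ?s) = cdf (conv_pow \<mu> (N j)) (y j)"
    using big
  proof eventually_elim
    case (elim j)
    have "(\<lambda>x. x / (?s * a (n j))) -` {..y j / a (n j) / ?s} \<inter> space (conv_pow \<mu> (N j)) = {..y j}"
      using mult_pos_pos[OF s a_pos[OF elim]]
      by (auto simp: divide_divide_eq_left mult.commute[of "a (n j)"] divide_le_cancel less_not_sym)
    then show ?case unfolding law_j_def cdf_def by (subst measure_distr) auto
  qed
  ultimately show ?thesis by (rule Lim_transform_eventually)
qed

text \<open>
  By the limit theorem \<open>V lam\<close> is a limit in law of rescaled sums of nonnegative variables.
\<close>

lemma V_nonneg: "0 < lam \<Longrightarrow> x < 0 \<Longrightarrow> cdf (V lam) x = 0"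
proof -
  assume lam: "0 < lam" and x: "x < 0"
  let ?s = "scale lam"
  have s: "0 < ?s" by (rule scale_pos[OF lam])
  \<comment> \<open>Number of summands whose ratio to \<open>k j\<close> tends to \<open>lam\<close>.\<close>
  define N where "N j = nat \<lfloor>lam * k j\<rfloor>" for j
  have "(\<lambda>j. real (N j) / real (k j)) \<longlonglongrightarrow> lam"
    unfolding N_def
  proof (rule floor_ratio_tendsto[OF k_at_top])
    show "(\<lambda>j. lam * k j / k j) \<longlonglongrightarrow> lam"
    proof (rule Lim_transform_eventually[OF tendsto_const])
      show "\<forall>\<^sub>F j in sequentially. lam = lam * k j / k j"
        using eventually_ge_at_top[of 1]
      proof eventually_elim
        case (elim j)
        then show ?case using k_pos[of j] by simp
      qed
    qed
  qed (use lam in simp)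
  moreover have "(\<lambda>j. x * ?s * a j / a j) \<longlonglongrightarrow> x * ?s"
  proof (rule Lim_transform_eventually[OF tendsto_const])
    show "\<forall>\<^sub>F j in sequentially. x * ?s = x * ?s * a j / a j"
      using eventually_ge_at_top[of 1]
    proof eventually_elim
      case (elim j)
      then show ?case using a_pos[of j] by simp
    qed
  qed
  ultimately have "(\<lambda>j. cdf (conv_pow \<mu> (N j)) (x * ?s * a j)) \<longlonglongrightarrow> cdf (V lam) (x * ?s / ?s)"
    by (intro conv_pow_cdf_limit[OF lam filterlim_ident])
  moreover have "\<forall>\<^sub>F j in sequentially. cdf (conv_pow \<mu> (N j)) (x * ?s * a j) = 0"
    using eventually_ge_at_top[of 1]
  proof eventually_elim
    case (elim j)
    interpret CP: real_distribution "conv_pow \<mu> (N j)" by (rule real_distribution_conv_pow[OF law])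
    have "x * ?s * a j < 0" using x s a_pos[OF elim] by (simp add: mult_less_0_iff)
    then have "measure (conv_pow \<mu> (N j)) {..x * ?s * a j} \<le> measure (conv_pow \<mu> (N j)) {..<0}"
      by (intro CP.finite_measure_mono) auto
    then show ?case by (simp add: cdf_def measure_conv_pow_neg[OF law law_nonneg] measure_le_0_iff)
  qed
  ultimately have "(\<lambda>j. 0) \<longlonglongrightarrow> cdf (V lam) (x * ?s / ?s)" by (rule Lim_transform_eventually)
  then show ?thesis using s by (simp add: LIMSEQ_const_iff)
qed

text \<open>
  The Lipschitz bound, applied between a point just below \<open>0\<close> and \<open>x\<close>.
\<close>

lemma V_cdf_linear_bound:
  obtains D where "0 < D" "\<And>lam x. 0 < lam \<Longrightarrow> 0 \<le> x \<Longrightarrow> cdf (V lam) x \<le> D * x"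
proof -
  obtain D where D: "0 < D" "\<And>lam x y. 0 < lam \<Longrightarrow> x \<le> y \<Longrightarrow> cdf (V lam) y \<le> cdf (V lam) x + D * (y - x)"
    using V_cdf_lipschitz by blast
  have "cdf (V lam) x \<le> D * x" if "0 < lam" "0 \<le> x" for lam x
  proof (rule field_le_epsilon)
    fix e :: real assume e: "0 < e"
    have "cdf (V lam) x \<le> cdf (V lam) (- (e / D)) + D * (x - (- (e / D)))"
      using that e D(1) by (intro D(2)) (auto intro: order_trans[of _ 0])
    also have "cdf (V lam) (- (e / D)) = 0" using that e D(1) by (intro V_nonneg) auto
    also have "0 + D * (x - (- (e / D))) = D * x + e" using D(1) by (simp add: distrib_left)
    finally show "cdf (V lam) x \<le> D * x + e" .
  qed
  with D(1) show ?thesis using that by blast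
qed

text \<open>
  By scaling, the dependence of the exponent on \<open>lam\<close> reduces to continuity of the single function
  \<open>\<psi> 1\<close>.
\<close>

lemma V_cdf_joint_limit:
  assumes l: "l \<longlonglongrightarrow> lam" and lam: "0 < lam" and l_pos: "\<And>j. 0 < l j" and x: "x \<longlonglongrightarrow> x0"
  shows "(\<lambda>j. cdf (V (l j)) (x j)) \<longlonglongrightarrow> cdf (V lam) x0"
proof (rule weak_conv_cdf_tendsto[OF V_law[OF l_pos] V_law[OF lam] _ V_cdf_continuous[OF lam] x])
  obtain K where "\<And>lam. 0 < lam \<Longrightarrow> levy_tail (\<Lambda> lam) K \<rho>" using levy_tail_family by blast
  then interpret levy_tail "\<Lambda> 1" K \<rho> by simp
  have "(\<lambda>j. char (V (l j)) t) \<longlonglongrightarrow> char (V lam) t" for t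
  proof -
    have "(\<lambda>j. scale (l j)) \<longlonglongrightarrow> scale lam"
      unfolding scale_def using lam by (intro tendsto_powr l tendsto_const) auto
    then have "(\<lambda>j. t / scale (l j)) \<longlonglongrightarrow> t / scale lam"
      using scale_pos[OF lam] by (intro tendsto_divide tendsto_const) auto
    from exponent_continuous[OF this]
    have "(\<lambda>j. \<psi> 1 (t / scale (l j))) \<longlonglongrightarrow> \<psi> 1 (t / scale lam)"
      by (simp only: exponent_def \<psi>_def)
    then have "(\<lambda>j. exp (l j * \<psi> 1 (t / scale (l j)))) \<longlonglongrightarrow> exp (lam * \<psi> 1 (t / scale lam))"
      by (intro tendsto_exp tendsto_mult tendsto_of_real l)
    then show ?thesis
      by (simp only: V_char_exponent[OF l_pos] V_char_exponent[OF lam] exponent_scaling[OF l_pos] exponent_scaling[OF lam])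
  qed
  then show "weak_conv_m (\<lambda>j. V (l j)) (V lam)"
    by (rule levy_continuity[OF V_law[OF l_pos] V_law[OF lam]])
qed

section \<open>Merging and the renewal function\<close>

text \<open>
  The index of the block \<open>(k (n - 1), k n]\<close> containing \<open>x\<close>; written as a least element it is visibly
  measurable in \<open>x\<close>.
\<close>

definition idx :: "real \<Rightarrow> nat" where "idx x = (LEAST n. x \<le> real (k n))"

lemma idx_le: "x \<le> real (k (idx x))"
proof -
  have "x \<le> real (k (nat \<lceil>x\<rceil>))" using k_ge[of "nat \<lceil>x\<rceil>"] by linarith
  then show ?thesis unfolding idx_def by (rule LeastI)
qed

lemma idx_facts:
  assumes x: "0 < x"
  shows "1 \<le> idx x" "real (k (idx x - 1)) < x" "pos_param k x = x / k (idx x)"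
proof -
  show one: "1 \<le> idx x"
  proof (rule ccontr)
    assume "\<not> 1 \<le> idx x"
    then have "idx x = 0" by simp
    then show False using idx_le[of x] k_0 x by simp
  qed
  show lower: "real (k (idx x - 1)) < x"
    using not_less_Least[of "idx x - 1" "\<lambda>n. x \<le> real (k n)"] one by (simp add: idx_def)
  have "(THE n. n \<ge> 1 \<and> real (k (n - 1)) < x \<and> x \<le> real (k n)) = idx x"
  proof (rule the_equality)
    show "1 \<le> idx x \<and> real (k (idx x - 1)) < x \<and> x \<le> real (k (idx x))"
      using one lower idx_le by blast
    fix n assume n: "n \<ge> 1 \<and> real (k (n - 1)) < x \<and> x \<le> real (k n)"
    have "k (n - 1) < k (idx x)" "k (idx x - 1) < k n" using n lower idx_le[of x] by linarith+
    then have "n - 1 < idx x" "idx x - 1 < n" using strict_mono_less[OF k_mono] by blast+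
    then show "n = idx x" using n one by linarith
  qed
  then show "pos_param k x = x / k (idx x)" by (simp add: pos_param_def)
qed

lemma pos_param_pos: "0 < x \<Longrightarrow> 0 < pos_param k x"
  using idx_facts[of x] k_pos[of "idx x"] by simp

lemma pos_param_le_1: "0 < x \<Longrightarrow> pos_param k x \<le> 1"
  using idx_facts[of x] k_pos[of "idx x"] idx_le[of x] by simp

lemma idx_at_top:
  assumes "filterlim x at_top sequentially" shows "filterlim (\<lambda>j. idx (x j)) at_top sequentially"
  unfolding filterlim_at_top
proof
  fix Z
  have "\<forall>\<^sub>F j in sequentially. real (k Z) < x j" using assms by (simp add: filterlim_at_top_dense)
  then show "\<forall>\<^sub>F j in sequentially. Z \<le> idx (x j)"
  proof eventually_elim
    case (elim j)
    then have "k Z < k (idx (x j))" using idx_le[of "x j"] by linarith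
    then show ?case using strict_mono_less[OF k_mono] by (simp add: less_imp_le)
  qed
qed

text \<open>
  The semistable integrand after the substitution \<open>u = x powr (- \<alpha>)\<close>.
\<close>

definition G :: "real \<Rightarrow> real \<Rightarrow> real" where
  "G b u = cdf (V (pos_param k (b * u))) (u powr (- (1 / \<alpha>)))"

lemma cdf_V_measurable:
  "(\<lambda>p. indicator ({0<..} \<times> UNIV) p *\<^sub>R cdf (V (fst p)) (snd p)) \<in> borel_measurable (borel :: (real \<times> real) measure)"
proof (rule borel_measurable_continuous_on_indicator)
  show "{0<..} \<times> (UNIV :: real set) \<in> sets (borel :: (real \<times> real) measure)"
    by (intro borel_open open_Times) auto
  show "continuous_on ({0<..} \<times> UNIV) (\<lambda>p. cdf (V (fst p)) (snd p))"
    unfolding continuous_on_sequentially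
  proof (intro allI ballI impI)
    fix p :: "nat \<Rightarrow> real \<times> real" and q
    assume q: "q \<in> {0<..} \<times> UNIV" and p: "(\<forall>n. p n \<in> {0<..} \<times> UNIV) \<and> p \<longlonglongrightarrow> q"
    have "(\<lambda>n. cdf (V (fst (p n))) (snd (p n))) \<longlonglongrightarrow> cdf (V (fst q)) (snd q)"
      using p q by (intro V_cdf_joint_limit tendsto_fst tendsto_snd) (auto simp: mem_Times_iff)
    then show "((\<lambda>p. cdf (V (fst p)) (snd p)) \<circ> p) \<longlonglongrightarrow> cdf (V (fst q)) (snd q)" by (simp add: o_def)
  qed
qed

text \<open>
  The position parameter jumps at the points of \<open>k\<close>, so \<open>G\<close> is not continuous; but it is a measurable
  function composed with the jointly continuous \<open>cdf (V lam) x\<close>.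
\<close>

lemma G_measurable: "(\<lambda>u. indicator {0<..} u * G b u) \<in> borel_measurable borel" if b: "0 < b"
proof -
  let ?\<gamma> = "\<lambda>u. b * u / real (k (idx (b * u)))" and ?x = "\<lambda>u::real. u powr (- (1 / \<alpha>))"
  have "(\<lambda>u. idx (b * u)) \<in> measurable borel (count_space UNIV)"
    unfolding idx_def by measurable
  then have "(\<lambda>u. real (k (idx (b * u)))) \<in> borel_measurable borel"
    by (rule measurable_compose) simp
  then have "?\<gamma> \<in> borel_measurable borel"
    by (intro borel_measurable_divide borel_measurable_times borel_measurable_const measurable_ident_sets refl)
  moreover have "?x \<in> borel_measurable borel" by measurable
  ultimately have pair: "(\<lambda>u. (?\<gamma> u, ?x u)) \<in> borel_measurable borel" by (rule borel_measurable_Pair)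
  have meas: "(\<lambda>u. indicator {0<..} u * (indicator ({0<..} \<times> UNIV) (?\<gamma> u, ?x u)
      *\<^sub>R cdf (V (fst (?\<gamma> u, ?x u))) (snd (?\<gamma> u, ?x u)))) \<in> borel_measurable borel"
    by (intro borel_measurable_times measurable_compose[OF pair cdf_V_measurable] borel_measurable_indicator) simp
  have eq: "indicator {0<..} u * (indicator ({0<..} \<times> UNIV) (?\<gamma> u, ?x u)
      *\<^sub>R cdf (V (fst (?\<gamma> u, ?x u))) (snd (?\<gamma> u, ?x u))) = indicator {0<..} u * G b u" for u
  proof (cases "0 < u")
    case True
    then have p: "0 < b * u" using b by simp
    have e: "?\<gamma> u = pos_param k (b * u)" using idx_facts(3)[OF p] by simp
    have "(pos_param k (b * u), ?x u) \<in> {0<..} \<times> UNIV" using pos_param_pos[OF p] by simp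
    then show ?thesis unfolding e G_def fst_conv snd_conv by (simp only: indicator_simps scaleR_one)
  qed simp
  show ?thesis using meas unfolding eq .
qed

lemma G_nonneg: "0 < b \<Longrightarrow> 0 < u \<Longrightarrow> 0 \<le> G b u"
  by (simp add: G_def cdf_def)

lemma G_le_1: "0 < b \<Longrightarrow> 0 < u \<Longrightarrow> G b u \<le> 1"
proof -
  assume "0 < b" "0 < u"
  then interpret V: real_distribution "V (pos_param k (b * u))" by (intro V_law pos_param_pos) simp
  show ?thesis unfolding G_def by (rule V.cdf_bounded_prob)
qed

text \<open>
  The two integrands have no limit separately. Every sequence \<open>y\<close> has a subsequence along which the
  position parameter converges, and along it both tend to the same value.
\<close>

theorem merging:
  assumes u: "0 < u"
  shows "((\<lambda>y. cdf (conv_pow \<mu> (nat \<lfloor>B y * u\<rfloor>)) y - G (B y) u) \<longlongrightarrow> 0) at_top"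
proof (rule subsequence_tendsto_at_top)
  fix y :: "nat \<Rightarrow> real" assume y: "filterlim y at_top sequentially"
  define x where "x j = B (y j) * u" for j
  have By: "filterlim (\<lambda>j. B (y j)) at_top sequentially" by (rule filterlim_compose[OF B_at_top y])
  have x: "filterlim x at_top sequentially"
    unfolding x_def by (rule filterlim_at_top_mult_tendsto_pos[OF tendsto_const u By])
  define n where "n j = idx (x j)" for j
  have n: "filterlim n at_top sequentially" unfolding n_def by (rule idx_at_top[OF x])
  define \<gamma> where "\<gamma> j = pos_param k (x j)" for j
  have big: "\<forall>\<^sub>F j in sequentially. 1 \<le> x j \<and> 1 \<le> y j \<and> 2 \<le> n j"
    using x[unfolded filterlim_at_top, rule_format, of 1] y[unfolded filterlim_at_top, rule_format, of 1]
      n[unfolded filterlim_at_top, rule_format, of 2]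
    by eventually_elim auto
  \<comment> \<open>Blocks have asymptotic ratio \<open>c\<close>, so the position parameter stays away from \<open>0\<close>.\<close>
  have lower: "\<forall>\<^sub>F j in sequentially. 1 / (2 * c) < \<gamma> j"
  proof -
    have "\<forall>\<^sub>F i in sequentially. real (k (Suc i)) / real (k i) < 2 * c"
      using c_gt_1 by (intro order_tendstoD(2)[OF k_ratio]) simp
    then obtain i0 where i0: "\<And>i. i0 \<le> i \<Longrightarrow> real (k (Suc i)) / real (k i) < 2 * c"
      by (auto simp: eventually_sequentially)
    show ?thesis
      using big n[unfolded filterlim_at_top, rule_format, of "Suc i0"]
    proof eventually_elim
      case (elim j)
      have xp: "0 < x j" using elim by simp
      obtain i where i: "n j = Suc i" "i0 \<le> i" "1 \<le> i" using elim by (cases "n j") auto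
      have kp: "0 < real (k i)" "0 < real (k (Suc i))" using k_pos[of i] k_pos[of "Suc i"] i by auto
      have "real (k (Suc i)) < 2 * c * k i" using i0[OF i(2)] by (simp only: pos_divide_less_eq[OF kp(1)])
      also have "2 * c * k i < 2 * c * x j"
        using idx_facts(2)[OF xp] i c_gt_1 by (simp add: n_def)
      finally have "real (k (Suc i)) < 2 * c * x j" .
      moreover have "\<gamma> j = x j / real (k (Suc i))" using idx_facts(3)[OF xp] i(1) by (simp add: \<gamma>_def n_def)
      moreover have "1 / (2 * c) * real (k (Suc i)) < x j"
        using calculation(1) c_gt_1 by (simp add: pos_divide_less_eq mult.commute)
      ultimately show ?case by (simp only: pos_less_divide_eq[OF kp(2)])
    qed
  qed
  have "bounded (range (\<lambda>j. if 0 < x j then \<gamma> j else 0))"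
    unfolding bounded_iff
  proof (intro exI[of _ 1] ballI)
    fix z assume "z \<in> range (\<lambda>j. if 0 < x j then \<gamma> j else 0)"
    then obtain j where "z = (if 0 < x j then \<gamma> j else 0)" by blast
    then show "norm z \<le> 1" using pos_param_pos[of "x j"] pos_param_le_1[of "x j"]
      by (cases "0 < x j") (simp_all add: \<gamma>_def)
  qed
  then obtain lam r where r: "strict_mono (r :: nat \<Rightarrow> nat)"
    and "((\<lambda>j. if 0 < x j then \<gamma> j else 0) \<circ> r) \<longlonglongrightarrow> lam"
    using bounded_imp_convergent_subsequence by blast
  then have lim0: "(\<lambda>j. if 0 < x (r j) then \<gamma> (r j) else 0) \<longlonglongrightarrow> lam" by (simp add: o_def)
  have rlim: "filterlim r at_top sequentially" by (rule filterlim_subseq[OF r])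
  have big_r: "\<forall>\<^sub>F j in sequentially. 1 \<le> x (r j) \<and> 1 \<le> y (r j) \<and> 2 \<le> n (r j)"
    by (rule eventually_compose_filterlim[OF big rlim])
  have lim: "(\<lambda>j. \<gamma> (r j)) \<longlonglongrightarrow> lam"
    by (rule Lim_transform_eventually[OF lim0]) (use big_r in eventually_elim, simp)
  have "\<forall>\<^sub>F j in sequentially. 1 / (2 * c) \<le> \<gamma> (r j)"
    using eventually_compose_filterlim[OF lower rlim] by eventually_elim (rule less_imp_le)
  then have "1 / (2 * c) \<le> lam" by (rule tendsto_lowerbound[OF lim]) simp
  moreover have "0 < 1 / (2 * c)" using c_gt_1 by simp
  ultimately have lam: "0 < lam" by linarith
  have nr: "filterlim (\<lambda>j. n (r j)) at_top sequentially" by (rule filterlim_compose[OF n rlim])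
  have yr: "filterlim (\<lambda>j. y (r j)) at_top sequentially" by (rule filterlim_compose[OF y rlim])
  have knr: "filterlim (\<lambda>j. real (k (n (r j)))) at_top sequentially" by (rule filterlim_compose[OF k_at_top nr])
  have x_eq: "\<forall>\<^sub>F j in sequentially. x (r j) = \<gamma> (r j) * k (n (r j)) \<and> 0 < real (k (n (r j)))"
    using big_r
  proof eventually_elim
    case (elim j)
    have "0 < real (k (n (r j)))" using k_pos[of "n (r j)"] elim by simp
    then show ?case using idx_facts(3)[of "x (r j)"] elim by (simp add: \<gamma>_def n_def)
  qed
  define N where "N j = nat \<lfloor>x (r j)\<rfloor>" for j
  have N: "(\<lambda>j. real (N j) / real (k (n (r j)))) \<longlonglongrightarrow> lam"
    unfolding N_def
  proof (rule floor_ratio_tendsto[OF knr])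
    show "\<forall>\<^sub>F j in sequentially. 0 \<le> x (r j)" using big_r by eventually_elim linarith
    show "(\<lambda>j. x (r j) / real (k (n (r j)))) \<longlonglongrightarrow> lam"
      by (rule Lim_transform_eventually[OF lim]) (use x_eq in eventually_elim, simp)
  qed
  have z: "(\<lambda>j. y (r j) / a (n (r j))) \<longlonglongrightarrow> (lam / u) powr (1 / \<alpha>)"
  proof -
    have "(\<lambda>j. A (\<gamma> (r j) / u * k (n (r j))) / A (k (n (r j)))) \<longlonglongrightarrow> (lam / u) powr (1 / \<alpha>)"
      using u lam by (intro A_ratio knr tendsto_divide lim tendsto_const) auto
    from tendsto_divide[OF this A_B[OF yr]]
    have "(\<lambda>j. A (\<gamma> (r j) / u * k (n (r j))) / A (k (n (r j))) / (A (B (y (r j))) / y (r j))) \<longlonglongrightarrow> (lam / u) powr (1 / \<alpha>)"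
      by simp
    moreover have "\<forall>\<^sub>F j in sequentially.
        A (\<gamma> (r j) / u * k (n (r j))) / A (k (n (r j))) / (A (B (y (r j))) / y (r j)) = y (r j) / a (n (r j))"
      using x_eq big_r
    proof eventually_elim
      case (elim j)
      have yp: "0 < y (r j)" using elim by simp
      have e: "\<gamma> (r j) / u * k (n (r j)) = B (y (r j))" using elim u by (simp add: x_def field_simps)
      have "0 < A (B (y (r j)))" using B_ge_1[OF yp] by (rule A_pos)
      then show ?case unfolding e a_def by simp
    qed
    ultimately show ?thesis by (rule Lim_transform_eventually)
  qed
  have "(\<lambda>j. cdf (conv_pow \<mu> (N j)) (y (r j))) \<longlonglongrightarrow> cdf (V lam) ((lam / u) powr (1 / \<alpha>) / scale lam)"
    by (rule conv_pow_cdf_limit[OF lam nr N z])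
  moreover have "(lam / u) powr (1 / \<alpha>) / scale lam = u powr (- (1 / \<alpha>))"
    using lam u by (simp add: scale_def powr_divide powr_minus field_simps)
  ultimately have lim1: "(\<lambda>j. cdf (conv_pow \<mu> (N j)) (y (r j))) \<longlonglongrightarrow> cdf (V lam) (u powr (- (1 / \<alpha>)))"
    by simp
  \<comment> \<open>The finitely many indices with \<open>x (r j) \<le> 0\<close>, where \<open>pos_param\<close> is meaningless, are given a positive
    dummy value.\<close>
  define g where "g j = (if 0 < x (r j) then \<gamma> (r j) else 1)" for j
  have g_eq: "\<forall>\<^sub>F j in sequentially. \<gamma> (r j) = g j" using big_r by eventually_elim (simp add: g_def)
  have g: "g \<longlonglongrightarrow> lam" by (rule Lim_transform_eventually[OF lim g_eq])
  have g_pos: "0 < g j" for j using pos_param_pos[of "x (r j)"] by (simp add: g_def \<gamma>_def)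
  have "(\<lambda>j. cdf (V (g j)) (u powr (- (1 / \<alpha>)))) \<longlonglongrightarrow> cdf (V lam) (u powr (- (1 / \<alpha>)))"
    by (rule V_cdf_joint_limit[OF g lam g_pos tendsto_const])
  then have "(\<lambda>j. G (B (y (r j))) u) \<longlonglongrightarrow> cdf (V lam) (u powr (- (1 / \<alpha>)))"
    by (rule Lim_transform_eventually) (use g_eq in eventually_elim, simp add: G_def \<gamma>_def x_def)
  from tendsto_diff[OF lim1 this]
  have "(\<lambda>j. cdf (conv_pow \<mu> (N j)) (y (r j)) - G (B (y (r j))) u) \<longlonglongrightarrow> 0" by simp
  then show "\<exists>r::nat \<Rightarrow> nat. strict_mono r \<and>
      (\<lambda>j. cdf (conv_pow \<mu> (nat \<lfloor>B (y (r j)) * u\<rfloor>)) (y (r j)) - G (B (y (r j))) u) \<longlonglongrightarrow> 0"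
    using r by (auto simp: N_def x_def)
qed

text \<open>
  All summands must be at most \<open>y\<close>, which has probability at most
  \<open>(1 - Fbar y) ^ n \<le> exp (- n * Fbar y)\<close>; with \<open>n \<ge> B y * u - 1\<close> and \<open>Fbar y \<ge> \<kappa> / B y\<close> the bound is
  uniform in \<open>y\<close>.
\<close>

lemma cdf_conv_pow_exp_bound:
  obtains \<kappa> where "0 < \<kappa>"
    "\<forall>\<^sub>F y in at_top. 0 < Fbar y \<and> (\<forall>u>0. cdf (conv_pow \<mu> (nat \<lfloor>B y * u\<rfloor>)) y \<le> exp \<kappa> * exp (- \<kappa> * u))"
proof -
  obtain \<kappa> where \<kappa>: "0 < \<kappa>" and low: "\<forall>\<^sub>F y in at_top. \<kappa> / B y \<le> Fbar y" using tail_lower_bound by blast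
  have "\<forall>\<^sub>F y in at_top. 0 < Fbar y \<and> (\<forall>u>0. cdf (conv_pow \<mu> (nat \<lfloor>B y * u\<rfloor>)) y \<le> exp \<kappa> * exp (- \<kappa> * u))"
    using low eventually_gt_at_top[of 0]
  proof eventually_elim
    case (elim y)
    have By: "1 \<le> B y" using elim by (intro B_ge_1)
    have "0 < \<kappa> / B y" using By \<kappa> by (intro divide_pos_pos) linarith+
    then have Fp: "0 < Fbar y" using elim by linarith
    have "cdf (conv_pow \<mu> (nat \<lfloor>B y * u\<rfloor>)) y \<le> exp \<kappa> * exp (- \<kappa> * u)" if u: "0 < u" for u
    proof -
      let ?n = "nat \<lfloor>B y * u\<rfloor>"
      have "cdf (conv_pow \<mu> ?n) y \<le> cdf \<mu> y ^ ?n" by (rule cdf_conv_pow_le[OF law law_nonneg])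
      also have "cdf \<mu> y = 1 + - Fbar y" by (simp add: Fbar_def)
      also have "(1 + - Fbar y) ^ ?n \<le> exp (- Fbar y) ^ ?n"
        using exp_ge_add_one_self[of "- Fbar y"] Fbar_le_1[of y] by (intro power_mono) auto
      also have "\<dots> = exp (- (real ?n * Fbar y))" by (simp only: exp_of_nat_mult[symmetric] mult_minus_right)
      also have "\<dots> \<le> exp (\<kappa> + - \<kappa> * u)"
      proof -
        have "B y * u - 1 \<le> real ?n" by linarith
        have nz: "B y \<noteq> 0" using By by linarith
        have "\<kappa> / B y \<le> \<kappa> / 1" using By \<kappa> by (intro divide_left_mono) auto
        then have "\<kappa> * u - \<kappa> \<le> \<kappa> * u - \<kappa> / B y" by simp
        also have "\<dots> = (B y * u - 1) * (\<kappa> / B y)" using nz by (simp add: left_diff_distrib diff_divide_distrib)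
        also have "\<dots> \<le> real ?n * (\<kappa> / B y)" using \<open>B y * u - 1 \<le> real ?n\<close> \<kappa> By by (intro mult_right_mono) auto
        also have "\<dots> \<le> real ?n * Fbar y" using elim by (intro mult_left_mono of_nat_0_le_iff) blast
        finally show ?thesis by simp
      qed
      finally show ?thesis by (simp only: exp_add)
    qed
    then show ?case using Fp by (intro conjI allI impI)
  qed
  from that[OF \<kappa> this] show ?thesis .
qed

abbreviation majorant :: "real \<Rightarrow> real \<Rightarrow> real" where
  "majorant D u \<equiv> if u \<le> 1 then 1 else D * u powr (- (1 / \<alpha>))"

lemma G_bound:
  obtains D where "0 < D" "\<And>b u. 0 < b \<Longrightarrow> 0 < u \<Longrightarrow> G b u \<le> majorant D u"
proof -
  obtain D where D: "0 < D" "\<And>lam x. 0 < lam \<Longrightarrow> 0 \<le> x \<Longrightarrow> cdf (V lam) x \<le> D * x"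
    using V_cdf_linear_bound by blast
  have "G b u \<le> majorant D u" if "0 < b" "0 < u" for b u
    using G_le_1[OF that] D(2)[OF pos_param_pos, of "b * u" "u powr (- (1 / \<alpha>))"] that by (simp add: G_def)
  then show ?thesis using that D(1) by blast
qed

text \<open>
  The first function is integrable at infinity because \<open>1 / \<alpha> > 1\<close>.
\<close>

lemma dominating_integrable:
  assumes \<kappa>: "0 < \<kappa>" and D: "0 < D"
  shows "integrable lborel (\<lambda>u. indicator {0<..} u * majorant D u :: real)"
    and "integrable lborel (\<lambda>u. indicator {0<..} u * (exp \<kappa> * exp (- \<kappa> * u)) :: real)"
proof -
  have to_lborel: "set_integrable lborel S f"
    if "f integrable_on S" "\<And>u. u \<in> S \<Longrightarrow> 0 \<le> f u" and meas: "f \<in> borel_measurable borel" "S \<in> sets borel"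
    for f :: "real \<Rightarrow> real" and S
  proof -
    have "f absolutely_integrable_on S" using that by (intro nonnegative_absolutely_integrable_1) auto
    moreover have "(\<lambda>u. indicat_real S u *\<^sub>R f u) \<in> borel_measurable lborel" using meas by simp
    ultimately show ?thesis unfolding set_integrable_def by (subst integrable_completion[symmetric])
  qed
  have "- (1 / \<alpha>) < -1" using alpha_pos alpha_less_1 by simp
  from has_integral_powr_to_inf[OF this zero_less_one]
  have "set_integrable lborel {1..} (\<lambda>u. u powr (- (1 / \<alpha>)))"
    by (intro to_lborel) (auto simp: integrable_on_def)
  then have "integrable lborel (\<lambda>u. indicator {0..1} u + D * (indicat_real {1..} u *\<^sub>R u powr (- (1 / \<alpha>))))"
    unfolding set_integrable_def
    by (intro Bochner_Integration.integrable_add integrable_mult_right) simp_all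
  then show "integrable lborel (\<lambda>u. indicator {0<..} u * majorant D u :: real)"
    by (rule Bochner_Integration.integrable_bound) (use D in \<open>auto intro!: AE_I2 simp: indicator_def\<close>)
  have "set_integrable lborel {0..} (\<lambda>u. exp (- \<kappa> * u))"
    using has_integral_exp_minus_to_infinity[OF \<kappa>, of 0] by (intro to_lborel) (auto simp: integrable_on_def)
  then have "integrable lborel (\<lambda>u. exp \<kappa> * (indicat_real {0..} u *\<^sub>R exp (- \<kappa> * u)))"
    unfolding set_integrable_def by (intro integrable_mult_right)
  then show "integrable lborel (\<lambda>u. indicator {0<..} u * (exp \<kappa> * exp (- \<kappa> * u)) :: real)"
    by (rule Bochner_Integration.integrable_bound) (auto intro!: AE_I2 simp: indicator_def)
qed

lemma G_integrable: "0 < b \<Longrightarrow> set_integrable lborel {0<..} (G b)"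
proof -
  assume b: "0 < b"
  obtain D where D: "0 < D" "\<And>b u. 0 < b \<Longrightarrow> 0 < u \<Longrightarrow> G b u \<le> majorant D u"
    using G_bound by blast
  show ?thesis unfolding set_integrable_def real_scaleR_def
  proof (rule Bochner_Integration.integrable_bound[OF dominating_integrable(1)[OF zero_less_one D(1)]])
    show "(\<lambda>u. indicat_real {0<..} u * G b u) \<in> borel_measurable lborel" using G_measurable[OF b] by simp
    show "AE u in lborel. norm (indicat_real {0<..} u * G b u) \<le> norm (indicat_real {0<..} u * majorant D u)"
    proof (rule AE_I2)
      fix u :: real
      show "norm (indicat_real {0<..} u * G b u) \<le> norm (indicat_real {0<..} u * majorant D u)"
        using D(2)[OF b, of u] G_nonneg[OF b, of u] by (cases "0 < u") auto
    qed
  qed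
qed

lemma renewal_integral:
  assumes y: "0 < y" and F: "0 < Fbar y"
  shows "set_integrable lborel {0<..} (\<lambda>u. cdf (conv_pow \<mu> (nat \<lfloor>B y * u\<rfloor>)) y)"
    and "(LBINT u:{0<..}. cdf (conv_pow \<mu> (nat \<lfloor>B y * u\<rfloor>)) y) = renewal_fun \<mu> y / B y"
proof -
  have B: "0 < B y" using B_ge_1[OF y] by simp
  have nn: "0 \<le> cdf (conv_pow \<mu> n) y" for n by (simp add: cdf_def)
  have "summable (\<lambda>n. cdf (conv_pow \<mu> n) y)"
  proof (rule summable_comparison_test')
    show "summable (\<lambda>n. cdf \<mu> y ^ n)"
      using F law.cdf_nonneg[of y] by (intro summable_geometric) (simp add: Fbar_def)
    show "norm (cdf (conv_pow \<mu> n) y) \<le> cdf \<mu> y ^ n" if "0 \<le> n" for n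
      using cdf_conv_pow_le[OF law law_nonneg, of n y] nn[of n] by simp
  qed
  note step = integral_step_function[of "B y" "\<lambda>n. cdf (conv_pow \<mu> n) y", OF B nn this]
  show "set_integrable lborel {0<..} (\<lambda>u. cdf (conv_pow \<mu> (nat \<lfloor>B y * u\<rfloor>)) y)" by (rule step(1))
  show "(LBINT u:{0<..}. cdf (conv_pow \<mu> (nat \<lfloor>B y * u\<rfloor>)) y) = renewal_fun \<mu> y / B y"
    unfolding renewal_fun_def by (rule step(2))
qed

theorem renewal_asymptotics:
  "((\<lambda>y. \<bar>y powr (- \<alpha>) * ell \<alpha> l1 y * renewal_fun \<mu> y
      - \<alpha> * (LBINT x:{0<..}. cdf (V (pos_param k (B y * x powr (- \<alpha>)))) x * x powr (- \<alpha> - 1))\<bar>) \<longlongrightarrow> 0) at_top"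
proof -
  define S where "S y u = cdf (conv_pow \<mu> (nat \<lfloor>B y * u\<rfloor>)) y" for y u
  obtain \<kappa> where \<kappa>: "0 < \<kappa>"
    and S_bound: "\<forall>\<^sub>F y in at_top. 0 < Fbar y \<and> (\<forall>u>0. S y u \<le> exp \<kappa> * exp (- \<kappa> * u))"
    unfolding S_def using cdf_conv_pow_exp_bound by blast
  obtain D where D: "0 < D" "\<And>b u. 0 < b \<Longrightarrow> 0 < u \<Longrightarrow> G b u \<le> majorant D u"
    using G_bound by blast
  have good: "\<forall>\<^sub>F y in at_top. 0 < y \<and> 0 < Fbar y \<and> 0 < B y \<and> (\<forall>u>0. S y u \<le> exp \<kappa> * exp (- \<kappa> * u))"
    using S_bound eventually_gt_at_top[of 0]
  proof eventually_elim
    case (elim y)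
    then show ?case using B_ge_1[of y] by simp
  qed
  define I where "I y = (LBINT u. indicator {0<..} u * (S y u - G (B y) u))" for y
  \<comment> \<open>For small \<open>y\<close> the renewal series may diverge; there the integrand is replaced by \<open>0\<close>, which makes it
    measurable for every \<open>y\<close>.\<close>
  define f where "f y u = (if 0 < y \<and> 0 < Fbar y then indicator {0<..} u * (S y u - G (B y) u) else 0)" for y u
  have f_meas: "f y \<in> borel_measurable lborel" for y
  proof (cases "0 < y \<and> 0 < Fbar y")
    case True
    then have "set_integrable lborel {0<..} (\<lambda>u. S y u - G (B y) u)"
      unfolding S_def using B_ge_1[of y] by (intro set_integral_diff(1) renewal_integral(1) G_integrable) auto
    moreover have "f y = (\<lambda>u. indicator {0<..} u *\<^sub>R (S y u - G (B y) u))"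
      using True by (simp add: f_def fun_eq_iff)
    ultimately show ?thesis unfolding set_integrable_def by (simp only: borel_measurable_integrable)
  next
    case False
    then have "f y = (\<lambda>u. 0)" by (auto simp: f_def fun_eq_iff)
    then show ?thesis by simp
  qed
  define w where "w u = indicator {0<..} u * (exp \<kappa> * exp (- \<kappa> * u))
      + indicator {0<..} u * majorant D u" for u :: real
  have w: "integrable lborel w"
    unfolding w_def by (intro Bochner_Integration.integrable_add dominating_integrable[OF \<kappa> D(1)])
  have "((\<lambda>y. integral\<^sup>L lborel (f y)) \<longlongrightarrow> integral\<^sup>L lborel (\<lambda>_::real. 0::real)) at_top"
  proof (rule integral_dominated_convergence_at_top[OF _ f_meas w])
    show "\<forall>\<^sub>F y in at_top. AE u in lborel. norm (f y u) \<le> w u"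
      using good
    proof eventually_elim
      case (elim y)
      have "norm (f y u) \<le> w u" for u
      proof (cases "0 < u")
        case True
        have "0 \<le> S y u" by (simp add: S_def cdf_def)
        moreover have "S y u \<le> exp \<kappa> * exp (- \<kappa> * u)" using elim True by blast
        moreover have "0 \<le> G (B y) u" "G (B y) u \<le> majorant D u"
          using G_nonneg[OF _ True] D(2)[OF _ True] elim by blast+
        moreover have "norm (f y u) = \<bar>S y u - G (B y) u\<bar>" using True elim by (simp add: f_def)
        moreover have "w u = exp \<kappa> * exp (- \<kappa> * u) + majorant D u"
          unfolding w_def using True by simp
        ultimately show ?thesis by linarith
      qed (simp add: f_def w_def)
      then show ?case by (intro AE_I2)
    qed
    show "AE u in lborel. ((\<lambda>y. f y u) \<longlongrightarrow> 0) at_top"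
    proof (rule AE_I2)
      fix u :: real
      show "((\<lambda>y. f y u) \<longlongrightarrow> 0) at_top"
      proof (cases "0 < u")
        case True
        have "\<forall>\<^sub>F y in at_top. S y u - G (B y) u = f y u"
          using good by eventually_elim (simp add: f_def True)
        with merging[OF True] show ?thesis unfolding S_def[symmetric] by (rule Lim_transform_eventually)
      next
        case False
        then have "f y u = 0" for y by (simp add: f_def)
        then show ?thesis by simp
      qed
    qed
  qed simp
  then have lim: "((\<lambda>y. \<bar>integral\<^sup>L lborel (f y)\<bar>) \<longlongrightarrow> 0) at_top" using tendsto_rabs_zero by simp
  have "\<forall>\<^sub>F y in at_top. \<bar>integral\<^sup>L lborel (f y)\<bar> = \<bar>y powr (- \<alpha>) * ell \<alpha> l1 y * renewal_fun \<mu> y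
      - \<alpha> * (LBINT x:{0<..}. cdf (V (pos_param k (B y * x powr (- \<alpha>)))) x * x powr (- \<alpha> - 1))\<bar>"
    using good
  proof eventually_elim
    case (elim y)
    then have y: "0 < y" and F: "0 < Fbar y" and B: "0 < B y" by auto
    have "integral\<^sup>L lborel (f y) = (LBINT u:{0<..}. S y u - G (B y) u)"
      using y F by (simp add: f_def[abs_def] set_lebesgue_integral_def)
    also have "\<dots> = (LBINT u:{0<..}. S y u) - (LBINT u:{0<..}. G (B y) u)"
      unfolding S_def by (rule set_integral_diff(2)[OF renewal_integral(1)[OF y F] G_integrable[OF B]])
    also have "(LBINT u:{0<..}. S y u) = renewal_fun \<mu> y / B y"
      unfolding S_def by (rule renewal_integral(2)[OF y F])
    also have "\<dots> = y powr (- \<alpha>) * ell \<alpha> l1 y * renewal_fun \<mu> y"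
      using ell_over_powr[OF y] by (simp add: powr_minus divide_inverse mult_ac)
    also have "(LBINT u:{0<..}. G (B y) u) = (LBINT u:{0<..}. indicator {0<..} u * G (B y) u)"
      by (intro set_lebesgue_integral_cong) auto
    also have "\<dots> = \<alpha> * (LBINT x:{0<..}. indicator {0<..} (x powr (- \<alpha>)) * G (B y) (x powr (- \<alpha>)) * x powr (- \<alpha> - 1))"
    proof (rule powr_substitution[symmetric, OF alpha_pos G_measurable[OF B]])
      have "(\<lambda>u. indicat_real {0<..} u *\<^sub>R (indicator {0<..} u * G (B y) u)) = (\<lambda>u. indicat_real {0<..} u *\<^sub>R G (B y) u)"
        by (auto simp: indicator_def)
      then show "set_integrable lborel {0<..} (\<lambda>u. indicator {0<..} u * G (B y) u)"
        using G_integrable[OF B] unfolding set_integrable_def by simp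
    qed
    also have "(LBINT x:{0<..}. indicator {0<..} (x powr (- \<alpha>)) * G (B y) (x powr (- \<alpha>)) * x powr (- \<alpha> - 1))
        = (LBINT x:{0<..}. cdf (V (pos_param k (B y * x powr (- \<alpha>)))) x * x powr (- \<alpha> - 1))"
      using alpha_pos by (intro set_lebesgue_integral_cong) (auto simp: G_def powr_powr)
    finally show ?case by simp
  qed
  with lim show ?thesis by (rule Lim_transform_eventually)
qed

end

section \<open>The renewal theorem\<close>

theorem theorem7:
  fixes \<alpha> c :: real
    and k :: "nat \<Rightarrow> nat"
    and l1 M h :: "real \<Rightarrow> real"
    and \<Lambda> V :: "real \<Rightarrow> real measure"
    and P :: "'a measure" and X :: "'a \<Rightarrow> real"
  assumes "0 < \<alpha>" and "\<alpha> < 1" and "c > 1"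
    and "k 0 = 0" and "strict_mono k"
    and "(\<lambda>n. real (k (Suc n)) / real (k n)) \<longlonglongrightarrow> c"
    and "slowly_varying_from 1 l1"
    and M_bounds: "\<exists>m>0. \<exists>K. \<forall>x>0. m \<le> M x \<and> M x \<le> K"
    and M_rcont: "\<forall>x>0. continuous (at_right x) M"
    and M_nonconst: "\<exists>x>0. \<exists>y>0. M x \<noteq> M y"
    and M_periodic: "\<forall>x>0. M (c powr (1 / \<alpha>) * x) = M x"
    and M_mono: "antimono_on {0<..} (\<lambda>x. M x * x powr (- \<alpha>))"
    and tail_measure: "\<And>lam. lam > 0 \<Longrightarrow> is_tail_measure \<alpha> M lam (\<Lambda> lam)"
    and V_law: "\<And>lam. lam > 0 \<Longrightarrow> real_distribution (V lam)"
    and V_char: "\<And>lam t. lam > 0 \<Longrightarrow>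
          char (V lam) t = exp (CLINT x:{0<..}|\<Lambda> lam. (iexp (t * x) - 1))"
    and "prob_space P" and "X \<in> borel_measurable P" and "AE \<omega> in P. 0 \<le> X \<omega>"
    and tail: "\<forall>\<^sub>F x in at_top.
          1 - cdf (distr P borel X) x
            = ell \<alpha> l1 x / x powr \<alpha> * (M (delta \<alpha> l1 k x) + h x)"
    and h_rcont: "\<forall>x>0. continuous (at_right x) h"
    and h_lim: "\<And>x. x > 0 \<Longrightarrow> isCont M x \<Longrightarrow>
          (\<lambda>n. h (norming \<alpha> l1 (real (k n)) * x)) \<longlonglongrightarrow> 0"
  shows "((\<lambda>y. \<bar>y powr (- \<alpha>) * ell \<alpha> l1 y * renewal_fun (distr P borel X) y
            - \<alpha> * (LBINT x:{0<..}.
                cdf (V (pos_param k (inv_norming \<alpha> l1 y * x powr (- \<alpha>)))) x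
                  * x powr (- \<alpha> - 1))\<bar>) \<longlongrightarrow> 0) at_top"
proof -
  interpret P: prob_space P by fact
  interpret semistable_renewal \<alpha> l1 c k M h "distr P borel X" \<Lambda> V
  proof (intro semistable_renewal.intro semistable_tail.intro regular_norming.intro
      semistable_tail_axioms.intro semistable_renewal_axioms.intro)
    show "real_distribution (distr P borel X)"
      using assms by (intro P.real_distribution_distr)
    show "AE x in distr P borel X. 0 \<le> x"
      using assms by (subst AE_distr_iff) auto
  qed (fact assms)+
  show ?thesis by (rule renewal_asymptotics)
qed

end
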